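(* Let $G\subset\mathcal{PGL}(3)$ be a closed algebraic subgroup with $\dim G>0$ acting on $\mathbb{C}^2$, with a chosen classifying set of rational differential invariants $\mathcal{I}=\{K_1,K_2\}$. Let $d$ be sufficiently large so that a generic curve of degree $d$ is non-exceptional with respect to $\mathcal{I}$, let $S(\mathbf{c},\kappa_1,\kappa_2)$ be the super-signature polynomial for polynomials of degree $d$, and let $D$ be the degree of $S$ in the variables $(\kappa_1,\kappa_2)$. Then for a generic curve of degree $d$, the degree of its signature polynomial equals $D$. Moreover, for any non-exceptional irreducible curve $X\subset \mathbb{C}^2$ of degree greater than one and at most $d$ that has a signature polynomial, the degree of its signature polynomial is less than or equal to $D$.
   Context: Everything is over $\mathbb{C}$ with the Zariski topology. A property holds for a generic curve of degree $d$ if it holds for $V(F)$ for all $F$ in some nonempty Zariski-open subset of $\mathbb{C}[x,y]_{\le d}$. Action. An element $g\in\mathcal{PGL}(3)$ is represented by an invertible $3\times3$ complex matrix $A_g$, defined up to scaling. $G$ acts rationally on $\mathbb{C}^2$ by $g\cdot(x,y)=(\phi_1/\phi_0,\phi_2/\phi_0)$, where $(\phi_0,\phi_1,\phi_2)^T=A_g(1,x,y)^T$. Jets and invariants. $J^n=\mathbb{C}^{n+2}$ has coordinates $(x,y,y^{(1)},\dots,y^{(n)})$, $y^{(0)}=y$. The total derivative $\frac{d}{dx}:\mathbb{C}(J^n)\to\mathbb{C}(J^{n+1})$ is the $\mathbb{C}$-linear derivation with $\frac{d}{dx}x=1$, $\frac{d}{dx}y^{(k)}=y^{(k+1)}$.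 With $(\bar x,\bar y)=g\cdot(x,y)$, the prolonged action on $J^n$ is $g\cdot(x,y,\dots,y^{(n)})=(\bar x,\bar y,\bar y^{(1)},\dots,\bar y^{(n)})$, $\bar y^{(k+1)}=\frac{d\bar y^{(k)}}{dx}\big/\frac{d\bar x}{dx}$ for $k\ge0$ ($g$ treated as constant). The order of a rational function $K$ on $J^n$ is the largest $k$ with $\partial K/\partial y^{(k)}\neq0$. $K$ is a rational differential invariant if $K(g\cdot p)=K(p)$ whenever both sides are defined. A set $\mathcal{J}$ of rational invariants separates orbits on a nonempty Zariski-open set $W$ (a domain of separation) if for all $p,q\in W$: $q\in Gp\Leftrightarrow K(p)=K(q)$ for all $K\in\mathcal{J}$. With $r=\dim G$, a pair $\mathcal{I}=\{K_1,K_2\}$ of rational differential invariants of orders $k<r$ and $r$ is classifying if $K_1$ separates orbits on a nonempty Zariski-open subset of $J^k$ and $\mathcal{I}$ separates orbits on a nonempty Zariski-open subset of $J^r$. Restriction to curves. Let $X=V(F)$ with $F$ irreducible. At $p=(p_1,p_2)\in X$ with $F_y(p)\ne0$, $X$ is locally the graph of an analytic function $y=f(x)$; set $y^{(n)}_X(p)=f^{(n)}(p_1)$ (a rational function on $X$), $j^n_X(p)=(p_1,p_2,y_X^{(1)}(p),\dots,y_X^{(n)}(p))$, $K|_X=K\circ j^n_X$. Fix maximal domains of separation $W_1\subset J^k$ for $\{K_1\}$ and $W_2\subset J^r$ for $\mathcal{I}$. A point $p\in X$ is $\mathcal{I}$-regular if (a) $j^r_X(p)$ is defined (equivalently $F_y(p)\ne0$);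 (b) $j^k_X(p)\in W_1$ and $j^r_X(p)\in W_2$; (c) $\frac{\partial K_1}{\partial y^{(k)}}\big|_{j^k_X(p)}\ne0$ if $K_1$ is constant on $X$, and $\frac{\partial K_2}{\partial y^{(r)}}\big|_{j^r_X(p)}\neq0$ otherwise. $X$ is non-exceptional with respect to $\mathcal{I}$ if all but finitely many of its points are $\mathcal{I}$-regular. The signature map is $\sigma_X=(K_1|_X,K_2|_X):X\dashrightarrow\mathbb{C}^2$. When $\overline{\sigma_X(X)}$ has dimension 1 it is an irreducible plane curve, and the signature polynomial $S_X(\kappa_1,\kappa_2)$ is an irreducible polynomial vanishing on it (unique up to scaling). Super-signature. Let $N=\binom{d+2}{2}$, $\mathbf{c}=(c_{ij})_{i+j\le d}\in\mathbb{C}^N$, and $F(\mathbf{c},x,y)=\sum_{i+j\le d}c_{ij}x^iy^j\in\mathbb{C}[\mathbf{c},x,y]$, with specialization $F_{\mathbf{c}}\in\mathbb{C}[x,y]_{\le d}$. Let $\mathcal{Y}=V(F)=\{(\mathbf{c},x,y): F_{\mathbf c}(x,y)=0\}\subset\mathbb{C}^N\times\mathbb{C}^2$. Let $j^n(F):\mathcal{Y}\dashrightarrow\mathbb{C}^{n+2}$ be the rational map $(x,y,y^{(1)},\dots,y^{(n)})$ whose components are obtained by implicit differentiation with $\mathbf{c}$ treated as parameters: $y^{(1)}=-F_x/F_y$, $y^{(m+1)}=\partial_xy^{(m)}+y^{(1)}\partial_yy^{(m)}$. Put $K|_F=K\circ j^n(F)$ and $\sigma:\mathcal{Y}\dashrightarrow\mathbb{C}^N\times\mathbb{C}^2$,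 $\sigma(\mathbf{c},x,y)=(\mathbf{c},K_1|_F(\mathbf{c},x,y),K_2|_F(\mathbf{c},x,y))$. The super-signature polynomial $S(\mathbf{c},\kappa_1,\kappa_2)\in\mathbb{C}[\mathbf{c},\kappa_1,\kappa_2]$ is the minimal polynomial vanishing on $\sigma(\mathcal{Y})$. *)

theory Defs
  imports
    "HOL-Analysis.Analysis"
    "HOL-Library.Poly_Mapping"
    "HOL-Library.Nat_Bijection"
    "HOL-Computational_Algebra.Fraction_Field"
    "HOL-Computational_Algebra.Factorial_Ring"
    "HOL-Algebra.Coset"
begin

section \<open>Multivariate polynomials and rational functions over the complex numbers\<close>

type_synonym 'v cpoly = "('v \<Rightarrow>\<^sub>0 nat) \<Rightarrow>\<^sub>0 complex"
type_synonym ratfun = "nat cpoly fract"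

definition cconst :: "complex \<Rightarrow> 'v cpoly" where
  "cconst a = Poly_Mapping.single 0 a"

definition cvar :: "'v \<Rightarrow> 'v cpoly" where
  "cvar i = Poly_Mapping.single (Poly_Mapping.single i 1) 1"

definition peval :: "('v \<Rightarrow> complex) \<Rightarrow> 'v cpoly \<Rightarrow> complex" where
  "peval a p = (\<Sum>m\<in>Poly_Mapping.keys p.
     Poly_Mapping.lookup p m * (\<Prod>i\<in>Poly_Mapping.keys m. a i ^ Poly_Mapping.lookup m i))"

definition pvars :: "'v cpoly \<Rightarrow> 'v set" where
  "pvars p = (\<Union>m\<in>Poly_Mapping.keys p. Poly_Mapping.keys m)"

text \<open>Degree in the variables belonging to V; the zero polynomial gets degree 0.\<close>

definition degree_in :: "'v set \<Rightarrow> 'v cpoly \<Rightarrow> nat" where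
  "degree_in V p = Max (insert 0
     ((\<lambda>m. \<Sum>i\<in>Poly_Mapping.keys m \<inter> V. Poly_Mapping.lookup m i) ` Poly_Mapping.keys p))"

abbreviation total_degree :: "'v cpoly \<Rightarrow> nat" where
  "total_degree \<equiv> degree_in UNIV"

definition pderivative :: "'v \<Rightarrow> 'v cpoly \<Rightarrow> 'v cpoly" where
  "pderivative i p = (\<Sum>m\<in>Poly_Mapping.keys p.
     Poly_Mapping.single (m - Poly_Mapping.single i 1)
       (Poly_Mapping.lookup p m * of_nat (Poly_Mapping.lookup m i)))"

text \<open>The \<open>\<complex>\<close>-linear derivation that sends the variable i to v i: on polynomials, and extended to
  rational functions by the quotient rule.\<close>

definition pderivation :: "('v \<Rightarrow> 'v cpoly) \<Rightarrow> 'v cpoly \<Rightarrow> 'v cpoly" where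
  "pderivation v p = (\<Sum>i\<in>pvars p. v i * pderivative i p)"

definition rderivation :: "(nat \<Rightarrow> nat cpoly) \<Rightarrow> ratfun \<Rightarrow> ratfun" where
  "rderivation v K = (THE D. \<exists>a b. b \<noteq> 0 \<and> K = Fract a b \<and>
     D = Fract (pderivation v a * b - a * pderivation v b) (b * b))"

definition rpartial :: "nat \<Rightarrow> ratfun \<Rightarrow> ratfun" where
  "rpartial i = rderivation (\<lambda>j. if j = i then 1 else 0)"

definition rconst :: "complex \<Rightarrow> ratfun" where
  "rconst a = Fract (cconst a) 1"

definition rvar :: "nat \<Rightarrow> ratfun" where
  "rvar i = Fract (cvar i) 1"

definition defined_at :: "ratfun \<Rightarrow> (nat \<Rightarrow> complex) \<Rightarrow> bool" where
  "defined_at K p \<longleftrightarrow> (\<exists>a b. K = Fract a b \<and> peval p b \<noteq> 0)"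

definition rvalue :: "ratfun \<Rightarrow> (nat \<Rightarrow> complex) \<Rightarrow> complex" where
  "rvalue K p = (THE z. \<exists>a b. K = Fract a b \<and> peval p b \<noteq> 0 \<and> z = peval p a / peval p b)"


section \<open>Zariski topology\<close>

text \<open>The affine space with coordinates indexed by I consists of the points that vanish outside I.
  The principal open sets are closed under finite intersections.\<close>

definition affine_space :: "'v set \<Rightarrow> ('v \<Rightarrow> complex) set" where
  "affine_space I = {a. \<forall>i. i \<notin> I \<longrightarrow> a i = 0}"

definition zariski :: "'v set \<Rightarrow> ('v \<Rightarrow> complex) topology" where
  "zariski I = topology_generated_by
     {{a \<in> affine_space I. peval a f \<noteq> 0} | f :: 'v cpoly. pvars f \<subseteq> I}"

definition irreducible_closed :: "'a topology \<Rightarrow> 'a set \<Rightarrow> bool" where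
  "irreducible_closed T Z \<longleftrightarrow> closedin T Z \<and> Z \<noteq> {} \<and>
     (\<forall>A B. closedin T A \<and> closedin T B \<and> Z \<subseteq> A \<union> B \<longrightarrow> Z \<subseteq> A \<or> Z \<subseteq> B)"

text \<open>Krull dimension: the supremum of the lengths of chains of irreducible closed subsets
  (with value 0 on the empty space).\<close>

definition krull_dim :: "'a topology \<Rightarrow> enat" where
  "krull_dim T = Sup {enat n | n. \<exists>Z :: nat \<Rightarrow> 'a set.
     (\<forall>i\<le>n. irreducible_closed T (Z i)) \<and> (\<forall>i<n. Z i \<subset> Z (Suc i))}"


section \<open>The projective linear group\<close>

definition GL3 :: "(complex^3^3) monoid" where
  "GL3 = \<lparr>carrier = {A. invertible A}, mult = (**), one = mat 1\<rparr>"

text \<open>An element of \<open>PGL3\<close> is the set of all its representing matrices.\<close>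

definition PGL3 :: "(complex^3^3) set monoid" where
  "PGL3 = GL3 Mod {mat c | c. c \<noteq> 0}"

definition zariski_GL3 :: "(complex^3^3) topology" where
  "zariski_GL3 = pullback_topology (carrier GL3) (\<lambda>A (i, j). A $ i $ j) (zariski UNIV)"

text \<open>The quotient topology, which is also the topology of \<open>PGL3\<close> as an open subset of the
  projective space of dimension 8. The generating family is already a topology.\<close>

definition zariski_PGL3 :: "(complex^3^3) set topology" where
  "zariski_PGL3 = topology_generated_by
     {U. U \<subseteq> carrier PGL3 \<and> openin zariski_GL3 (\<Union>U)}"


section \<open>Jets, prolonged action, differential invariants\<close>

text \<open>On the jet space of order n, coordinate 0 is x and coordinate \<open>k + 1\<close> is \<open>y\<^sup>(\<^sup>k\<^sup>)\<close>. In
  particular the plane has coordinates \<open>0, 1\<close> and equals the jet space of order 0.\<close>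

abbreviation jet_coords :: "nat \<Rightarrow> nat set" where
  "jet_coords n \<equiv> {..<n + 2}"

abbreviation jet_space :: "nat \<Rightarrow> (nat \<Rightarrow> complex) set" where
  "jet_space n \<equiv> affine_space (jet_coords n)"

definition jet_point :: "nat \<Rightarrow> complex \<Rightarrow> (nat \<Rightarrow> complex) \<Rightarrow> nat \<Rightarrow> complex" where
  "jet_point n x y = (\<lambda>i. if i = 0 then x else if i < n + 2 then y (i - 1) else 0)"

definition plane_point :: "complex \<Rightarrow> complex \<Rightarrow> nat \<Rightarrow> complex" where
  "plane_point x y = jet_point 0 x (\<lambda>_. y)"

definition total_derivative :: "ratfun \<Rightarrow> ratfun" where
  "total_derivative = rderivation (\<lambda>i. if i = 0 then 1 else cvar (i + 1))"

text \<open>Row and column indices 1, 2, 3 of \<open>A\<close> correspond to \<open>(\<phi>\<^sub>0, \<phi>\<^sub>1, \<phi>\<^sub>2)\<close> and \<open>(1, x, y)\<close>.\<close>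

definition phi :: "complex^3^3 \<Rightarrow> 3 \<Rightarrow> ratfun" where
  "phi A i = rconst (A $ i $ 1) + rconst (A $ i $ 2) * rvar 0 + rconst (A $ i $ 3) * rvar 1"

definition xbar :: "complex^3^3 \<Rightarrow> ratfun" where
  "xbar A = phi A 2 / phi A 1"

fun ybar :: "complex^3^3 \<Rightarrow> nat \<Rightarrow> ratfun" where
  "ybar A 0 = phi A 3 / phi A 1"
| "ybar A (Suc k) = total_derivative (ybar A k) / total_derivative (xbar A)"

definition prolonged_defined :: "nat \<Rightarrow> complex^3^3 \<Rightarrow> (nat \<Rightarrow> complex) \<Rightarrow> bool" where
  "prolonged_defined n A p \<longleftrightarrow> defined_at (xbar A) p \<and> (\<forall>m\<le>n. defined_at (ybar A m) p)"

definition prolonged_action ::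
    "nat \<Rightarrow> complex^3^3 \<Rightarrow> (nat \<Rightarrow> complex) \<Rightarrow> (nat \<Rightarrow> complex)" where
  "prolonged_action n A p = jet_point n (rvalue (xbar A) p) (\<lambda>m. rvalue (ybar A m) p)"

definition orbit :: "(complex^3^3) set set \<Rightarrow> nat \<Rightarrow> (nat \<Rightarrow> complex) \<Rightarrow> (nat \<Rightarrow> complex) set" where
  "orbit G n p = {prolonged_action n A p | A g. g \<in> G \<and> A \<in> g \<and> prolonged_defined n A p}"

definition has_order :: "ratfun \<Rightarrow> nat \<Rightarrow> bool" where
  "has_order K k \<longleftrightarrow> rpartial (k + 1) K \<noteq> 0 \<and> (\<forall>j>k. rpartial (j + 1) K = 0)"

definition differential_invariant :: "(complex^3^3) set set \<Rightarrow> nat \<Rightarrow> ratfun \<Rightarrow> bool" where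
  "differential_invariant G n K \<longleftrightarrow>
     (\<forall>g\<in>G. \<forall>A\<in>g. \<forall>p\<in>jet_space n.
        prolonged_defined n A p \<and> defined_at K (prolonged_action n A p) \<and> defined_at K p \<longrightarrow>
        rvalue K (prolonged_action n A p) = rvalue K p)"

definition separates_orbits ::
    "(complex^3^3) set set \<Rightarrow> nat \<Rightarrow> ratfun set \<Rightarrow> (nat \<Rightarrow> complex) set \<Rightarrow> bool" where
  "separates_orbits G n \<J> W \<longleftrightarrow>
     openin (zariski (jet_coords n)) W \<and> W \<noteq> {} \<and>
     (\<forall>K\<in>\<J>. \<forall>p\<in>W. defined_at K p) \<and>
     (\<forall>p\<in>W. \<forall>q\<in>W. q \<in> orbit G n p \<longleftrightarrow> (\<forall>K\<in>\<J>. rvalue K p = rvalue K q))"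

definition maximal_domain ::
    "(complex^3^3) set set \<Rightarrow> nat \<Rightarrow> ratfun set \<Rightarrow> (nat \<Rightarrow> complex) set \<Rightarrow> bool" where
  "maximal_domain G n \<J> W \<longleftrightarrow> separates_orbits G n \<J> W \<and>
     (\<forall>W'. separates_orbits G n \<J> W' \<and> W \<subseteq> W' \<longrightarrow> W' = W)"

definition classifying ::
    "(complex^3^3) set set \<Rightarrow> nat \<Rightarrow> nat \<Rightarrow> ratfun \<Rightarrow> ratfun \<Rightarrow> bool" where
  "classifying G k r K1 K2 \<longleftrightarrow>
     k < r \<and> has_order K1 k \<and> has_order K2 r \<and>
     differential_invariant G k K1 \<and> differential_invariant G r K2 \<and>
     (\<exists>W. separates_orbits G k {K1} W) \<and> (\<exists>W. separates_orbits G r {K1, K2} W)"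


section \<open>Plane curves and their signatures\<close>

text \<open>An irreducible plane curve is given by an irreducible polynomial \<open>F\<close> in the variables 0, 1.\<close>

definition irreducible_curve :: "nat cpoly \<Rightarrow> bool" where
  "irreducible_curve F \<longleftrightarrow> pvars F \<subseteq> {0, 1} \<and> irreducible F"

definition curve :: "nat cpoly \<Rightarrow> (nat \<Rightarrow> complex) set" where
  "curve F = {p \<in> affine_space {0, 1}. peval p F = 0}"

definition local_graph :: "nat cpoly \<Rightarrow> (nat \<Rightarrow> complex) \<Rightarrow> (complex \<Rightarrow> complex) \<Rightarrow> bool" where
  "local_graph F p f \<longleftrightarrow> f analytic_on {p 0} \<and>
     (\<forall>\<^sub>F (x, y) in nhds (p 0, p 1). peval (plane_point x y) F = 0 \<longleftrightarrow> y = f x)"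

text \<open>The value of \<open>y\<^sup>(\<^sup>m\<^sup>)\<close> on the curve at p; meaningful where the curve has a nonvertical tangent,
  so that the germ of the graph function exists and is unique.\<close>

definition y_curve :: "nat cpoly \<Rightarrow> nat \<Rightarrow> (nat \<Rightarrow> complex) \<Rightarrow> complex" where
  "y_curve F m p = (deriv ^^ m) (SOME f. local_graph F p f) (p 0)"

definition jet_defined :: "nat cpoly \<Rightarrow> (nat \<Rightarrow> complex) \<Rightarrow> bool" where
  "jet_defined F p \<longleftrightarrow> p \<in> curve F \<and> peval p (pderivative 1 F) \<noteq> 0"

definition jet :: "nat cpoly \<Rightarrow> nat \<Rightarrow> (nat \<Rightarrow> complex) \<Rightarrow> (nat \<Rightarrow> complex)" where
  "jet F n p = jet_point n (p 0) (\<lambda>m. y_curve F m p)"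

definition restriction_defined :: "ratfun \<Rightarrow> nat \<Rightarrow> nat cpoly \<Rightarrow> (nat \<Rightarrow> complex) \<Rightarrow> bool" where
  "restriction_defined K n F p \<longleftrightarrow> jet_defined F p \<and> defined_at K (jet F n p)"

definition restriction :: "ratfun \<Rightarrow> nat \<Rightarrow> nat cpoly \<Rightarrow> (nat \<Rightarrow> complex) \<Rightarrow> complex" where
  "restriction K n F p = rvalue K (jet F n p)"

definition constant_on_curve :: "ratfun \<Rightarrow> nat \<Rightarrow> nat cpoly \<Rightarrow> bool" where
  "constant_on_curve K n F \<longleftrightarrow>
     (\<exists>z. \<forall>p. restriction_defined K n F p \<longrightarrow> restriction K n F p = z)"

text \<open>The partial derivatives are only evaluated where they are defined: the invariants are defined
  on \<open>W1\<close> and \<open>W2\<close>.\<close>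

definition regular_point ::
    "nat \<Rightarrow> nat \<Rightarrow> ratfun \<Rightarrow> ratfun \<Rightarrow> (nat \<Rightarrow> complex) set \<Rightarrow> (nat \<Rightarrow> complex) set \<Rightarrow>
     nat cpoly \<Rightarrow> (nat \<Rightarrow> complex) \<Rightarrow> bool" where
  "regular_point k r K1 K2 W1 W2 F p \<longleftrightarrow>
     jet_defined F p \<and>
     jet F k p \<in> W1 \<and> jet F r p \<in> W2 \<and>
     (if constant_on_curve K1 k F
      then rvalue (rpartial (k + 1) K1) (jet F k p) \<noteq> 0
      else rvalue (rpartial (r + 1) K2) (jet F r p) \<noteq> 0)"

definition non_exceptional ::
    "nat \<Rightarrow> nat \<Rightarrow> ratfun \<Rightarrow> ratfun \<Rightarrow> (nat \<Rightarrow> complex) set \<Rightarrow> (nat \<Rightarrow> complex) set \<Rightarrow>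
     nat cpoly \<Rightarrow> bool" where
  "non_exceptional k r K1 K2 W1 W2 F \<longleftrightarrow>
     irreducible_curve F \<and> finite {p \<in> curve F. \<not> regular_point k r K1 K2 W1 W2 F p}"

text \<open>The plane of signatures also has the coordinates \<open>\<kappa>\<^sub>1 = 0\<close> and \<open>\<kappa>\<^sub>2 = 1\<close>.\<close>

definition signature_image ::
    "nat \<Rightarrow> nat \<Rightarrow> ratfun \<Rightarrow> ratfun \<Rightarrow> nat cpoly \<Rightarrow> (nat \<Rightarrow> complex) set" where
  "signature_image k r K1 K2 F =
     {plane_point (restriction K1 k F p) (restriction K2 r F p) | p.
        restriction_defined K1 k F p \<and> restriction_defined K2 r F p}"

definition signature_polynomial ::
    "nat \<Rightarrow> nat \<Rightarrow> ratfun \<Rightarrow> ratfun \<Rightarrow> nat cpoly \<Rightarrow> nat cpoly \<Rightarrow> bool" where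
  "signature_polynomial k r K1 K2 F S \<longleftrightarrow>
     irreducible_curve F \<and>
     krull_dim (subtopology (zariski {0, 1})
       (zariski {0, 1} closure_of signature_image k r K1 K2 F)) = 1 \<and>
     pvars S \<subseteq> {0, 1} \<and> irreducible S \<and>
     (\<forall>\<kappa> \<in> zariski {0, 1} closure_of signature_image k r K1 K2 F. peval \<kappa> S = 0)"


section \<open>The universal curve of degree d and the super-signature\<close>

text \<open>The variable \<open>c\<^sub>i\<^sub>j\<close> is numbered so as to avoid the variables 0 and 1, which stand for \<open>x, y\<close>
  in \<open>F(c, x, y)\<close> and for \<open>\<kappa>\<^sub>1, \<kappa>\<^sub>2\<close> in \<open>S(c, \<kappa>\<^sub>1, \<kappa>\<^sub>2)\<close>.\<close>

definition coeff_index :: "nat \<Rightarrow> nat \<Rightarrow> nat" where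
  "coeff_index i j = prod_encode (i, j) + 2"

definition coeff_indices :: "nat \<Rightarrow> nat set" where
  "coeff_indices d = {coeff_index i j | i j. i + j \<le> d}"

definition universal_poly :: "nat \<Rightarrow> nat cpoly" where
  "universal_poly d =
     (\<Sum>(i, j)\<in>{(i, j). i + j \<le> d}. cvar (coeff_index i j) * cvar 0 ^ i * cvar 1 ^ j)"

definition specialization :: "nat \<Rightarrow> (nat \<Rightarrow> complex) \<Rightarrow> nat cpoly" where
  "specialization d c =
     (\<Sum>(i, j)\<in>{(i, j). i + j \<le> d}. cconst (c (coeff_index i j)) * cvar 0 ^ i * cvar 1 ^ j)"

text \<open>Here the space of polynomials of degree at most d is identified with the space of
  coefficient vectors.\<close>

definition generic_curve :: "nat \<Rightarrow> (nat cpoly \<Rightarrow> bool) \<Rightarrow> bool" where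
  "generic_curve d P \<longleftrightarrow>
     (\<exists>U. openin (zariski (coeff_indices d)) U \<and> U \<noteq> {} \<and> (\<forall>c\<in>U. P (specialization d c)))"

definition universal_curve :: "nat \<Rightarrow> (nat \<Rightarrow> complex) set" where
  "universal_curve d = {q \<in> affine_space (coeff_indices d \<union> {0, 1}). peval q (universal_poly d) = 0}"

text \<open>Implicit differentiation with respect to the variables 0, 1; all others are parameters.\<close>

fun y_implicit :: "nat cpoly \<Rightarrow> nat \<Rightarrow> ratfun" where
  "y_implicit F 0 = rvar 1"
| "y_implicit F (Suc 0) = - (Fract (pderivative 0 F) 1 / Fract (pderivative 1 F) 1)"
| "y_implicit F (Suc (Suc m)) = rpartial 0 (y_implicit F (Suc m))
     + y_implicit F (Suc 0) * rpartial 1 (y_implicit F (Suc m))"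

definition super_jet_defined :: "nat \<Rightarrow> nat \<Rightarrow> (nat \<Rightarrow> complex) \<Rightarrow> bool" where
  "super_jet_defined d n q \<longleftrightarrow> q \<in> universal_curve d \<and>
     (\<forall>m\<le>n. defined_at (y_implicit (universal_poly d) m) q)"

definition super_jet :: "nat \<Rightarrow> nat \<Rightarrow> (nat \<Rightarrow> complex) \<Rightarrow> (nat \<Rightarrow> complex)" where
  "super_jet d n q = jet_point n (q 0) (\<lambda>m. rvalue (y_implicit (universal_poly d) m) q)"

definition super_signature_image ::
    "nat \<Rightarrow> nat \<Rightarrow> nat \<Rightarrow> ratfun \<Rightarrow> ratfun \<Rightarrow> (nat \<Rightarrow> complex) set" where
  "super_signature_image d k r K1 K2 =
     {q(0 := rvalue K1 (super_jet d k q), 1 := rvalue K2 (super_jet d r q)) | q.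
        super_jet_defined d k q \<and> defined_at K1 (super_jet d k q) \<and>
        super_jet_defined d r q \<and> defined_at K2 (super_jet d r q)}"

text \<open>The minimal polynomial is the generator of the ideal of all polynomials vanishing on the
  image. For nonempty images it exists if and only if the closure of the image is a hypersurface.\<close>

definition super_signature_polynomial ::
    "nat \<Rightarrow> nat \<Rightarrow> nat \<Rightarrow> ratfun \<Rightarrow> ratfun \<Rightarrow> nat cpoly \<Rightarrow> bool" where
  "super_signature_polynomial d k r K1 K2 S \<longleftrightarrow>
     pvars S \<subseteq> coeff_indices d \<union> {0, 1} \<and> S \<noteq> 0 \<and>
     (\<forall>P. pvars P \<subseteq> coeff_indices d \<union> {0, 1} \<longrightarrow>
        ((\<forall>q\<in>super_signature_image d k r K1 K2. peval q P = 0) \<longleftrightarrow> S dvd P))"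

end

theory Submission
  imports Defs "HOL-Computational_Algebra.Polynomial_Factorial"
    "HOL-Computational_Algebra.Field_as_Ring" "HOL-Computational_Algebra.Fundamental_Theorem_Algebra"
begin

text \<open>Write \<open>D\<close> for the degree of the super-signature polynomial \<open>S\<close> in \<open>(\<kappa>\<^sub>1, \<kappa>\<^sub>2)\<close>.

  Upper bound, for every curve \<open>F\<^sub>c\<close>: move \<open>c\<close> along a line on which \<open>S\<close> does not vanish
  identically and expand \<open>S(c + t w, \<kappa>) = \<Sum>\<^sub>j t\<^sup>j S\<^sub>j(\<kappa>)\<close>. By the implicit function theorem a point of
  \<open>F\<^sub>c\<close> with nonvertical tangent extends to a path of points on the curves with parameter
  \<open>c + t w\<close>, and by continuity the first nonzero \<open>S\<^sub>j\<close> vanishes at its signature. So a nonzero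
  polynomial of degree at most \<open>D\<close> vanishes on the signature of \<open>F\<^sub>c\<close>, and the irreducible signature
  polynomial divides it.

  Lower bound, for generic \<open>c\<close>: as \<open>S\<close> generates the ideal of the super-signature, the monomials of
  degree less than \<open>D\<close> in \<open>K\<^sub>1|\<^sub>F, K\<^sub>2|\<^sub>F\<close> are linearly independent over \<open>\<complex>[c]\<close> modulo \<open>F\<close>. Together
  with the multiples \<open>x\<^sup>i y\<^sup>j F\<close> of bounded degree they give, after clearing denominators, a finite
  independent family of polynomials, and Gaussian elimination shows that such a family stays
  independent under generic specialization. The same argument with the family \<open>1, \<kappa>\<^sub>i\<close> shows that a
  generic signature is not a point, so that a signature polynomial exists.\<close>

text \<open>Substituting a special \<open>c\<close> into \<open>S\<close> may give the zero
  polynomial, so a bound for every curve cannot come from substitution. Dividing by a power of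
  \<open>t\<close> off \<open>t = 0\<close> and passing to the limit repairs this; the limit is
  taken separately at each point of the curve. Vanishing on the curve of \<open>F_c\<close> is not
  by itself a linear condition of fixed size. Irreducibility of \<open>F_c\<close> makes it one: a
  polynomial of degree at most \<open>m\<close> that vanishes there equals \<open>F_c * R\<close>,
  where \<open>R\<close> again has degree at most \<open>m\<close>. Hence a finite set of multiples
  \<open>x^i y^j F\<close>, chosen independently of \<open>c\<close>, suffices. The invariants have
  in general no fraction that is valid at all points where they are defined. A relation checked with
  one fraction is carried to the other points by irreducibility of the universal curve: what holds
  off the zeros of a denominator holds everywhere after clearing denominators. The degree
  \<open>D\<close> enters the lower bound through divisibility: a relation over
  \<open>\<complex>[c]\<close> is a multiple of \<open>S\<close>, and a nonzero multiple has degree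
  at least \<open>D\<close> in the signature variables.\<close>

abbreviation keys :: "('a \<Rightarrow>\<^sub>0 'b::zero) \<Rightarrow> 'a set" where
  "keys \<equiv> Poly_Mapping.keys"

abbreviation lookup :: "('a \<Rightarrow>\<^sub>0 'b::zero) \<Rightarrow> 'a \<Rightarrow> 'b" where
  "lookup \<equiv> Poly_Mapping.lookup"

abbreviation single :: "'a \<Rightarrow> 'b \<Rightarrow> 'a \<Rightarrow>\<^sub>0 'b::zero" where
  "single \<equiv> Poly_Mapping.single"


section \<open>Evaluation and differentiation of polynomials\<close>

lemma poly_mapping_sum_single:
  "p = (\<Sum>m\<in>keys p. single m (lookup p m))"
  by (rule poly_mapping_eqI)
    (auto simp: lookup_sum lookup_single when_def in_keys_iff)

lemma poly_mapping_sum_superset: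
  assumes "finite A" "keys p \<subseteq> A" "\<And>m. g m 0 = 0"
  shows "(\<Sum>m\<in>keys p. g m (lookup p m))
    = (\<Sum>m\<in>A. g m (lookup p m))"
  by (rule sum.mono_neutral_left) (use assms in \<open>auto simp: in_keys_iff\<close>)

lemma prod_keys_superset:
  fixes a :: "'v \<Rightarrow> 'a::comm_semiring_1"
  assumes "finite A" "keys m \<subseteq> A"
  shows "(\<Prod>i\<in>keys m. a i ^ lookup m i)
    = (\<Prod>i\<in>A. a i ^ lookup m i)"
  by (rule prod.mono_neutral_left) (use assms in \<open>auto simp: in_keys_iff\<close>)

lemma peval_add: "peval a (p + q) = peval a p + peval a q"
proof -
  let ?A = "keys p \<union> keys q"
  let ?g = "\<lambda>m c. c * (\<Prod>i\<in>keys m. a i ^ lookup m i)"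
  have e: "peval a r = (\<Sum>m\<in>?A. ?g m (lookup r m))"
    if "keys r \<subseteq> ?A" for r
    unfolding peval_def by (rule poly_mapping_sum_superset) (use that in auto)
  show ?thesis
    by (simp add: e Poly_Mapping.keys_add lookup_add algebra_simps sum.distrib)
qed

lemma peval_0 [simp]: "peval a 0 = 0"
  by (simp add: peval_def)

lemma peval_sum: "peval a (sum f A) = (\<Sum>x\<in>A. peval a (f x))"
  by (induction A rule: infinite_finite_induct) (auto simp: peval_add)

lemma peval_single: "peval a (single m c)
    = c * (\<Prod>i\<in>keys m. a i ^ lookup m i)"
  by (simp add: peval_def)

lemma keys_prod_add:
  fixes a :: "'v \<Rightarrow> 'a::comm_semiring_1"
  shows "(\<Prod>i\<in>keys (m + n). a i ^ lookup (m + n) i)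
   = (\<Prod>i\<in>keys m. a i ^ lookup m i)
     * (\<Prod>i\<in>keys n. a i ^ lookup n i)"
proof -
  let ?A = "keys m \<union> keys n"
  have "(\<Prod>i\<in>keys r. a i ^ lookup r i)
      = (\<Prod>i\<in>?A. a i ^ lookup r i)" if "keys r \<subseteq> ?A" for r
    by (rule prod_keys_superset) (use that in auto)
  from this[of "m + n"] this[of m] this[of n] show ?thesis
    by (simp add: Poly_Mapping.keys_add) (simp add: lookup_add power_add prod.distrib)
qed

lemma peval_mult: "peval a (p * q) = peval a p * peval a q"
proof -
  have "p * q = (\<Sum>m\<in>keys p. single m (lookup p m))
      * (\<Sum>n\<in>keys q. single n (lookup q n))"
    using poly_mapping_sum_single[of p] poly_mapping_sum_single[of q] by simp
  then have "peval a (p * q) = (\<Sum>m\<in>keys p. \<Sum>n\<in>keys q.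
      peval a (single (m + n) (lookup p m * lookup q n)))"
    by (simp add: sum_product mult_single peval_sum)
  then show ?thesis
    by (simp add: peval_single keys_prod_add) (simp add: peval_def sum_product mult_ac)
qed

lemma peval_cconst [simp]: "peval a (cconst c) = c"
  by (simp add: peval_single cconst_def)

lemma cconst_0 [simp]: "cconst 0 = 0" and cconst_1 [simp]: "cconst 1 = 1"
  by (simp_all add: cconst_def)

lemma peval_1 [simp]: "peval a 1 = 1"
  using peval_cconst[of a 1] by simp

lemma peval_cvar [simp]: "peval a (cvar i) = a i"
  by (simp add: peval_single cvar_def)

lemma peval_uminus: "peval a (- p) = - peval a p"
  using peval_add[of a p "- p"] by (simp add: add_eq_0_iff)

lemma peval_diff: "peval a (p - q) = peval a p - peval a q"
  using peval_add[of a p "- q"] by (simp add: peval_uminus)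

lemma peval_power: "peval a (p ^ n) = peval a p ^ n"
  by (induction n) (auto simp: peval_mult)

lemma peval_prod: "peval a (prod f A) = (\<Prod>x\<in>A. peval a (f x))"
  by (induction A rule: infinite_finite_induct) (auto simp: peval_mult)

lemmas peval_simps = peval_add peval_mult peval_uminus peval_diff peval_power peval_sum peval_prod

lemma cconst_mult: "cconst (a * b) = cconst a * cconst b"
  by (simp add: cconst_def mult_single)

lemma cconst_eq_0_iff [simp]: "cconst a = 0 \<longleftrightarrow> a = 0"
  by (metis cconst_0 peval_cconst)

lemma peval_cong:
  assumes "\<And>i. i \<in> pvars p \<Longrightarrow> a i = b i"
  shows "peval a p = peval b p"
  unfolding peval_def
  by (intro sum.cong prod.cong arg_cong2[where f = "(*)"] refl)
    (metis UN_I assms pvars_def)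

lemma single_eq_cconst_prod_cvar:
  "single m c = cconst c * (\<Prod>i\<in>keys m. cvar i ^ lookup m i)"
proof -
  have pw: "cvar i ^ n = single (single i n) 1" for i n
    by (induction n) (simp_all add: cvar_def mult_single flip: single_add)
  have "(\<Prod>i\<in>A. cvar i ^ lookup m i)
      = single (\<Sum>i\<in>A. single i (lookup m i)) 1" for A
    by (induction A rule: infinite_finite_induct) (auto simp: pw mult_single)
  then show ?thesis
    using poly_mapping_sum_single[of m] by (simp add: cconst_def mult_single)
qed

text \<open>Constants and variables generate the polynomials as a ring. Facts about derivatives,
  limits and substitution are checked on these four cases instead of on sums of monomials.\<close>

lemma cpoly_induct [case_names const var add mult]:
  assumes c: "\<And>a. P (cconst a)" and v: "\<And>i. P (cvar i)"
    and a: "\<And>p q. P p \<Longrightarrow> P q \<Longrightarrow> P (p + q)" and m: "\<And>p q. P p \<Longrightarrow> P q \<Longrightarrow> P (p * q)"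
  shows "P p"
proof -
  have 0: "P 0" and 1: "P 1" using c[of 0] c[of 1] by auto
  have pw: "P (cvar i ^ n)" for i n by (induction n) (auto intro: 1 m v)
  have pr: "P (\<Prod>i\<in>A. cvar i ^ f i)" for A f
    by (induction A rule: infinite_finite_induct) (auto intro: 1 m pw)
  have "P (\<Sum>m\<in>A. single m (f m))" for A f
    by (induction A rule: infinite_finite_induct)
      (auto simp: single_eq_cconst_prod_cvar intro!: 0 a m c pr)
  then show ?thesis using poly_mapping_sum_single[of p] by metis
qed

text \<open>Truncated subtraction of \<open>single i 1\<close> is not injective on exponents, but a
  monomial with exponent 0 at \<open>i\<close> carries the factor 0. So only
  \<open>m + single i 1\<close> contributes to the coefficient at \<open>m\<close>.\<close>

lemma lookup_pderivative:
  "lookup (pderivative i p) m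
   = lookup p (m + single i 1) * of_nat (lookup m i + 1)"
proof -
  let ?e = "single i (1::nat)"
  let ?f = "\<lambda>n. lookup (single (n - ?e)
       (lookup p n * of_nat (lookup n i))) m"
  have *: "?f n = 0" if "n \<noteq> m + ?e" for n
  proof (cases "lookup n i = 0")
    case False
    have "n - ?e \<noteq> m"
    proof
      assume e: "n - ?e = m"
      have "n = m + ?e"
      proof (rule poly_mapping_eqI)
        fix j show "lookup n j = lookup (m + ?e) j"
          using arg_cong[OF e, of "\<lambda>q. lookup q j"] False
          by (cases "i = j") (auto simp: lookup_add lookup_minus lookup_single)
      qed
      with that show False by simp
    qed
    then show ?thesis by (simp add: lookup_single)
  qed simp
  have "lookup (pderivative i p) m = (\<Sum>n\<in>keys p. ?f n)"
    by (simp add: pderivative_def lookup_sum)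
  also have "\<dots> = (\<Sum>n\<in>insert (m + ?e) (keys p). ?f n)"
    by (rule sum.mono_neutral_left) (auto simp: in_keys_iff)
  also have "\<dots> = (\<Sum>n\<in>{m + ?e}. ?f n)"
    by (rule sum.mono_neutral_right) (use * in auto)
  also have "\<dots> = ?f (m + ?e)" by simp
  finally show ?thesis by (simp add: lookup_add)
qed

lemma pderivative_add: "pderivative i (p + q) = pderivative i p + pderivative i q"
  by (rule poly_mapping_eqI) (simp add: lookup_pderivative lookup_add algebra_simps)

lemma pderivative_0 [simp]: "pderivative i 0 = 0"
  by (rule poly_mapping_eqI) (simp add: lookup_pderivative)

lemma pderivative_sum: "pderivative i (sum f A) = (\<Sum>x\<in>A. pderivative i (f x))"
  by (induction A rule: infinite_finite_induct) (auto simp: pderivative_add)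

lemma pderivative_single: "pderivative i (single m c)
    = single (m - single i 1) (c * of_nat (lookup m i))"
  by (simp add: pderivative_def)

lemma pderivative_mult:
  "pderivative i (p * q) = pderivative i p * q + p * pderivative i q"
proof -
  have s: "pderivative i (single m a * single n b)
     = pderivative i (single m a) * single n b
       + single m a * pderivative i (single n b)" for m n a b
  proof -
    let ?e = "single i (1::nat)"
    have 1: "m - ?e + n = m + n - ?e" if "lookup m i \<noteq> 0" for m n :: "'a \<Rightarrow>\<^sub>0 nat"
      by (rule poly_mapping_eqI)
        (use that in \<open>auto simp: lookup_add lookup_minus lookup_single when_def\<close>)
    \<comment> \<open>If the exponent at \<open>i\<close> is 0, the truncated subtraction yields a
      wrong monomial, but then the coefficient is 0 on both sides.\<close>
    have A: "single (m - ?e + n) (a * of_nat (lookup m i) * b)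
       = single (m + n - ?e) (a * of_nat (lookup m i) * b)"
      using 1[of m n] by (cases "lookup m i = 0") simp_all
    have B: "single (m + (n - ?e)) (a * (b * of_nat (lookup n i)))
       = single (m + n - ?e) (a * (b * of_nat (lookup n i)))"
      using 1[of n m] by (cases "lookup n i = 0") (simp_all add: add.commute)
    show ?thesis
      by (simp only: mult_single pderivative_single A B flip: single_add)
        (simp add: lookup_add algebra_simps)
  qed
  let ?s = "\<lambda>p m. single m (lookup p m)"
  have "pderivative i ((\<Sum>m\<in>A. ?s p m) * (\<Sum>n\<in>B. ?s q n))
     = pderivative i (\<Sum>m\<in>A. ?s p m) * (\<Sum>n\<in>B. ?s q n)
       + (\<Sum>m\<in>A. ?s p m) * pderivative i (\<Sum>n\<in>B. ?s q n)" for A B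
    by (simp add: sum_product pderivative_sum s sum.distrib)
  from this[of "keys p" "keys q"] show ?thesis
    by (simp flip: poly_mapping_sum_single)
qed

lemma pderivative_cconst [simp]: "pderivative i (cconst c) = 0"
  by (simp add: cconst_def pderivative_single)

lemma pderivative_cvar: "pderivative i (cvar j) = (if i = j then 1 else 0)"
  by (auto simp: cvar_def pderivative_single lookup_single)

text \<open>The chain rule, proved along the ring operations. Only the coordinates in
  \<open>V\<close> move, and \<open>z\<close> may range over any normed space, so the lemma serves
  lines and graphs as well as maps of two complex variables.\<close>

lemma has_derivative_peval:
  assumes V: "finite V"
    and d: "\<And>i. i \<in> V \<Longrightarrow> ((\<lambda>z. \<gamma> z i) has_derivative \<gamma>' i) (at z within T)"
    and e: "\<And>i z'. i \<notin> V \<Longrightarrow> \<gamma> z' i = \<gamma> z i"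
  shows "((\<lambda>z. peval (\<gamma> z) p) has_derivative
    (\<lambda>h. \<Sum>i\<in>V. \<gamma>' i h * peval (\<gamma> z) (pderivative i p))) (at z within T)"
proof (induction p rule: cpoly_induct)
  case (const a)
  then show ?case by simp
next
  case (var j)
  show ?case
  proof (cases "j \<in> V")
    case True
    have "(\<Sum>i\<in>V. \<gamma>' i h * peval (\<gamma> z) (pderivative i (cvar j))) = \<gamma>' j h" for h
    proof -
      have "(\<Sum>i\<in>V. \<gamma>' i h * peval (\<gamma> z) (pderivative i (cvar j)))
          = (\<Sum>i\<in>V. if i = j then \<gamma>' i h else 0)"
        by (rule sum.cong) (auto simp: pderivative_cvar)
      then show ?thesis using True V by simp
    qed
    then show ?thesis using d[OF True] by simp
  next
    case False
    have "(\<Sum>i\<in>V. \<gamma>' i h * peval (\<gamma> z) (pderivative i (cvar j))) = 0" for h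
      by (rule sum.neutral) (use False in \<open>auto simp: pderivative_cvar\<close>)
    moreover have "(\<lambda>z. peval (\<gamma> z) (cvar j)) = (\<lambda>_. \<gamma> z j)"
      using e[OF False] by auto
    ultimately show ?thesis by simp
  qed
next
  case (add p q)
  show ?case
    using has_derivative_add[OF add]
    by (simp add: peval_add pderivative_add algebra_simps sum.distrib)
next
  case (mult p q)
  show ?case
    using has_derivative_mult[OF mult]
    by (simp add: peval_simps pderivative_mult algebra_simps sum.distrib sum_distrib_left)
qed

text \<open>Induction on a bound for the total degree. The partial derivatives of a polynomial that
  vanishes everywhere vanish everywhere too and have smaller degree, so they are 0; in
  characteristic 0 the polynomial is then constant.\<close>

lemma peval_eq_0_imp_eq_0:
  assumes "\<And>a. peval a p = 0"
  shows "p = 0"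
proof -
  have "\<lbrakk>\<And>m. m \<in> keys p \<Longrightarrow> (\<Sum>i\<in>keys m. lookup m i) \<le> n;
      \<And>a. peval a p = 0\<rbrakk> \<Longrightarrow> p = 0" for n
  proof (induction n arbitrary: p)
    case 0
    have "keys p \<subseteq> {0}"
    proof
      fix m assume "m \<in> keys p"
      then have "\<forall>i. lookup m i = 0"
        using 0(1)[of m] by (auto simp: in_keys_iff)
      then show "m \<in> {0}" by (auto intro: poly_mapping_eqI)
    qed
    then have "p = cconst (lookup p 0)"
      by (intro poly_mapping_eqI)
        (auto simp: cconst_def lookup_single when_def in_keys_iff)
    then show ?case using 0(2) by (metis cconst_0 peval_cconst)
  next
    case (Suc n)
    have d0: "pderivative i p = 0" for i
    proof (rule Suc.IH)
      fix a :: "'a \<Rightarrow> complex"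
      let ?\<gamma> = "\<lambda>z. a(i := z)"
      have "((\<lambda>z. peval (?\<gamma> z) p) has_derivative
        (\<lambda>h. \<Sum>i\<in>{i}. h * peval (?\<gamma> (a i)) (pderivative i p))) (at (a i))"
        using has_derivative_peval[of "{i}" ?\<gamma> "\<lambda>_ h. h" "a i" UNIV p] by auto
      moreover have "((\<lambda>z. peval (?\<gamma> z) p) has_derivative (\<lambda>h. 0)) (at (a i))"
        by (simp add: Suc.prems)
      ultimately have "(\<lambda>h. h * peval a (pderivative i p)) = (\<lambda>h. 0)"
        by (auto dest: has_derivative_unique)
      from fun_cong[OF this, of 1] show "peval a (pderivative i p) = 0" by simp
    next
      fix m assume "m \<in> keys (pderivative i p)"
      let ?m = "m + single i 1"
      have m: "?m \<in> keys p"
        using \<open>m \<in> _\<close> by (auto simp: in_keys_iff lookup_pderivative)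
      let ?A = "insert i (keys m)"
      have "(\<Sum>i\<in>keys ?m. lookup ?m i) = (\<Sum>j\<in>?A. lookup ?m j)"
        by (rule sum.mono_neutral_left)
          (auto simp: in_keys_iff lookup_add lookup_single when_def split: if_splits)
      also have "\<dots> = (\<Sum>j\<in>?A. lookup m j) + 1"
        by (simp add: lookup_add sum.distrib lookup_single when_def)
      also have "(\<Sum>j\<in>?A. lookup m j) = (\<Sum>j\<in>keys m. lookup m j)"
        by (rule sum.mono_neutral_right) (auto simp: in_keys_iff)
      finally show "(\<Sum>j\<in>keys m. lookup m j) \<le> n"
        using Suc.prems(1)[OF m] by simp
    qed
    have "keys p \<subseteq> {0}"
    proof
      fix m assume m: "m \<in> keys p"
      have "lookup m i = 0" for i
      proof (rule ccontr)
        assume i: "lookup m i \<noteq> 0"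
        let ?n = "m - single i 1"
        have "?n + single i 1 = m"
          by (rule poly_mapping_eqI)
            (use i in \<open>auto simp: lookup_add lookup_minus lookup_single when_def\<close>)
        then have "lookup (pderivative i p) ?n \<noteq> 0"
          using m unfolding lookup_pderivative
          by (simp add: in_keys_iff del: of_nat_Suc of_nat_add)
        then show False using d0 by simp
      qed
      then show "m \<in> {0}" by (auto intro: poly_mapping_eqI)
    qed
    then have "p = cconst (lookup p 0)"
      by (intro poly_mapping_eqI)
        (auto simp: cconst_def lookup_single when_def in_keys_iff)
    then show ?case using Suc.prems(2) by (metis cconst_0 peval_cconst)
  qed
  moreover have "(\<Sum>i\<in>keys m. lookup m i)
      \<le> Max ((\<lambda>m. \<Sum>i\<in>keys m. lookup m i) ` keys p)"
    if "m \<in> keys p" for m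
    using that by simp
  ultimately show ?thesis using assms by blast
qed

lemma peval_eqI: "(\<And>a. peval a p = peval a q) \<Longrightarrow> p = q"
  using peval_eq_0_imp_eq_0[of "p - q"] by (simp add: peval_diff)

section \<open>Degrees and polynomial functions\<close>

definition mdeg :: "'v set \<Rightarrow> ('v \<Rightarrow>\<^sub>0 nat) \<Rightarrow> nat" where
  "mdeg V m = (\<Sum>i\<in>keys m \<inter> V. lookup m i)"

lemma mdeg_superset:
  assumes "finite A" "keys m \<subseteq> A"
  shows "mdeg V m = (\<Sum>i\<in>A \<inter> V. lookup m i)"
  unfolding mdeg_def
  by (rule sum.mono_neutral_left) (use assms in \<open>auto simp: in_keys_iff\<close>)

lemma mdeg_add: "mdeg V (m + n) = mdeg V m + mdeg V n"
proof -
  let ?A = "keys m \<union> keys n"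
  have "mdeg V r = (\<Sum>i\<in>?A \<inter> V. lookup r i)" if "keys r \<subseteq> ?A" for r
    by (rule mdeg_superset) (use that in auto)
  from this[of "m + n"] this[of m] this[of n] show ?thesis
    by (simp add: Poly_Mapping.keys_add) (simp add: lookup_add sum.distrib)
qed

lemma mdeg_eq_0_iff: "mdeg V m = 0 \<longleftrightarrow> keys m \<inter> V = {}"
  by (auto simp: mdeg_def in_keys_iff)

lemma degree_in_mdeg: "degree_in V p = Max (insert 0 (mdeg V ` keys p))"
  by (simp add: degree_in_def mdeg_def)

lemma degree_in_le_iff: "degree_in V p \<le> n \<longleftrightarrow> (\<forall>m\<in>keys p. mdeg V m \<le> n)"
  by (simp add: degree_in_mdeg)

lemma mdeg_le_degree_in: "m \<in> keys p \<Longrightarrow> mdeg V m \<le> degree_in V p"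
  using degree_in_le_iff[of V p "degree_in V p"] by simp

lemma degree_in_0 [simp]: "degree_in V 0 = 0"
  by (simp add: degree_in_mdeg)

lemma degree_in_add_le: "\<lbrakk>degree_in V p \<le> n; degree_in V q \<le> n\<rbrakk> \<Longrightarrow> degree_in V (p + q) \<le> n"
  unfolding degree_in_le_iff using Poly_Mapping.keys_add[of p q] by auto

lemma degree_in_sum_le:
  "(\<And>x. x \<in> A \<Longrightarrow> degree_in V (f x) \<le> n) \<Longrightarrow> degree_in V (sum f A) \<le> n"
  by (induction A rule: infinite_finite_induct) (auto intro: degree_in_add_le)

lemma degree_in_mult_le: "degree_in V (p * q) \<le> degree_in V p + degree_in V q"
  unfolding degree_in_le_iff
proof
  fix m assume "m \<in> keys (p * q)"
  then obtain a b where "m = a + b" "a \<in> keys p" "b \<in> keys q"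
    using keys_mult[of p q] by auto
  then show "mdeg V m \<le> degree_in V p + degree_in V q"
    by (simp add: mdeg_add add_mono mdeg_le_degree_in)
qed

lemma degree_in_cconst [simp]: "degree_in V (cconst c) = 0"
  using degree_in_le_iff[of V "cconst c" 0] by (auto simp: cconst_def mdeg_def)

lemma degree_in_1 [simp]: "degree_in V 1 = 0"
  using degree_in_cconst[of V 1] by simp

lemma degree_in_cvar: "degree_in V (cvar i) = (if i \<in> V then 1 else 0)"
  by (simp add: degree_in_mdeg cvar_def mdeg_def)

lemma degree_in_power_le: "degree_in V (p ^ n) \<le> n * degree_in V p"
proof (induction n)
  case (Suc n)
  then show ?case using degree_in_mult_le[of V p "p ^ n"] by simp
qed simp

text \<open>The parts of top degree in \<open>V\<close> have a nonzero product, and no other product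
  of parts reaches that degree. The linear order on the variables provides a monomial order, through
  which polynomials have no zero divisors.\<close>

lemma degree_in_mult:
  fixes p q :: "'v::linorder cpoly"
  assumes "p \<noteq> 0" "q \<noteq> 0"
  shows "degree_in V (p * q) = degree_in V p + degree_in V q"
proof (rule antisym[OF degree_in_mult_le])
  define part where "part = (\<lambda>S (p :: 'v cpoly). \<Sum>m\<in>{m \<in> keys p. S (mdeg V m) (degree_in V p)}.
    single m (lookup p m))"
  have look: "lookup (part S p) m
      = (if S (mdeg V m) (degree_in V p) then lookup p m else 0)" for p m S
  proof -
    have "lookup (part S p) m
      = (\<Sum>n\<in>{n \<in> keys p. S (mdeg V n) (degree_in V p)}.
          if n = m then lookup p m else 0)"
      unfolding part_def lookup_sum by (rule sum.cong) (auto simp: lookup_single)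
    then show ?thesis by (auto simp: in_keys_iff)
  qed
  have split: "p = part (=) p + part (<) p" for p
  proof (rule poly_mapping_eqI)
    fix m show "lookup p m = lookup (part (=) p + part (<) p) m"
      using mdeg_le_degree_in[of m p V]
      by (cases "lookup p m = 0") (auto simp: lookup_add look in_keys_iff)
  qed
  have top: "part (=) p \<noteq> 0" if "p \<noteq> 0" for p
  proof -
    have ne: "keys p \<noteq> {}" using that by simp
    have "\<exists>m\<in>keys p. mdeg V m = degree_in V p"
    proof (cases "degree_in V p = 0")
      case True
      moreover obtain m where "m \<in> keys p" using ne by (meson all_not_in_conv)
      ultimately show ?thesis using mdeg_le_degree_in[of m p V] by auto
    next
      case False
      have "degree_in V p \<in> insert 0 (mdeg V ` keys p)"
        unfolding degree_in_mdeg by (rule Max_in) auto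
      with False show ?thesis by auto
    qed
    then obtain m where "m \<in> keys p" "mdeg V m = degree_in V p" by auto
    then have "lookup (part (=) p) m \<noteq> 0" by (simp add: look in_keys_iff)
    then show ?thesis by auto
  qed
  have keyseq: "mdeg V m = degree_in V p" if "m \<in> keys (part (=) p)" for m p
    using that by (auto simp: in_keys_iff look split: if_splits)
  have keysless: "mdeg V m < degree_in V p" if "m \<in> keys (part (<) p)" for m p
    using that by (auto simp: in_keys_iff look split: if_splits)
  have "part (=) p * part (=) q \<noteq> 0" using top assms by simp
  then obtain m where m: "m \<in> keys (part (=) p * part (=) q)"
    by (meson all_not_in_conv keys_eq_empty)
  then obtain a b where "m = a + b" "a \<in> keys (part (=) p)" "b \<in> keys (part (=) q)"
    using keys_mult by blast
  then have dm: "mdeg V m = degree_in V p + degree_in V q" using keyseq by (simp add: mdeg_add)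
  have low: "lookup (r * s) m = 0"
    if "\<And>a. a \<in> keys r \<Longrightarrow> mdeg V a \<le> i"
      "\<And>a. a \<in> keys s \<Longrightarrow> mdeg V a \<le> j" "i + j < degree_in V p + degree_in V q"
      for r s i j
  proof (rule ccontr)
    assume "\<not> ?thesis"
    then have "m \<in> keys (r * s)" by (simp add: in_keys_iff)
    then obtain a b where "m = a + b" "a \<in> keys r" "b \<in> keys s"
      using keys_mult by blast
    then show False using that(1)[of a] that(2)[of b] that(3) dm by (simp add: mdeg_add)
  qed
  \<comment> \<open>Degree 0 is treated apart: there the lower part is 0, whereas
    \<open>degree_in V p - 1\<close> would not be a strictly smaller bound.\<close>
  have low1: "lookup (part (<) p * q) m = 0"
  proof (cases "degree_in V p = 0")
    case True
    then have "part (<) p = 0" using keysless[of _ p] by (metis all_not_in_conv keys_eq_empty not_less_zero)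
    then show ?thesis by simp
  next
    case False
    show ?thesis
    proof (rule low[of _ "degree_in V p - 1" _ "degree_in V q"])
      show "mdeg V a \<le> degree_in V p - 1" if "a \<in> keys (part (<) p)" for a
        using keysless[OF that] by simp
    qed (use False in \<open>simp_all add: mdeg_le_degree_in\<close>)
  qed
  have low2: "lookup (part (=) p * part (<) q) m = 0"
  proof (cases "degree_in V q = 0")
    case True
    then have "part (<) q = 0" using keysless[of _ q] by (metis all_not_in_conv keys_eq_empty not_less_zero)
    then show ?thesis by simp
  next
    case False
    show ?thesis
    proof (rule low[of _ "degree_in V p" _ "degree_in V q - 1"])
      show "mdeg V a \<le> degree_in V q - 1" if "a \<in> keys (part (<) q)" for a
        using keysless[OF that] by simp
    qed (use False keyseq in \<open>simp_all add: mdeg_le_degree_in\<close>)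
  qed
  have e: "p * q = part (=) p * part (=) q + part (=) p * part (<) q + part (<) p * q"
  proof -
    have "p * q = part (=) p * q + part (<) p * q"
      using split[of p] by (metis distrib_right)
    also have "part (=) p * q = part (=) p * part (=) q + part (=) p * part (<) q"
      using split[of q] by (metis distrib_left)
    finally show ?thesis .
  qed
  have "lookup (p * q) m \<noteq> 0"
    unfolding e using low1 low2 m by (simp add: lookup_add in_keys_iff)
  then show "degree_in V p + degree_in V q \<le> degree_in V (p * q)"
    using mdeg_le_degree_in[of m "p * q" V] dm by (simp add: in_keys_iff)
qed

text \<open>Expressing the occurring variables by a degree lets the degree bounds yield the closure
  rules, and multiplicativity of the degree yields the variables of factors.\<close>

lemma pvars_subset_iff: "pvars p \<subseteq> V \<longleftrightarrow> degree_in (- V) p = 0"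
proof -
  have "degree_in (- V) p = 0 \<longleftrightarrow> (\<forall>m\<in>keys p. mdeg (- V) m = 0)"
    using degree_in_le_iff[of "- V" p 0] by simp
  also have "\<dots> \<longleftrightarrow> pvars p \<subseteq> V" by (auto simp: mdeg_eq_0_iff pvars_def)
  finally show ?thesis by simp
qed

lemma pvars_add: "\<lbrakk>pvars p \<subseteq> V; pvars q \<subseteq> V\<rbrakk> \<Longrightarrow> pvars (p + q) \<subseteq> V"
  unfolding pvars_subset_iff using degree_in_add_le[of "- V" p 0 q] by simp

lemma pvars_sum: "(\<And>x. x \<in> A \<Longrightarrow> pvars (f x) \<subseteq> V) \<Longrightarrow> pvars (sum f A) \<subseteq> V"
  unfolding pvars_subset_iff using degree_in_sum_le[of A "- V" f 0] by simp

lemma pvars_mult: "\<lbrakk>pvars p \<subseteq> V; pvars q \<subseteq> V\<rbrakk> \<Longrightarrow> pvars (p * q) \<subseteq> V"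
  unfolding pvars_subset_iff using degree_in_mult_le[of "- V" p q] by simp

lemma pvars_cconst: "pvars (cconst c) \<subseteq> V"
  unfolding pvars_subset_iff by simp

lemma pvars_cvar: "i \<in> V \<Longrightarrow> pvars (cvar i) \<subseteq> V"
  unfolding pvars_subset_iff by (simp add: degree_in_cvar)

lemma pvars_power: "pvars p \<subseteq> V \<Longrightarrow> pvars (p ^ n) \<subseteq> V"
  unfolding pvars_subset_iff using degree_in_power_le[of "- V" p n] by simp

lemma pvars_prod: "(\<And>x. x \<in> A \<Longrightarrow> pvars (f x) \<subseteq> V) \<Longrightarrow> pvars (prod f A) \<subseteq> V"
  by (induction A rule: infinite_finite_induct)
    (auto simp: pvars_mult pvars_cconst[of 1, simplified])

lemmas pvars_intros = pvars_add pvars_sum pvars_mult pvars_cconst pvars_cvar pvars_power pvars_prod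

lemma pvars_factor:
  fixes p q :: "'v::linorder cpoly"
  assumes "pvars (p * q) \<subseteq> V" "p * q \<noteq> 0"
  shows "pvars p \<subseteq> V" "pvars q \<subseteq> V"
  using assms degree_in_mult[of p q "- V"] unfolding pvars_subset_iff by auto

lemma degree_in_dvd_le:
  fixes p q :: "'v::linorder cpoly"
  assumes "p dvd q" "q \<noteq> 0"
  shows "degree_in V p \<le> degree_in V q"
  using assms degree_in_mult[of p _ V] by (auto elim!: dvdE)

lemma total_degree_eq_0_imp:
  assumes "total_degree p = 0"
  shows "\<exists>c. p = cconst c"
proof -
  have "pvars p \<subseteq> {}" unfolding pvars_subset_iff using assms by simp
  then have "peval a p = peval (\<lambda>_. 0) p" for a by (intro peval_cong) auto
  then have "p = cconst (peval (\<lambda>_. 0) p)" by (intro peval_eqI) simp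
  then show ?thesis by blast
qed

lemma cconst_is_unit_iff: "cconst (c::complex) dvd (1 :: 'v cpoly) \<longleftrightarrow> c \<noteq> 0"
proof
  assume "c \<noteq> 0"
  then have "1 = cconst c * (cconst (1 / c) :: 'v cpoly)" by (simp flip: cconst_mult)
  then show "cconst c dvd (1 :: 'v cpoly)" by (rule dvdI)
next
  assume "cconst c dvd (1 :: 'v cpoly)"
  then show "c \<noteq> 0" by auto
qed

text \<open>Coordinates outside \<open>I\<close> vanish on the affine space, so every variable
  outside \<open>I\<close> may be replaced by 0.\<close>

lemma exists_pvars_subset:
  "\<exists>q. pvars q \<subseteq> I \<and> (\<forall>a\<in>affine_space I. peval a q = peval a p)"
proof (induction p rule: cpoly_induct)
  case (const a)
  show ?case by (rule exI[of _ "cconst a"], rule conjI[OF pvars_cconst]) simp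
next
  case (var i)
  show ?case
  proof (cases "i \<in> I")
    case True
    then show ?thesis by (intro exI[of _ "cvar i"] conjI pvars_cvar) auto
  next
    case False
    then have "\<forall>a\<in>affine_space I. peval a (cconst 0) = peval a (cvar i)"
      by (auto simp: affine_space_def)
    then show ?thesis by (intro exI[of _ "cconst 0"] conjI pvars_cconst)
  qed
next
  case (add p q)
  then obtain p' q' where "pvars p' \<subseteq> I \<and> (\<forall>a\<in>affine_space I. peval a p' = peval a p)"
    "pvars q' \<subseteq> I \<and> (\<forall>a\<in>affine_space I. peval a q' = peval a q)" by auto
  then show ?case by (intro exI[of _ "p' + q'"]) (simp add: pvars_add peval_simps)
next
  case (mult p q)
  then obtain p' q' where "pvars p' \<subseteq> I \<and> (\<forall>a\<in>affine_space I. peval a p' = peval a p)"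
    "pvars q' \<subseteq> I \<and> (\<forall>a\<in>affine_space I. peval a q' = peval a q)" by auto
  then show ?case by (intro exI[of _ "p' * q'"]) (simp add: pvars_mult peval_simps)
qed

lemma peval_restrict:
  assumes "pvars p \<subseteq> I"
  shows "peval (\<lambda>i. if i \<in> I then a i else 0) p = peval a p"
  by (rule peval_cong) (use assms in auto)

lemma eq_0_if_vanishes:
  assumes "pvars p \<subseteq> I" "\<And>a. a \<in> affine_space I \<Longrightarrow> peval a p = 0"
  shows "p = 0"
proof (rule peval_eq_0_imp_eq_0)
  fix a
  have "(\<lambda>i. if i \<in> I then a i else 0) \<in> affine_space I" by (simp add: affine_space_def)
  then show "peval a p = 0" using assms(2) peval_restrict[OF assms(1), of a] by metis
qed

text \<open>A function counts only through its values on the affine space. Denominators can thus be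
  cleared with plain functions, without naming a polynomial at each step; \<open>polyfunE\<close>
  returns to polynomials in the variables of \<open>I\<close>.\<close>

definition polyfun :: "'v set \<Rightarrow> (('v \<Rightarrow> complex) \<Rightarrow> complex) \<Rightarrow> bool" where
  "polyfun I f \<longleftrightarrow> (\<exists>p. \<forall>a\<in>affine_space I. f a = peval a p)"

lemma polyfunE:
  assumes "polyfun I f"
  obtains p where "pvars p \<subseteq> I" "\<And>a. a \<in> affine_space I \<Longrightarrow> f a = peval a p"
  using assms exists_pvars_subset[of I] unfolding polyfun_def by metis

lemma polyfun_const [intro]: "polyfun I (\<lambda>_. c)"
  unfolding polyfun_def by (rule exI[of _ "cconst c"]) simp

lemma polyfun_coord [intro]: "polyfun I (\<lambda>a. a i)"
  unfolding polyfun_def by (rule exI[of _ "cvar i"]) simp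

lemma polyfun_add [intro]: "polyfun I f \<Longrightarrow> polyfun I g \<Longrightarrow> polyfun I (\<lambda>a. f a + g a)"
  unfolding polyfun_def by (metis peval_add)

lemma polyfun_mult [intro]: "polyfun I f \<Longrightarrow> polyfun I g \<Longrightarrow> polyfun I (\<lambda>a. f a * g a)"
  unfolding polyfun_def by (metis peval_mult)

lemma polyfun_diff [intro]: "polyfun I f \<Longrightarrow> polyfun I g \<Longrightarrow> polyfun I (\<lambda>a. f a - g a)"
  unfolding polyfun_def by (metis peval_diff)

lemma polyfun_minus [intro]: "polyfun I f \<Longrightarrow> polyfun I (\<lambda>a. - f a)"
  unfolding polyfun_def by (metis peval_uminus)

lemma polyfun_sum [intro]: "(\<And>x. x \<in> A \<Longrightarrow> polyfun I (f x)) \<Longrightarrow> polyfun I (\<lambda>a. \<Sum>x\<in>A. f x a)"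
  by (induction A rule: infinite_finite_induct) auto

lemma polyfun_power [intro]: "polyfun I f \<Longrightarrow> polyfun I (\<lambda>a. f a ^ n)"
  by (induction n) auto

lemma polyfun_comp_peval:
  "(\<And>i. polyfun I (\<lambda>a. \<phi> a i)) \<Longrightarrow> polyfun I (\<lambda>a. peval (\<phi> a) p)"
  by (induction p rule: cpoly_induct) (auto simp: peval_simps)

lemma polyfun_comp:
  assumes "polyfun J f" "\<And>i. polyfun I (\<lambda>a. \<phi> a i)" "\<And>a. a \<in> affine_space I \<Longrightarrow> \<phi> a \<in> affine_space J"
  shows "polyfun I (\<lambda>a. f (\<phi> a))"
proof -
  obtain p where "\<forall>a\<in>affine_space J. f a = peval a p" using assms(1) unfolding polyfun_def by auto
  then have "\<forall>a\<in>affine_space I. f (\<phi> a) = peval (\<phi> a) p" using assms(3) by auto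
  moreover obtain q where "\<forall>a\<in>affine_space I. peval (\<phi> a) p = peval a q"
    using polyfun_comp_peval[of I \<phi> p, OF assms(2)] unfolding polyfun_def by auto
  ultimately show ?thesis unfolding polyfun_def by auto
qed

text \<open>This is the irreducibility of affine space, obtained from the absence of zero divisors
  among polynomials.\<close>

lemma polyfun_no_zero_divisors:
  fixes f g :: "('v::linorder \<Rightarrow> complex) \<Rightarrow> complex"
  assumes "polyfun I f" "polyfun I g" "\<And>a. a \<in> affine_space I \<Longrightarrow> f a * g a = 0"
  shows "(\<forall>a\<in>affine_space I. f a = 0) \<or> (\<forall>a\<in>affine_space I. g a = 0)"
proof -
  obtain p where p: "pvars p \<subseteq> I" "\<And>a. a \<in> affine_space I \<Longrightarrow> f a = peval a p"
    by (rule polyfunE[OF assms(1)]) (rule that)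
  obtain q where q: "pvars q \<subseteq> I" "\<And>a. a \<in> affine_space I \<Longrightarrow> g a = peval a q"
    by (rule polyfunE[OF assms(2)]) (rule that)
  have "p * q = 0"
    by (rule eq_0_if_vanishes[OF pvars_mult[OF p(1) q(1)]])
      (use p(2) q(2) assms(3) in \<open>simp add: peval_mult\<close>)
  then show ?thesis using p q by auto
qed

section \<open>Irreducible plane curves\<close>

lemma plane_point_simps [simp]:
  "plane_point x y 0 = x" "plane_point x y (Suc 0) = y" "plane_point x y 1 = y"
  "i \<noteq> 0 \<Longrightarrow> i \<noteq> 1 \<Longrightarrow> plane_point x y i = 0"
  by (auto simp: plane_point_def jet_point_def)

lemma plane_point_in_affine_space [simp]:
  "plane_point x y \<in> affine_space {0, 1}" "plane_point x y \<in> affine_space {0, Suc 0}"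
  by (simp_all add: affine_space_def)

lemma plane_point_eta:
  assumes "p \<in> affine_space {0, 1}"
  shows "plane_point (p 0) (p 1) = p"
proof
  fix i :: nat
  consider "i = 0" | "i = 1" | "i \<noteq> 0" "i \<noteq> 1" by blast
  then show "plane_point (p 0) (p 1) i = p i"
    by cases (use assms in \<open>simp_all add: affine_space_def\<close>)
qed

lemma plane_point_eq_iff [simp]: "plane_point x y = plane_point x' y' \<longleftrightarrow> x = x' \<and> y = y'"
proof
  assume "plane_point x y = plane_point x' y'"
  from fun_cong[OF this, of 0] fun_cong[OF this, of 1] show "x = x' \<and> y = y'" by simp
qed auto

section \<open>Bivariate polynomials as polynomials in y over the polynomials in x\<close>

definition poly2 :: "complex poly poly \<Rightarrow> complex \<Rightarrow> complex \<Rightarrow> complex" where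
  "poly2 P x y = poly (poly P [:y:]) x"

lemma poly2_simps [simp]:
  "poly2 0 x y = 0" "poly2 (P + Q) x y = poly2 P x y + poly2 Q x y"
  "poly2 (P * Q) x y = poly2 P x y * poly2 Q x y" "poly2 [:q:] x y = poly q x"
  "poly2 (P - Q) x y = poly2 P x y - poly2 Q x y"
  by (simp_all add: poly2_def)

lemma poly2_sum: "poly2 (sum f A) x y = (\<Sum>a\<in>A. poly2 (f a) x y)"
  by (induction A rule: infinite_finite_induct) auto

lemma poly2_monom: "poly2 (monom (monom c i) j) x y = c * x ^ i * y ^ j"
  by (simp add: poly2_def poly_monom flip: poly_power) (simp add: poly_monom)

text \<open>A nonzero polynomial over the domain of polynomials in \<open>x\<close> has finitely
  many roots in that domain, while here every constant \<open>[:y:]\<close> would be a root.\<close>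

lemma poly2_eq_0_imp_eq_0:
  assumes "\<And>x y. poly2 P x y = 0"
  shows "P = 0"
proof (rule ccontr)
  assume "P \<noteq> 0"
  then have "finite {q. poly P q = 0}" by (rule poly_roots_finite)
  moreover have "poly P [:y:] = 0" for y
    by (rule poly_all_0_iff_0[THEN iffD1]) (use assms in \<open>simp add: poly2_def\<close>)
  then have "range (\<lambda>y. [:y:]) \<subseteq> {q. poly P q = 0}" by auto
  ultimately have "finite (range (\<lambda>y::complex. [:y:]))" by (rule finite_subset[rotated])
  then have "finite (UNIV :: complex set)" by (rule finite_imageD) (auto simp: inj_def)
  then show False using infinite_UNIV_char_0 by blast
qed

lemma poly2_eqI: "(\<And>x y. poly2 P x y = poly2 Q x y) \<Longrightarrow> P = Q"
  using poly2_eq_0_imp_eq_0[of "P - Q"] by simp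

lemma poly_map_poly_poly: "poly (map_poly (\<lambda>q. poly q x) P) y = poly2 P x y"
  by (induction P) (auto simp: poly2_def map_poly_pCons)

text \<open>After substitution of \<open>x\<close> the polynomial in \<open>y\<close> is identically
  0, so every coefficient has the root \<open>x\<close>.\<close>

lemma linear_dvd_if_vanishes:
  assumes "\<And>y. poly2 P x y = 0"
  shows "[:[:-x, 1:]:] dvd P"
proof -
  have "map_poly (\<lambda>q. poly q x) P = 0"
    by (rule poly_all_0_iff_0[THEN iffD1]) (use assms in \<open>simp add: poly_map_poly_poly\<close>)
  then have "poly (coeff P i) x = 0" for i
    by (metis coeff_0 coeff_map_poly poly_0)
  then show ?thesis by (simp add: const_poly_dvd_iff poly_eq_0_iff_dvd)
qed

text \<open>The polynomial \<open>r\<close> of least degree in the ideal \<open>(f, g)\<close> divides \<open>f\<close> and \<open>g\<close> up to scalars, by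
  pseudo-division; primality of \<open>f\<close> then forces \<open>r\<close> to be constant.\<close>

lemma eliminate_variable:
  fixes f g :: "'a::idom poly"
  assumes f: "prime_elem f" and "degree f > 0" and g: "\<not> f dvd g"
  shows "\<exists>u v h. h \<noteq> 0 \<and> u * f + v * g = [:h:]"
proof -
  define I where "I = {r. r \<noteq> 0 \<and> (\<exists>u v. r = u * f + v * g)}"
  have "f \<in> I" using f by (auto simp: I_def intro: exI[of _ 1] exI[of _ 0])
  then obtain r where r: "r \<in> I" "\<And>s. s \<in> I \<Longrightarrow> degree r \<le> degree s"
    using arg_min_natI[of "\<lambda>r. r \<in> I" f degree] arg_min_nat_le[of "\<lambda>r. r \<in> I" _ degree] by blast
  obtain u v where uv: "r = u * f + v * g" and r0: "r \<noteq> 0" using r(1) by (auto simp: I_def)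
  have div: "\<exists>a q. a \<noteq> 0 \<and> smult a w = r * q" if w: "w = s * f + t * g" for w s t
  proof -
    obtain a q where a: "a \<noteq> 0" "smult a w = r * q + pseudo_mod w r"
      using pseudo_mod(1)[OF r0] by blast
    have "pseudo_mod w r = 0"
    proof (rule ccontr)
      assume n: "pseudo_mod w r \<noteq> 0"
      then have "degree (pseudo_mod w r) < degree r" using pseudo_mod(2)[OF r0] by blast
      moreover have "pseudo_mod w r = (smult a s - q * u) * f + (smult a t - q * v) * g"
        using a(2) unfolding w uv by (simp add: algebra_simps smult_add_right)
      then have "pseudo_mod w r \<in> I" using n by (auto simp: I_def)
      ultimately show False using r(2) by fastforce
    qed
    then show ?thesis using a by auto
  qed
  obtain a q where a: "a \<noteq> 0" "smult a f = r * q" using div[of f 1 0] by auto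
  obtain b q' where b: "b \<noteq> 0" "smult b g = r * q'" using div[of g 0 1] by auto
  have "f dvd r * q" by (simp add: a(2)[symmetric] dvd_smult)
  then consider "f dvd r" | "f dvd q" using f prime_elem_dvd_multD by blast
  then have "degree r = 0"
  proof cases
    case 1
    then have "f dvd [:b:] * g" using b(2) by (simp add: dvd_mult2)
    then have "f dvd [:b:]" using f g prime_elem_dvd_multD by blast
    then have "degree f = 0" using b(1) by (metis degree_pCons_0 dvd_imp_degree_le le_0_eq pCons_eq_0_iff)
    then show ?thesis using \<open>degree f > 0\<close> by simp
  next
    case 2
    then obtain q2 where "q = f * q2" by (elim dvdE)
    then have "f * [:a:] = f * (r * q2)" using a(2) by (simp add: algebra_simps)
    then have "[:a:] = r * q2" using f by (metis mult_left_cancel prime_elem_not_zeroI)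
    then have "r dvd [:a:]" by simp
    then show ?thesis using a(1) by (metis degree_pCons_0 dvd_imp_degree_le le_0_eq pCons_eq_0_iff)
  qed
  then obtain h where "r = [:h:]" by (metis degree_eq_zeroE)
  then show ?thesis using r0 uv by (intro exI[of _ u] exI[of _ v] exI[of _ h]) auto
qed

text \<open>Eliminating \<open>y\<close> leaves a nonzero polynomial in \<open>x\<close>, hence
  finitely many first coordinates. Infinitely many common zeros over one \<open>x\<close> would make
  the equation of that vertical line divide both polynomials; \<open>f\<close>, being irreducible,
  would be associated to it and divide \<open>g\<close>.\<close>

lemma finite_common_zeros_poly2:
  fixes f g :: "complex poly poly"
  assumes f: "irreducible f" and g: "\<not> f dvd g"
  shows "finite {(x, y). poly2 f x y = 0 \<and> poly2 g x y = 0}"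
proof -
  have "\<exists>h. h \<noteq> 0 \<and> (\<forall>x y. poly2 f x y = 0 \<and> poly2 g x y = 0 \<longrightarrow> poly h x = 0)"
  proof (cases "degree f = 0")
    case True
    then obtain q where q: "f = [:q:]" by (metis degree_eq_zeroE)
    then show ?thesis using f by (intro exI[of _ q]) auto
  next
    case False
    have "prime_elem f" using f by (rule irreducible_imp_prime_elem_gcd)
    then obtain u v h where h: "h \<noteq> 0" "u * f + v * g = [:h:]"
      using eliminate_variable[of f g] False g by auto
    have "poly h x = 0" if "poly2 f x y = 0" "poly2 g x y = 0" for x y
      using arg_cong[OF h(2), of "\<lambda>P. poly2 P x y"] that by simp
    then show ?thesis using h(1) by blast
  qed
  then obtain h where h: "h \<noteq> 0"
    "\<And>x y. poly2 f x y = 0 \<Longrightarrow> poly2 g x y = 0 \<Longrightarrow> poly h x = 0" by blast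
  have fin: "finite {y. poly2 f x y = 0 \<and> poly2 g x y = 0}" for x
  proof (rule ccontr)
    assume inf: "infinite {y. poly2 f x y = 0 \<and> poly2 g x y = 0}"
    have van: "poly2 P x y = 0" if "{y. poly2 f x y = 0 \<and> poly2 g x y = 0} \<subseteq> {y. poly2 P x y = 0}" for P y
    proof -
      have "infinite {y. poly (map_poly (\<lambda>q. poly q x) P) y = 0}"
        using inf finite_subset[OF that] by (auto simp only: poly_map_poly_poly)
      then have "map_poly (\<lambda>q. poly q x) P = 0" using poly_roots_finite by blast
      then show ?thesis using poly_map_poly_poly[of x P y] by simp
    qed
    let ?l = "[:[:-x, 1:]:]"
    have lf: "?l dvd f" and lg: "?l dvd g" by (rule linear_dvd_if_vanishes, rule van, blast)+
    from lf obtain e where e: "f = ?l * e" by (elim dvdE)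
    have "\<not> ?l dvd 1" by (simp add: is_unit_const_poly_iff is_unit_pCons_iff)
    then have "e dvd 1" using irreducibleD[OF f e] by blast
    then have "f dvd ?l" using e by (metis dvd_mult_unit_iff dvd_refl mult.commute)
    then show False using lg g dvd_trans by blast
  qed
  have "{(x, y). poly2 f x y = 0 \<and> poly2 g x y = 0}
      \<subseteq> (SIGMA x:{x. poly h x = 0}. {y. poly2 f x y = 0 \<and> poly2 g x y = 0})"
    using h(2) by auto
  moreover have "finite (SIGMA x:{x. poly h x = 0}. {y. poly2 f x y = 0 \<and> poly2 g x y = 0})"
    using h(1) fin by (intro finite_SigmaI poly_roots_finite) auto
  ultimately show ?thesis by (rule finite_subset)
qed

text \<open>If \<open>y\<close> occurs, each of the infinitely many \<open>x\<close> off the zeros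
  of the leading coefficient has a root above it. Otherwise a root of the polynomial in
  \<open>x\<close> gives a whole vertical line.\<close>

lemma infinite_zeros_poly2:
  fixes f :: "complex poly poly"
  assumes f: "irreducible f"
  shows "infinite {(x, y). poly2 f x y = 0}"
proof (cases "degree f = 0")
  case True
  then obtain q where q: "f = [:q:]" by (metis degree_eq_zeroE)
  have "degree q \<noteq> 0"
  proof
    assume "degree q = 0"
    then obtain c where c: "q = [:c:]" by (metis degree_eq_zeroE)
    then have "c \<noteq> 0" "\<not> f dvd 1" using f q by (auto simp: irreducible_def)
    then show False by (simp add: q c is_unit_const_poly_iff dvd_field_iff)
  qed
  then obtain a where "poly q a = 0"
    using Fundamental_Theorem_Algebra.fundamental_theorem_of_algebra[of q] by (auto simp: constant_degree)
  then have "range (\<lambda>y. (a, y)) \<subseteq> {(x, y). poly2 f x y = 0}" by (auto simp: q)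
  moreover have "infinite (range (\<lambda>y::complex. (a, y)))"
    using infinite_UNIV_char_0 finite_imageD[of "\<lambda>y. (a, y)" UNIV] by (auto simp: inj_on_def)
  ultimately show ?thesis using finite_subset by blast
next
  case False
  have "infinite {x. poly (lead_coeff f) x \<noteq> 0}"
  proof
    assume "finite {x. poly (lead_coeff f) x \<noteq> 0}"
    moreover have "finite {x. poly (lead_coeff f) x = 0}" using False by (intro poly_roots_finite) auto
    ultimately have "finite ({x. poly (lead_coeff f) x \<noteq> 0} \<union> {x. poly (lead_coeff f) x = 0})" by blast
    moreover have "{x. poly (lead_coeff f) x \<noteq> 0} \<union> {x. poly (lead_coeff f) x = 0} = UNIV" by auto
    ultimately show False using infinite_UNIV_char_0 by metis
  qed
  moreover have "{x. poly (lead_coeff f) x \<noteq> 0} \<subseteq> fst ` {(x, y). poly2 f x y = 0}"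
  proof
    fix x assume x: "x \<in> {x. poly (lead_coeff f) x \<noteq> 0}"
    let ?p = "map_poly (\<lambda>q. poly q x) f"
    have "coeff ?p (degree f) \<noteq> 0" using x by (simp add: coeff_map_poly)
    then have "degree ?p \<noteq> 0" using False le_degree by (metis le_0_eq)
    then obtain y where "poly ?p y = 0"
      using Fundamental_Theorem_Algebra.fundamental_theorem_of_algebra[of ?p] by (auto simp: constant_degree)
    then show "x \<in> fst ` {(x, y). poly2 f x y = 0}" by (force simp: poly_map_poly_poly)
  qed
  ultimately show ?thesis using finite_subset finite_imageI by blast
qed

section \<open>Transfer to polynomials in the variables 0 and 1\<close>

definition poly2_of :: "nat cpoly \<Rightarrow> complex poly poly" where
  "poly2_of w = (\<Sum>m\<in>keys w. monom (monom (lookup w m)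
     (lookup m 0)) (lookup m 1))"

definition cpoly_of :: "complex poly poly \<Rightarrow> nat cpoly" where
  "cpoly_of P = (\<Sum>j\<le>degree P. \<Sum>i\<le>degree (coeff P j).
     cconst (coeff (coeff P j) i) * cvar 0 ^ i * cvar 1 ^ j)"

lemma poly2_poly2_of:
  assumes "pvars w \<subseteq> {0, 1}"
  shows "poly2 (poly2_of w) x y = peval (plane_point x y) w"
proof -
  have "(\<Prod>i\<in>keys m. plane_point x y i ^ lookup m i)
      = x ^ lookup m 0 * y ^ lookup m 1"
    if "m \<in> keys w" for m
  proof -
    have "keys m \<subseteq> {0, 1}" using assms that by (auto simp: pvars_def)
    then show ?thesis by (subst prod_keys_superset[of "{0, 1}"]) auto
  qed
  then show ?thesis
    by (simp add: poly2_of_def poly2_sum poly2_monom peval_def mult.assoc)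
qed

lemma peval_cpoly_of: "peval a (cpoly_of P) = poly2 P (a 0) (a 1)"
  by (simp add: cpoly_of_def peval_simps poly2_def poly_altdef[of P] poly_sum poly_altdef[of "coeff P _"]
      sum_distrib_left sum_distrib_right mult_ac poly_power)

lemma pvars_cpoly_of: "pvars (cpoly_of P) \<subseteq> {0, 1}"
  unfolding cpoly_of_def by (intro pvars_intros) auto

lemma peval_plane:
  assumes "pvars w \<subseteq> {0, 1}"
  shows "peval a w = peval (plane_point (a 0) (a 1)) w"
  by (rule peval_cong) (use assms in auto)

lemma cpoly_plane_eqI:
  assumes "pvars p \<subseteq> {0, 1}" "pvars q \<subseteq> {0, 1}"
    "\<And>x y. peval (plane_point x y) p = peval (plane_point x y) q"
  shows "p = q"
  using assms by (metis peval_eqI peval_plane)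

text \<open>Factorizations are carried over by comparing values, since polynomials in the two
  variables are determined by them on the plane. Units are recognized by degree 0.\<close>

lemma irreducible_poly2_of:
  assumes w: "pvars w \<subseteq> {0, 1}" "irreducible w"
  shows "irreducible (poly2_of w)"
proof (rule irreducibleI)
  have w0: "w \<noteq> 0" "\<not> w dvd 1" using w by (auto simp: irreducible_def)
  show "poly2_of w \<noteq> 0"
  proof
    assume "poly2_of w = 0"
    then have "peval (plane_point x y) w = 0" for x y using poly2_poly2_of[OF w(1), of x y] by simp
    then have "w = 0" using w(1) by (intro cpoly_plane_eqI) (auto simp: pvars_cconst[of 0, simplified])
    then show False using w0 by simp
  qed
  have of_w: "w = cpoly_of A * cpoly_of B" if "poly2_of w = A * B" for A B
    by (rule cpoly_plane_eqI[OF w(1) pvars_mult[OF pvars_cpoly_of pvars_cpoly_of]])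
      (simp add: peval_simps peval_cpoly_of that flip: poly2_poly2_of[OF w(1)])
  have unit: "A dvd 1" if A: "cpoly_of A dvd 1" for A
  proof -
    have "total_degree (cpoly_of A) = 0"
      using degree_in_dvd_le[OF A, of UNIV] by simp
    then obtain c where c: "cpoly_of A = cconst c" using total_degree_eq_0_imp by blast
    then have "c \<noteq> 0" using A by auto
    have "A = [:[:c:]:]"
      by (rule poly2_eqI)
        (use peval_cpoly_of[of "plane_point _ _" A] in \<open>simp add: c\<close>)
    then show ?thesis using \<open>c \<noteq> 0\<close> by (simp add: is_unit_const_poly_iff dvd_field_iff)
  qed
  show "\<not> poly2_of w dvd 1"
  proof
    assume "poly2_of w dvd 1"
    then obtain B where "1 = poly2_of w * B" by (elim dvdE)
    then have "1 = w * cpoly_of B"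
      by (intro cpoly_plane_eqI pvars_mult w(1) pvars_cpoly_of pvars_cconst[of 1, simplified])
        (metis peval_1 peval_mult peval_cpoly_of plane_point_simps(1,3) poly2_poly2_of[OF w(1)]
          poly2_simps(3) poly2_simps(4) poly_1 one_poly_eq_simps(1))
    then show False using w0 by (metis dvdI)
  qed
  show "A dvd 1 \<or> B dvd 1" if "poly2_of w = A * B" for A B
    using irreducibleD[OF w(2) of_w[OF that]] unit by blast
qed

text \<open>A weak form of Bezout: without a common component two plane curves meet in finitely many
  points, and the only component of the first curve is the curve itself.\<close>

theorem irreducible_plane_dvd:
  fixes F :: "nat cpoly"
  assumes F: "pvars F \<subseteq> {0, 1}" "irreducible F" and g: "pvars g \<subseteq> {0, 1}"
    and inf: "infinite {p \<in> affine_space {0, 1}. peval p F = 0 \<and> peval p g = 0}"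
  shows "F dvd g"
proof -
  have "poly2_of F dvd poly2_of g"
  proof (rule ccontr)
    assume "\<not> ?thesis"
    then have "finite {(x, y). poly2 (poly2_of F) x y = 0 \<and> poly2 (poly2_of g) x y = 0}"
      using irreducible_poly2_of[OF F] by (rule finite_common_zeros_poly2[rotated])
    then have "finite ((\<lambda>(x, y). plane_point x y) ` {(x, y). peval (plane_point x y) F = 0
        \<and> peval (plane_point x y) g = 0})"
      using F g by (simp add: poly2_poly2_of)
    moreover have "{p \<in> affine_space {0, 1}. peval p F = 0 \<and> peval p g = 0} \<subseteq>
      (\<lambda>(x, y). plane_point x y) ` {(x, y). peval (plane_point x y) F = 0 \<and> peval (plane_point x y) g = 0}"
    proof
      fix p assume p: "p \<in> {p \<in> affine_space {0, 1}. peval p F = 0 \<and> peval p g = 0}"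
      show "p \<in> (\<lambda>(x, y). plane_point x y) ` {(x, y). peval (plane_point x y) F = 0 \<and> peval (plane_point x y) g = 0}"
        by (rule image_eqI[of _ _ "(p 0, p 1)"]) (use p in \<open>simp_all add: plane_point_eta[of p, unfolded One_nat_def]\<close>)
    qed
    ultimately show False using inf finite_subset by blast
  qed
  then obtain h where h: "poly2_of g = poly2_of F * h" by (elim dvdE)
  have "g = F * cpoly_of h"
    by (rule cpoly_plane_eqI[OF g pvars_mult[OF F(1) pvars_cpoly_of]])
      (simp add: peval_simps peval_cpoly_of h flip: poly2_poly2_of[OF F(1)] poly2_poly2_of[OF g])
  then show ?thesis by simp
qed

lemma infinite_curve:
  assumes "irreducible_curve F"
  shows "infinite (curve F)"
proof
  assume "finite (curve F)"
  have F: "pvars F \<subseteq> {0, 1}" "irreducible F" using assms by (auto simp: irreducible_curve_def)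
  have "{(x, y). poly2 (poly2_of F) x y = 0} \<subseteq> (\<lambda>p. (p 0, p 1)) ` curve F"
  proof clarify
    fix x y assume "poly2 (poly2_of F) x y = 0"
    then have "plane_point x y \<in> curve F" by (simp add: curve_def poly2_poly2_of[OF F(1)])
    then show "(x, y) \<in> (\<lambda>p. (p 0, p 1)) ` curve F" by (rule rev_image_eqI) simp
  qed
  then show False
    using infinite_zeros_poly2[OF irreducible_poly2_of[OF F]] \<open>finite (curve F)\<close> finite_subset
    by blast
qed

lemma curve_vanish_imp_dvd:
  assumes "irreducible_curve F" "pvars g \<subseteq> {0, 1}" "\<And>p. p \<in> curve F \<Longrightarrow> peval p g = 0"
  shows "F dvd g"
proof (rule irreducible_plane_dvd)
  have "{p \<in> affine_space {0, 1}. peval p F = 0 \<and> peval p g = 0} = curve F"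
    using assms(3) by (auto simp: curve_def)
  then show "infinite {p \<in> affine_space {0, 1}. peval p F = 0 \<and> peval p g = 0}"
    using infinite_curve[OF assms(1)] by simp
qed (use assms in \<open>auto simp: irreducible_curve_def\<close>)

text \<open>Primality of the ideal of an irreducible curve. If neither function vanished on the
  curve, each would have finitely many zeros there, and two finite sets cannot cover an infinite
  curve.\<close>

lemma curve_vanish_mult:
  assumes F: "irreducible_curve F" and "polyfun {0, 1} f" "polyfun {0, 1} g"
    and van: "\<And>p. p \<in> curve F \<Longrightarrow> f p * g p = 0"
  shows "(\<forall>p\<in>curve F. f p = 0) \<or> (\<forall>p\<in>curve F. g p = 0)"
proof -
  obtain u where u: "pvars u \<subseteq> {0, 1}" "\<And>a. a \<in> affine_space {0, 1} \<Longrightarrow> f a = peval a u"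
    by (rule polyfunE[OF assms(2)]) (rule that)
  obtain v where v: "pvars v \<subseteq> {0, 1}" "\<And>a. a \<in> affine_space {0, 1} \<Longrightarrow> g a = peval a v"
    by (rule polyfunE[OF assms(3)]) (rule that)
  have on: "p \<in> affine_space {0, 1}" "peval p F = 0" if "p \<in> curve F" for p
    using that by (auto simp: curve_def)
  show ?thesis
  proof (rule ccontr)
    assume "\<not> ?thesis"
    then obtain p q where pq: "p \<in> curve F" "f p \<noteq> 0" "q \<in> curve F" "g q \<noteq> 0" by auto
    let ?Z = "\<lambda>w. {p \<in> affine_space {0, 1}. peval p F = 0 \<and> peval p w = 0}"
    have nd: "\<not> F dvd u" "\<not> F dvd v"
      using pq on u v by (auto simp: peval_simps elim!: dvdE)
    then have "finite (?Z u)" "finite (?Z v)"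
      using irreducible_plane_dvd F u(1) v(1) by (auto simp: irreducible_curve_def)
    moreover have "curve F \<subseteq> ?Z u \<union> ?Z v"
      using van on u(2) v(2) by fastforce
    ultimately show False using infinite_curve[OF F] finite_subset by blast
  qed
qed

section \<open>Zariski topology and dimension\<close>

lemma openin_zariski_principal:
  "pvars p \<subseteq> I \<Longrightarrow> openin (zariski I) {a \<in> affine_space I. peval a p \<noteq> 0}"
  unfolding zariski_def by (rule topology_generated_by_Basis) blast

lemma topspace_zariski [simp]: "topspace (zariski I) = affine_space I"
proof
  show "topspace (zariski I) \<subseteq> affine_space I"
    unfolding zariski_def topology_generated_by_topspace by blast
  show "affine_space I \<subseteq> topspace (zariski I)"
    using openin_subset[OF openin_zariski_principal[OF pvars_cconst[of 1]]] by simp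
qed

lemma openin_zariski_polyfun:
  assumes "polyfun I f"
  shows "openin (zariski I) {a \<in> affine_space I. f a \<noteq> 0}"
proof -
  obtain p where p: "pvars p \<subseteq> I" "\<And>a. a \<in> affine_space I \<Longrightarrow> f a = peval a p"
    by (rule polyfunE[OF assms]) (rule that)
  have "{a \<in> affine_space I. f a \<noteq> 0} = {a \<in> affine_space I. peval a p \<noteq> 0}"
    by (rule Collect_cong) (simp add: p(2) cong: conj_cong)
  then show ?thesis using openin_zariski_principal[OF p(1)] by simp
qed

text \<open>Principal open sets form a base: an intersection of two of them is the principal open
  set of the product, so the induction over the generated topology closes.\<close>

lemma openin_zariski_contains_principal:
  assumes "openin (zariski I) U" "c \<in> U"
  obtains p where "pvars p \<subseteq> I" "peval c p \<noteq> 0" "{a \<in> affine_space I. peval a p \<noteq> 0} \<subseteq> U"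
proof -
  have "generate_topology_on {{a \<in> affine_space I. peval a f \<noteq> 0} | f. pvars f \<subseteq> I} U"
    using assms(1) unfolding zariski_def openin_topology_generated_by_iff .
  then have "c \<in> U \<longrightarrow> (\<exists>p. pvars p \<subseteq> I \<and> peval c p \<noteq> 0 \<and> {a \<in> affine_space I. peval a p \<noteq> 0} \<subseteq> U)"
  proof induction
    case (Int A B)
    show ?case
    proof
      assume "c \<in> A \<inter> B"
      then obtain p q where "pvars p \<subseteq> I" "peval c p \<noteq> 0" "{a \<in> affine_space I. peval a p \<noteq> 0} \<subseteq> A"
        "pvars q \<subseteq> I" "peval c q \<noteq> 0" "{a \<in> affine_space I. peval a q \<noteq> 0} \<subseteq> B"
        using Int.IH by auto
      then show "\<exists>p. pvars p \<subseteq> I \<and> peval c p \<noteq> 0 \<and> {a \<in> affine_space I. peval a p \<noteq> 0} \<subseteq> A \<inter> B"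
        by (intro exI[of _ "p * q"] conjI pvars_mult) (auto simp: peval_mult)
    qed
  next
    case (UN K)
    show ?case
    proof
      assume "c \<in> \<Union>K"
      then obtain A where A: "A \<in> K" "c \<in> A" by auto
      then obtain p where "pvars p \<subseteq> I" "peval c p \<noteq> 0" "{a \<in> affine_space I. peval a p \<noteq> 0} \<subseteq> A"
        using UN.IH[OF A(1)] by auto
      then show "\<exists>p. pvars p \<subseteq> I \<and> peval c p \<noteq> 0 \<and> {a \<in> affine_space I. peval a p \<noteq> 0} \<subseteq> \<Union>K"
        using A(1) by (intro exI[of _ p] conjI) auto
    qed
  next
    case (Basis s)
    then show ?case by blast
  qed simp
  then show ?thesis using assms(2) that by blast
qed

lemma zariski_open_inter_nonempty:
  fixes I :: "'v::linorder set"
  assumes "openin (zariski I) U" "U \<noteq> {}" "openin (zariski I) V" "V \<noteq> {}"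
  shows "U \<inter> V \<noteq> {}"
proof -
  obtain c c' where c: "c \<in> U" "c' \<in> V" using assms by auto
  then have aff: "c \<in> affine_space I" "c' \<in> affine_space I"
    using openin_subset[OF assms(1)] openin_subset[OF assms(3)] by auto
  obtain p where p: "peval c p \<noteq> 0" "{a \<in> affine_space I. peval a p \<noteq> 0} \<subseteq> U"
    by (rule openin_zariski_contains_principal[OF assms(1) c(1)]) (rule that)
  obtain q where q: "peval c' q \<noteq> 0" "{a \<in> affine_space I. peval a q \<noteq> 0} \<subseteq> V"
    by (rule openin_zariski_contains_principal[OF assms(3) c(2)]) (rule that)
  have "\<exists>a\<in>affine_space I. peval a p * peval a q \<noteq> 0"
    using polyfun_no_zero_divisors[of I "\<lambda>a. peval a p" "\<lambda>a. peval a q"] p(1) q(1) aff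
    by (auto simp: polyfun_def)
  then show ?thesis using p(2) q(2) by auto
qed

lemma closedin_zariski_separate:
  assumes "closedin (zariski I) A" "z \<in> affine_space I" "z \<notin> A"
  obtains p where "pvars p \<subseteq> I" "peval z p \<noteq> 0" "\<And>a. a \<in> A \<Longrightarrow> peval a p = 0"
proof -
  have "openin (zariski I) (affine_space I - A)" "z \<in> affine_space I - A"
    using assms by (auto simp: closedin_def)
  then obtain p where p: "pvars p \<subseteq> I" "peval z p \<noteq> 0"
    "{a \<in> affine_space I. peval a p \<noteq> 0} \<subseteq> affine_space I - A"
    by (rule openin_zariski_contains_principal)
  moreover have "A \<subseteq> affine_space I" using closedin_subset[OF assms(1)] by simp
  ultimately show ?thesis using that[of p] by blast
qed

lemma zariski_closure_vanish:
  assumes "pvars p \<subseteq> I" "\<And>z. z \<in> Z \<Longrightarrow> peval z p = 0" "a \<in> (zariski I closure_of Z)"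
  shows "peval a p = 0"
proof (rule ccontr)
  assume n: "peval a p \<noteq> 0"
  have a: "a \<in> topspace (zariski I)"
    and *: "\<forall>T. a \<in> T \<and> openin (zariski I) T \<longrightarrow> (\<exists>z. z \<in> Z \<and> z \<in> T)"
    using assms(3) unfolding in_closure_of by (rule conjunct1, rule conjunct2)
  have "a \<in> {a \<in> affine_space I. peval a p \<noteq> 0}" using a n by simp
  then have "\<exists>z. z \<in> Z \<and> z \<in> {a \<in> affine_space I. peval a p \<noteq> 0}"
    using *[rule_format, OF conjI, OF _ openin_zariski_principal[OF assms(1)]] by simp
  then show False using assms(2) by auto
qed

lemma closedin_zariski_singleton:
  assumes "z \<in> affine_space I"
  shows "closedin (zariski I) {z}"
proof -
  have "openin (zariski I) {a \<in> affine_space I. a i - z i \<noteq> 0}" for i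
    by (rule openin_zariski_polyfun) auto
  then have "openin (zariski I) (\<Union>i. {a \<in> affine_space I. a i - z i \<noteq> 0})" by auto
  moreover have "(\<Union>i. {a \<in> affine_space I. a i - z i \<noteq> 0}) = affine_space I - {z}" by auto
  ultimately show ?thesis using assms by (simp add: closedin_def)
qed

lemma closedin_zariski_finite:
  assumes "finite Z" "Z \<subseteq> affine_space I"
  shows "closedin (zariski I) Z"
proof -
  have "closedin (zariski I) (\<Union>z\<in>Z. {z})"
    using assms by (intro closedin_Union) (auto intro: closedin_zariski_singleton)
  then show ?thesis by simp
qed

section \<open>Irreducible closed sets and Krull dimension\<close>

lemma irreducible_closedD:
  assumes "irreducible_closed T Z"
  shows "closedin T Z" "Z \<noteq> {}"
  using assms by (simp_all add: irreducible_closed_def)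

lemma irreducible_closed_subtopology_iff:
  assumes "closedin T C"
  shows "irreducible_closed (subtopology T C) A \<longleftrightarrow> irreducible_closed T A \<and> A \<subseteq> C"
proof -
  have "A \<subseteq> X \<or> A \<subseteq> Y"
    if "A \<subseteq> C" "closedin T X" "closedin T Y" "A \<subseteq> X \<union> Y" and
      h: "\<forall>X Y. closedin (subtopology T C) X \<and> closedin (subtopology T C) Y \<and> A \<subseteq> X \<union> Y
        \<longrightarrow> A \<subseteq> X \<or> A \<subseteq> Y" for X Y
  proof -
    have "closedin (subtopology T C) (X \<inter> C)" "closedin (subtopology T C) (Y \<inter> C)"
      using that assms by (auto simp: closedin_closed_subtopology closedin_Int)
    moreover have "A \<subseteq> X \<inter> C \<union> Y \<inter> C" using that by auto
    ultimately show ?thesis using h by blast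
  qed
  then show ?thesis
    unfolding irreducible_closed_def closedin_closed_subtopology[OF assms] by blast
qed

lemma irreducible_closed_finite_imp_singleton:
  assumes "irreducible_closed (zariski I) A" "finite A" "a \<in> A"
  shows "A = {a}"
proof -
  have sub: "A \<subseteq> affine_space I" using assms closedin_subset[of "zariski I" A] by (simp add: irreducible_closed_def)
  then have "closedin (zariski I) {a}" "closedin (zariski I) (A - {a})"
    using assms by (auto intro: closedin_zariski_finite)
  moreover have "A \<subseteq> {a} \<union> (A - {a})" by auto
  ultimately have "A \<subseteq> {a} \<or> A \<subseteq> A - {a}" using assms(1) unfolding irreducible_closed_def by blast
  then show ?thesis using assms(3) by auto
qed

text \<open>A finite set is closed and its irreducible closed subsets are points, so its dimension
  is 0. The lemma turns the dimension condition on a signature into the infinitude needed for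
  divisibility.\<close>

lemma infinite_of_krull_dim_closure_eq_1:
  assumes "Z \<subseteq> affine_space I" "krull_dim (subtopology (zariski I) (zariski I closure_of Z)) = 1"
  shows "infinite Z"
proof
  assume fin: "finite Z"
  let ?C = "zariski I closure_of Z"
  have C: "closedin (zariski I) Z" using fin assms(1) by (rule closedin_zariski_finite)
  then have eq: "?C = Z" by (rule closure_of_closedin)
  have "krull_dim (subtopology (zariski I) Z) \<le> 0"
    unfolding krull_dim_def
  proof (rule Sup_least, clarify)
    fix n :: nat and Y
    assume Y: "\<forall>i\<le>n. irreducible_closed (subtopology (zariski I) Z) (Y i)" "\<forall>i<n. Y i \<subset> Y (Suc i)"
    have "n = 0"
    proof (rule ccontr)
      assume "n \<noteq> 0"
      then have irr: "irreducible_closed (zariski I) (Y 0)" "irreducible_closed (zariski I) (Y 1)"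
        "Y 1 \<subseteq> Z" and lt: "Y 0 \<subset> Y 1"
        using Y by (auto simp: irreducible_closed_subtopology_iff[OF C])
      have "Y 0 \<noteq> {}" by (rule irreducible_closedD(2)[OF irr(1)])
      then obtain a where a: "a \<in> Y 0" by auto
      have "Y 1 = {a}"
        by (rule irreducible_closed_finite_imp_singleton[OF irr(2)])
          (use a lt irr(3) fin finite_subset in auto)
      then show False using lt a by auto
    qed
    then show "enat n \<le> 0" by (simp add: zero_enat_def)
  qed
  then show False using assms(2) unfolding eq by simp
qed

text \<open>The ideal of polynomials vanishing on \<open>Z\<close> is prime or the whole ring (the latter if \<open>Z\<close> is empty).\<close>

definition vanishing_prime :: "('v \<Rightarrow> complex) set \<Rightarrow> bool" where
  "vanishing_prime Z \<longleftrightarrow> (\<forall>P Q. (\<forall>z\<in>Z. peval z P * peval z Q = 0) \<longrightarrow>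
     (\<forall>z\<in>Z. peval z P = 0) \<or> (\<forall>z\<in>Z. peval z Q = 0))"

lemma vanishing_primeD:
  assumes "vanishing_prime Z" "\<And>z. z \<in> Z \<Longrightarrow> peval z P * peval z Q = 0"
  shows "(\<forall>z\<in>Z. peval z P = 0) \<or> (\<forall>z\<in>Z. peval z Q = 0)"
  using assms unfolding vanishing_prime_def by simp

text \<open>In a chain of length 2 the middle set is infinite. A polynomial \<open>f\<close>
  separating it from a point of the top set shares infinitely many zeros with \<open>P\<close>, so
  \<open>P\<close> divides \<open>f\<close> and \<open>f\<close> vanishes on the whole closure, a
  contradiction. A point inside the closure is a chain of length 1, as primality makes the closure
  irreducible.\<close>

lemma krull_dim_closure_eq_1:
  fixes Z :: "(nat \<Rightarrow> complex) set"
  assumes Z: "Z \<subseteq> affine_space {0, 1}" "infinite Z"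
    and prime: "vanishing_prime Z"
    and P: "pvars P \<subseteq> {0, 1}" "irreducible P" "\<And>z. z \<in> Z \<Longrightarrow> peval z P = 0"
  shows "krull_dim (subtopology (zariski {0, 1}) (zariski {0, 1} closure_of Z)) = 1"
proof (rule antisym)
  let ?T = "zariski {0, 1 :: nat}" and ?C = "zariski {0, 1} closure_of Z"
  have C: "closedin ?T ?C" by simp
  have ZC: "Z \<subseteq> ?C" using Z(1) by (intro closure_of_subset) simp
  have Caff: "?C \<subseteq> affine_space {0, 1}" using closure_of_subset_topspace[of ?T Z] by simp
  show "krull_dim (subtopology ?T ?C) \<le> 1"
    unfolding krull_dim_def
  proof (rule Sup_least, clarify)
    fix n :: nat and Y
    assume Y: "\<forall>i\<le>n. irreducible_closed (subtopology ?T ?C) (Y i)" "\<forall>i<n. Y i \<subset> Y (Suc i)"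
    have "n \<le> 1"
    proof (rule ccontr)
      assume n: "\<not> n \<le> 1"
      have "irreducible_closed ?T (Y i) \<and> Y i \<subseteq> ?C" if "i \<le> 2" for i
        using Y(1) n that irreducible_closed_subtopology_iff[OF C, of "Y i"] by simp
      from this[of 0] this[of 1] this[of 2]
      have irr: "irreducible_closed ?T (Y 0)" "irreducible_closed ?T (Y 1)"
        "Y 1 \<subseteq> ?C" "Y 2 \<subseteq> ?C" by simp_all
      have lt: "Y 0 \<subset> Y 1" "Y 1 \<subset> Y 2" using Y(2) n by (simp_all add: numeral_2_eq_2)
      have "Y 0 \<noteq> {}" by (rule irreducible_closedD(2)[OF irr(1)])
      then obtain a where a: "a \<in> Y 0" by auto
      have inf: "infinite (Y 1)"
      proof
        assume "finite (Y 1)"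
        then have "Y 1 = {a}"
          by (rule irreducible_closed_finite_imp_singleton[OF irr(2)]) (use a lt(1) in auto)
        then show False using lt(1) a by auto
      qed
      obtain z where z: "z \<in> Y 2" "z \<notin> Y 1" using lt(2) by blast
      have "closedin ?T (Y 1)" "z \<in> affine_space {0, 1}"
        using irreducible_closedD(1)[OF irr(2)] irr(4) z(1) Caff by blast+
      then obtain f where f: "pvars f \<subseteq> {0, 1}" "peval z f \<noteq> 0" "\<And>a. a \<in> Y 1 \<Longrightarrow> peval a f = 0"
        using z(2) by (rule closedin_zariski_separate) (rule that)
      have PC: "peval a P = 0" if "a \<in> ?C" for a
        using zariski_closure_vanish[OF P(1) P(3) that] .
      have "Y 1 \<subseteq> {p \<in> affine_space {0, 1}. peval p P = 0 \<and> peval p f = 0}"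
        using irr(3) Caff PC f(3) by blast
      then have "P dvd f"
        by (intro irreducible_plane_dvd P f) (use inf finite_subset in blast)
      then have "peval z f = 0" using PC[of z] z(1) irr(4) by (auto simp: peval_mult elim!: dvdE)
      then show False using f(2) by simp
    qed
    then show "enat n \<le> 1" by (simp add: one_enat_def)
  qed
  have "Z \<noteq> {}" using Z(2) by auto
  then obtain z where z: "z \<in> Z" by blast
  have "irreducible_closed ?T {z}"
    using closedin_zariski_singleton z Z(1) by (auto simp: irreducible_closed_def)
  moreover have "irreducible_closed ?T ?C"
    unfolding irreducible_closed_def
  proof (intro conjI allI impI C)
    show "?C \<noteq> {}" using z ZC by auto
    fix A B assume AB: "closedin ?T A \<and> closedin ?T B \<and> ?C \<subseteq> A \<union> B"
    show "?C \<subseteq> A \<or> ?C \<subseteq> B"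
    proof (rule ccontr)
      assume "\<not> ?thesis"
      then have "\<not> Z \<subseteq> A" "\<not> Z \<subseteq> B" using AB closure_of_minimal by blast+
      then obtain x y where xy: "x \<in> Z" "x \<notin> A" "y \<in> Z" "y \<notin> B" by auto
      have xA: "closedin ?T A" "x \<in> affine_space {0, 1}" and yB: "closedin ?T B" "y \<in> affine_space {0, 1}"
        using AB xy Z(1) by auto
      obtain f where f: "pvars f \<subseteq> {0, 1}" "peval x f \<noteq> 0" "\<And>a. a \<in> A \<Longrightarrow> peval a f = 0"
        by (rule closedin_zariski_separate[OF xA xy(2)]) (rule that)
      obtain g where g: "pvars g \<subseteq> {0, 1}" "peval y g \<noteq> 0" "\<And>a. a \<in> B \<Longrightarrow> peval a g = 0"
        by (rule closedin_zariski_separate[OF yB xy(4)]) (rule that)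
      have "peval a f * peval a g = 0" if "a \<in> Z" for a
      proof -
        have "a \<in> A \<or> a \<in> B" using that AB ZC by blast
        then show ?thesis using f(3) g(3) by auto
      qed
      then show False using vanishing_primeD[OF prime, of f g] f(2) g(2) xy by auto
    qed
  qed
  moreover have "{z} \<subset> ?C" using z ZC Z(2) finite_subset[of Z "{z}"] by auto
  ultimately have "\<exists>Y. (\<forall>i\<le>1. irreducible_closed (subtopology ?T ?C) (Y i)) \<and> (\<forall>i<1. Y i \<subset> Y (Suc i))"
    unfolding irreducible_closed_subtopology_iff[OF C] using subsetD[OF ZC z]
    by (intro exI[of _ "\<lambda>i::nat. if i = 0 then {z} else ?C"]) simp
  then have "enat 1 \<in> {enat n | n. \<exists>Y. (\<forall>i\<le>n. irreducible_closed (subtopology ?T ?C) (Y i)) \<and> (\<forall>i<n. Y i \<subset> Y (Suc i))}"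
    by blast
  then show "1 \<le> krull_dim (subtopology ?T ?C)"
    unfolding krull_dim_def one_enat_def by (rule Sup_upper)
qed

section \<open>The implicit function theorem\<close>

lemma tendsto_peval:
  assumes "\<And>i. ((\<lambda>t. \<gamma> t i) \<longlongrightarrow> a i) F"
  shows "((\<lambda>t. peval (\<gamma> t) p) \<longlongrightarrow> peval a p) F"
  by (induction p rule: cpoly_induct) (auto simp: peval_simps intro!: tendsto_intros assms)

lemma continuous_on_peval:
  assumes "\<And>i. continuous_on S (\<lambda>t. \<gamma> t i)"
  shows "continuous_on S (\<lambda>t. peval (\<gamma> t) p)"
  by (induction p rule: cpoly_induct) (auto simp: peval_simps intro!: continuous_intros assms)

text \<open>The inverse function theorem is applied to \<open>\<Phi>(x, y) = (x, G(x, y))\<close>;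
  the graph function is the second component of the inverse at \<open>(x, 0)\<close>.\<close>

theorem implicit_function:
  fixes G :: "complex \<times> complex \<Rightarrow> complex"
  assumes G: "\<And>z. (G has_derivative (\<lambda>h. A z * fst h + B z * snd h)) (at z)"
    and cont: "continuous_on UNIV A" "continuous_on UNIV B"
    and zero: "G (a, b) = 0" and B0: "B (a, b) \<noteq> 0"
  shows "\<exists>f. f analytic_on {a} \<and> f a = b \<and> (\<forall>\<^sub>F (x, y) in nhds (a, b). G (x, y) = 0 \<longleftrightarrow> y = f x)"
proof -
  define \<Phi> where "\<Phi> = (\<lambda>z :: complex \<times> complex. (fst z, G z))"
  define D where "D = (\<lambda>z h :: complex \<times> complex. (fst h, A z * fst h + B z * snd h))"
  define U where "U = {z. B z \<noteq> 0}"
  have bl: "bounded_linear (D z)" for z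
    unfolding D_def by (intro bounded_linear_intros)
  have app: "blinfun_apply (Blinfun (D z)) = D z" for z
    by (rule bounded_linear_Blinfun_apply[OF bl])
  have "open U"
    unfolding U_def using cont(2) by (intro open_Collect_neq) auto
  have der: "(\<Phi> has_derivative blinfun_apply (Blinfun (D z))) (at z)" for z
    unfolding app unfolding \<Phi>_def D_def by (intro has_derivative_Pair G derivative_intros)
  have contD: "continuous_on U (\<lambda>z. Blinfun (D z))"
  proof (rule continuous_on_blinfun_componentwise)
    fix i :: "complex \<times> complex"
    show "continuous_on U (\<lambda>z. blinfun_apply (Blinfun (D z)) i)"
      unfolding app unfolding D_def
      by (intro continuous_intros continuous_on_subset[OF cont(1)] continuous_on_subset[OF cont(2)]) auto
  qed
  \<comment> \<open>The inverse of the derivative of \<open>\<Phi>\<close> at \<open>(a, b)\<close>,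
    found by solving the second component for \<open>snd h\<close>.\<close>
  define E where "E = (\<lambda>h :: complex \<times> complex. (fst h, (snd h - A (a, b) * fst h) * (1 / B (a, b))))"
  have E: "blinfun_apply (Blinfun E) = E"
    unfolding E_def
    by (intro bounded_linear_Blinfun_apply bounded_linear_intros bounded_linear_mult_const)
  have inv: "Blinfun E o\<^sub>L Blinfun (D (a, b)) = id_blinfun"
  proof (rule blinfun_eqI)
    fix h
    have "E (D (a, b) h) = h" by (simp add: E_def D_def B0)
    then show "blinfun_apply (Blinfun E o\<^sub>L Blinfun (D (a, b))) h = blinfun_apply id_blinfun h"
      by (simp add: app E)
  qed
  have ab: "(a, b) \<in> U" using B0 by (simp add: U_def)
  obtain U' V g g' where U': "open U'" "U' \<subseteq> U" "(a, b) \<in> U'" and V: "open V" "\<Phi> (a, b) \<in> V"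
    and hom: "homeomorphism U' V \<Phi> g"
    and g: "\<And>y. y \<in> V \<Longrightarrow> (g has_derivative (g' y)) (at y)"
    and g': "\<And>y. y \<in> V \<Longrightarrow> g' y = inv_into UNIV (blinfun_apply (Blinfun (D (g y))))"
    and "\<And>y. y \<in> V \<Longrightarrow> bij (blinfun_apply (Blinfun (D (g y))))"
    by (rule inverse_function_theorem[OF \<open>open U\<close> der contD ab inv]) (rule that)
  define f where "f = (\<lambda>x. snd (g (x, 0)))"
  define W where "W = {x. (x, 0) \<in> V}"
  have "open ((\<lambda>x. (x, 0 :: complex)) -` V)"
    by (intro open_vimage V continuous_intros)
  then have "open W" unfolding W_def vimage_def .
  have "a \<in> W" using V(2) by (simp add: \<Phi>_def W_def zero)
  have gV: "g y \<in> U'" "\<Phi> (g y) = y" if "y \<in> V" for y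
    using hom that unfolding homeomorphism_def by blast+
  have gU: "g (\<Phi> z) = z" if "z \<in> U'" for z
    using hom that unfolding homeomorphism_def by blast
  have fder: "(f has_field_derivative (- A (g (x, 0)) / B (g (x, 0)))) (at x)" if "x \<in> W" for x
  proof -
    let ?y = "(x, 0 :: complex)"
    have yV: "?y \<in> V" using that by (simp add: W_def)
    have Bn: "B (g ?y) \<noteq> 0" using gV(1)[OF yV] U'(2) by (auto simp: U_def)
    \<comment> \<open>The theorem supplies only a real derivative. Its explicit form shows that the
      derivative of \<open>f\<close> is multiplication by the complex number \<open>- A / B\<close>,
      which makes \<open>f\<close> holomorphic.\<close>
    have inj: "inv_into UNIV (D (g ?y)) h = (fst h, (snd h - A (g ?y) * fst h) / B (g ?y))" for h
    proof (rule inv_f_eq)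
      show "inj (D (g ?y))" using Bn by (auto simp: inj_def D_def prod_eq_iff)
      show "D (g ?y) (fst h, (snd h - A (g ?y) * fst h) / B (g ?y)) = h"
        using Bn by (auto simp: D_def prod_eq_iff)
    qed
    have "((\<lambda>x. (x, 0 :: complex)) has_derivative (\<lambda>h. (h, 0))) (at x)"
      by (intro derivative_intros)
    then have "((\<lambda>x. g (x, 0)) has_derivative (\<lambda>h. g' ?y (h, 0))) (at x)"
      using g[OF yV] by (rule has_derivative_compose[where f = "\<lambda>x. (x, 0)" and g = g])
    then have "(f has_derivative (\<lambda>h. snd (g' ?y (h, 0)))) (at x)"
      unfolding f_def by (rule has_derivative_snd)
    moreover have "(\<lambda>h. snd (g' ?y (h, 0))) = (*) (- A (g ?y) / B (g ?y))"
      by (auto simp: g'[OF yV] app inj)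
    ultimately show ?thesis unfolding has_field_derivative_def by simp
  qed
  then have "f holomorphic_on W" using \<open>open W\<close> by (auto simp: holomorphic_on_open)
  then have an: "f analytic_on {a}" using \<open>open W\<close> \<open>a \<in> W\<close> by (auto simp: analytic_at)
  have fa: "f a = b" using gU[OF U'(3)] by (simp add: f_def \<Phi>_def zero)
  have "\<forall>\<^sub>F z in nhds (a, b). z \<in> U' \<inter> (W \<times> UNIV)"
    using U' \<open>open W\<close> \<open>a \<in> W\<close> by (intro eventually_nhds_in_open open_Int open_Times) auto
  then have "\<forall>\<^sub>F z in nhds (a, b). G z = 0 \<longleftrightarrow> snd z = f (fst z)"
  proof eventually_elim
    case (elim z)
    have z: "z \<in> U'" "(fst z, 0) \<in> V" using elim by (auto simp: W_def)
    show ?case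
    proof
      assume "G z = 0"
      then have "\<Phi> z = (fst z, 0)" by (simp add: \<Phi>_def)
      then show "snd z = f (fst z)" using gU[OF z(1)] by (simp add: f_def)
    next
      assume s: "snd z = f (fst z)"
      have "\<Phi> (g (fst z, 0)) = (fst z, 0)" by (rule gV(2)[OF z(2)])
      then have e: "fst (g (fst z, 0)) = fst z" "G (g (fst z, 0)) = 0" by (auto simp: \<Phi>_def)
      then have "g (fst z, 0) = z" using s by (simp add: prod_eq_iff f_def)
      then show "G z = 0" using e by simp
    qed
  qed
  then show ?thesis using an fa by (intro exI[of _ f]) (simp add: case_prod_beta')
qed

section \<open>Jets of plane curves by implicit differentiation\<close>

lemma defined_at_Fract: "peval q b \<noteq> 0 \<Longrightarrow> defined_at (Fract a b) q"
  unfolding defined_at_def by blast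

lemma rvalue_Fract:
  assumes "peval q b \<noteq> 0"
  shows "rvalue (Fract a b) q = peval q a / peval q b"
  unfolding rvalue_def
proof (rule the_equality)
  show "\<exists>a' b'. Fract a b = Fract a' b' \<and> peval q b' \<noteq> 0 \<and> peval q a / peval q b = peval q a' / peval q b'"
    using assms by blast
  fix z assume "\<exists>a' b'. Fract a b = Fract a' b' \<and> peval q b' \<noteq> 0 \<and> z = peval q a' / peval q b'"
  then obtain a' b' where z: "Fract a b = Fract a' b'" "peval q b' \<noteq> 0" "z = peval q a' / peval q b'" by blast
  have "b \<noteq> 0" "b' \<noteq> 0" using assms z(2) by auto
  then have "a * b' = a' * b" using z(1) by (simp add: eq_fract)
  then have "peval q a * peval q b' = peval q a' * peval q b" by (metis peval_mult)
  then show "z = peval q a / peval q b" using assms z by (simp add: frac_eq_eq)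
qed

lemma defined_atE:
  assumes "defined_at K q"
  obtains a b where "K = Fract a b" "peval q b \<noteq> 0" "b \<noteq> 0" "rvalue K q = peval q a / peval q b"
proof -
  obtain a b where ab: "K = Fract a b" "peval q b \<noteq> 0" using assms unfolding defined_at_def by blast
  then have "b \<noteq> 0" by auto
  then show ?thesis using that ab rvalue_Fract by metis
qed

lemma rvalue_arith:
  assumes K: "defined_at K q" and L: "defined_at L q"
  shows "rvalue (K + L) q = rvalue K q + rvalue L q" "rvalue (K * L) q = rvalue K q * rvalue L q"
    "rvalue (- K) q = - rvalue K q"
proof -
  obtain a b where a: "K = Fract a b" "peval q b \<noteq> 0" "b \<noteq> 0" "rvalue K q = peval q a / peval q b"
    by (rule defined_atE[OF K]) (rule that)
  obtain c d where c: "L = Fract c d" "peval q d \<noteq> 0" "d \<noteq> 0" "rvalue L q = peval q c / peval q d"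
    by (rule defined_atE[OF L]) (rule that)
  have "rvalue (Fract (a * d + c * b) (b * d)) q = rvalue K q + rvalue L q"
    unfolding a(4) c(4) add_frac_eq[OF a(2) c(2)]
    by (subst rvalue_Fract) (simp_all add: peval_add peval_mult a(2) c(2))
  moreover have "K + L = Fract (a * d + c * b) (b * d)" using a(1,3) c(1,3) by simp
  ultimately show "rvalue (K + L) q = rvalue K q + rvalue L q" by simp
  have "rvalue (Fract (a * c) (b * d)) q = rvalue K q * rvalue L q"
    unfolding a(4) c(4) by (subst rvalue_Fract) (simp_all add: peval_mult a(2) c(2))
  moreover have "K * L = Fract (a * c) (b * d)" using a(1) c(1) by simp
  ultimately show "rvalue (K * L) q = rvalue K q * rvalue L q" by simp
  have "rvalue (Fract (- a) b) q = - rvalue K q"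
    unfolding a(4) by (subst rvalue_Fract) (simp_all add: peval_uminus a(2))
  moreover have "- K = Fract (- a) b" using a(1) by simp
  ultimately show "rvalue (- K) q = - rvalue K q" by simp
qed

lemma defined_at_mult:
  assumes "defined_at K q" "defined_at L q"
  shows "defined_at (K * L) q"
proof -
  obtain a b where a: "K = Fract a b" "peval q b \<noteq> 0"
    by (rule defined_atE[OF assms(1)]) (rule that)
  obtain c d where c: "L = Fract c d" "peval q d \<noteq> 0"
    by (rule defined_atE[OF assms(2)]) (rule that)
  show ?thesis unfolding a(1) c(1) mult_fract
    by (rule defined_at_Fract) (simp add: peval_mult a(2) c(2))
qed

lemma pderivative_eq_0:
  assumes "i \<notin> pvars p"
  shows "pderivative i p = 0"
proof (rule poly_mapping_eqI)
  fix m
  have "m + single i 1 \<notin> keys p"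
  proof
    assume "m + single i 1 \<in> keys p"
    moreover have "i \<in> keys (m + single i 1)"
      by (simp add: in_keys_iff lookup_add)
    ultimately show False using assms unfolding pvars_def by blast
  qed
  then show "lookup (pderivative i p) m = lookup 0 m"
    by (simp add: lookup_pderivative in_keys_iff)
qed

lemma pderivation_delta: "pderivation (\<lambda>j. if j = i then 1 else 0) p = pderivative i p"
proof -
  have "pderivation (\<lambda>j. if j = i then 1 else 0) p = (\<Sum>j\<in>pvars p. if j = i then pderivative i p else 0)"
    unfolding pderivation_def by (rule sum.cong) auto
  also have "\<dots> = (if i \<in> pvars p then pderivative i p else 0)"
    by (simp add: pvars_def sum.delta)
  finally show ?thesis using pderivative_eq_0 by auto
qed

text \<open>Independence of the representation: differentiating \<open>a * b' = a' * b\<close> gives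
  the relation between the two quotient-rule numerators.\<close>

lemma rpartial_Fract:
  assumes "b \<noteq> 0"
  shows "rpartial i (Fract a b) = Fract (pderivative i a * b - a * pderivative i b) (b * b)"
  unfolding rpartial_def rderivation_def pderivation_delta
proof (rule the_equality)
  show "\<exists>a' b'. b' \<noteq> 0 \<and> Fract a b = Fract a' b' \<and> Fract (pderivative i a * b - a * pderivative i b) (b * b)
      = Fract (pderivative i a' * b' - a' * pderivative i b') (b' * b')"
    using assms by blast
  fix D assume "\<exists>a' b'. b' \<noteq> 0 \<and> Fract a b = Fract a' b' \<and>
     D = Fract (pderivative i a' * b' - a' * pderivative i b') (b' * b')"
  then obtain a' b' where b': "b' \<noteq> 0" and eq: "Fract a b = Fract a' b'"
    and D: "D = Fract (pderivative i a' * b' - a' * pderivative i b') (b' * b')" by blast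
  have e: "a * b' = a' * b" using eq assms b' by (simp add: eq_fract)
  have e': "pderivative i a * b' + a * pderivative i b' = pderivative i a' * b + a' * pderivative i b"
    using arg_cong[OF e, of "pderivative i"] by (simp add: pderivative_mult)
  have "(pderivative i a' * b' - a' * pderivative i b') * (b * b)
      = b' * (b * (pderivative i a' * b + a' * pderivative i b)) - b' * (b * (a' * pderivative i b))
        - (a' * b) * pderivative i b' * b"
    by (simp add: algebra_simps)
  also have "\<dots> = (pderivative i a * b - a * pderivative i b) * (b' * b')"
    unfolding e'[symmetric] e[symmetric]
    by (simp add: algebra_simps) (metis e mult.assoc mult.commute)
  finally show "D = Fract (pderivative i a * b - a * pderivative i b) (b * b)"
    unfolding D using assms b' by (simp add: eq_fract)
qed

lemma defined_at_rpartial: "defined_at K q \<Longrightarrow> defined_at (rpartial i K) q"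
  by (elim defined_atE) (auto simp: rpartial_Fract peval_simps intro!: defined_at_Fract)

lemma rvalue_rpartial:
  assumes "peval q b \<noteq> 0"
  shows "rvalue (rpartial i (Fract a b)) q
    = (peval q (pderivative i a) * peval q b - peval q a * peval q (pderivative i b)) / (peval q b * peval q b)"
proof -
  have "b \<noteq> 0" using assms by auto
  then show ?thesis using assms by (simp add: rpartial_Fract rvalue_Fract peval_simps)
qed

lemma has_field_derivative_peval_graph:
  assumes "(f has_field_derivative f') (at x)"
  shows "((\<lambda>x. peval (c(0 := x, Suc 0 := f x)) p) has_field_derivative
     (peval (c(0 := x, Suc 0 := f x)) (pderivative 0 p)
      + f' * peval (c(0 := x, Suc 0 := f x)) (pderivative (Suc 0) p))) (at x)"
proof -
  have "((\<lambda>x. peval (c(0 := x, Suc 0 := f x)) p) has_derivative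
     (\<lambda>h. \<Sum>i\<in>{0, Suc 0}. (if i = 0 then h else f' * h) * peval (c(0 := x, Suc 0 := f x)) (pderivative i p))) (at x)"
  proof (rule has_derivative_peval)
    fix i :: nat assume "i \<in> {0, Suc 0}"
    then show "((\<lambda>z. (c(0 := z, Suc 0 := f z)) i) has_derivative (\<lambda>h. if i = 0 then h else f' * h)) (at x)"
      using assms unfolding has_field_derivative_def by (auto simp: fun_upd_def)
  qed auto
  then show ?thesis
    unfolding has_field_derivative_def by (rule has_derivative_eq_rhs) (auto simp: algebra_simps)
qed

text \<open>A denominator that is nonzero at the point stays nonzero nearby, so one representation
  is valid in a neighbourhood and the analytic quotient rule matches the formal one.\<close>

lemma has_field_derivative_rvalue_graph:
  assumes f: "(f has_field_derivative f') (at x)" and def: "defined_at K (c(0 := x, Suc 0 := f x))"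
  shows "((\<lambda>x. rvalue K (c(0 := x, Suc 0 := f x))) has_field_derivative
     (rvalue (rpartial 0 K) (c(0 := x, Suc 0 := f x))
      + f' * rvalue (rpartial (Suc 0) K) (c(0 := x, Suc 0 := f x)))) (at x)"
proof -
  let ?q = "\<lambda>x. c(0 := x, Suc 0 := f x)"
  obtain a b where ab: "K = Fract a b" "peval (?q x) b \<noteq> 0" by (rule defined_atE[OF def]) (rule that)
  note d = has_field_derivative_peval_graph[OF f, of c]
  have "((\<lambda>x. peval (?q x) a / peval (?q x) b) has_field_derivative
     (rvalue (rpartial 0 K) (?q x) + f' * rvalue (rpartial (Suc 0) K) (?q x))) (at x)"
    unfolding ab(1) rvalue_rpartial[OF ab(2)]
    by (rule DERIV_cong[OF DERIV_divide[OF d d ab(2)]])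
      (simp add: add_divide_distrib diff_divide_distrib algebra_simps del: fun_upd_apply)
  then have quot: "((\<lambda>x. peval (?q x) a / peval (?q x) b) has_field_derivative
     (rvalue (rpartial 0 K) (?q x) + f' * rvalue (rpartial (Suc 0) K) (?q x))) (at x)" .
  have "\<forall>\<^sub>F z in nhds x. peval (?q z) b \<noteq> 0"
  proof -
    have "((\<lambda>z. peval (?q z) b) \<longlongrightarrow> peval (?q x) b) (nhds x)"
      using DERIV_isCont[OF d[of b]]
      unfolding isCont_def by (rule tendsto_at_iff_tendsto_nhds[THEN iffD1])
    then show ?thesis using ab(2) by (rule tendsto_imp_eventually_ne)
  qed
  then have "\<forall>\<^sub>F z in nhds x. peval (?q z) a / peval (?q z) b = rvalue K (?q z)"
    by eventually_elim (simp add: ab(1) rvalue_Fract)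
  from DERIV_cong_ev[OF refl this refl] show ?thesis using quot by (rule iffD1)
qed

text \<open>Implicit differentiation divides by nothing but the derivative with respect to
  \<open>y\<close>, so all derivatives are defined wherever it is nonzero.\<close>

lemma y_implicit_eq_Fract:
  assumes "pderivative (Suc 0) F \<noteq> 0"
  shows "\<exists>N e. y_implicit F m = Fract N (pderivative (Suc 0) F ^ e)"
proof -
  let ?h = "pderivative (Suc 0) F"
  have "\<exists>N e. y_implicit F (Suc m) = Fract N (?h ^ e)" for m
  proof (induction m)
    case 0
    show ?case by (rule exI[of _ "- pderivative 0 F"], rule exI[of _ 1]) (simp add: minus_fract)
  next
    case (Suc m)
    then obtain N e where N: "y_implicit F (Suc m) = Fract N (?h ^ e)" by blast
    obtain A B where AB: "rpartial 0 (Fract N (?h ^ e)) = Fract A (?h ^ e * ?h ^ e)"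
      "rpartial (Suc 0) (Fract N (?h ^ e)) = Fract B (?h ^ e * ?h ^ e)"
      using assms by (simp add: rpartial_Fract)
    \<comment> \<open>The summands have denominators with exponents \<open>e + e\<close> and
      \<open>1 + e + e\<close>; the sum is formed over the product of these denominators.\<close>
    show ?case
      by (rule exI, rule exI[of _ "e + e + (1 + e + e)"])
        (simp add: N AB assms power_add mult_ac)
  qed
  moreover have "y_implicit F 0 = Fract (cvar 1) (?h ^ 0)" by (simp add: rvar_def)
  ultimately show ?thesis by (metis not0_implies_Suc)
qed

lemma local_graph_exists:
  assumes "peval p F = 0" "p \<in> affine_space {0, 1}" and nz: "peval p (pderivative 1 F) \<noteq> 0"
  shows "\<exists>f. local_graph F p f"
proof -
  let ?D = "\<lambda>i z. peval (plane_point (fst z) (snd z)) (pderivative i F)"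
  have p: "plane_point (p 0) (p 1) = p" by (rule plane_point_eta[OF assms(2)])
  have coord: "continuous_on UNIV (\<lambda>z. plane_point (fst z) (snd z) i)" for i
    by (cases "i = 0"; cases "i = 1") (auto intro!: continuous_intros)
  have der: "((\<lambda>z. peval (plane_point (fst z) (snd z)) F) has_derivative
      (\<lambda>h. ?D 0 z * fst h + ?D 1 z * snd h)) (at z)" for z :: "complex \<times> complex"
  proof -
    have "((\<lambda>z. peval (plane_point (fst z) (snd z)) F) has_derivative
      (\<lambda>h. \<Sum>i\<in>{0, 1}. plane_point (fst h) (snd h) i * ?D i z)) (at z)"
    proof (rule has_derivative_peval)
      fix i :: nat assume "i \<in> {0, 1}"
      then show "((\<lambda>z. plane_point (fst z) (snd z) i) has_derivative (\<lambda>h. plane_point (fst h) (snd h) i)) (at z)"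
        by (auto intro!: derivative_intros)
    qed auto
    then show ?thesis by (rule has_derivative_eq_rhs) (auto simp: mult.commute)
  qed
  have "\<exists>f. f analytic_on {p 0} \<and> f (p 0) = p 1 \<and> (\<forall>\<^sub>F (x, y) in nhds (p 0, p 1).
      peval (plane_point (fst (x, y)) (snd (x, y))) F = 0 \<longleftrightarrow> y = f x)"
    by (rule implicit_function[of _ "?D 0" "?D 1"])
      (use assms(1) nz in \<open>simp_all add: p[unfolded One_nat_def] der[unfolded One_nat_def] continuous_on_peval coord\<close>)
  then show ?thesis unfolding local_graph_def by auto
qed

text \<open>The condition near \<open>p\<close> includes \<open>p\<close> itself, and this forces
  the graph to pass through \<open>p\<close>, which \<open>local_graph\<close> does not demand
  explicitly. By continuity of \<open>f\<close>, the points \<open>(x, f x)\<close> stay in the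
  neighbourhood where the condition holds.\<close>

lemma local_graphD:
  assumes "local_graph F p f" "peval p F = 0" "p \<in> affine_space {0, 1}"
  shows "f (p 0) = p 1" "f analytic_on {p 0}"
    "\<forall>\<^sub>F x in nhds (p 0). peval (plane_point x (f x)) F = 0"
proof -
  have ev: "\<forall>\<^sub>F z in nhds (p 0, p 1). peval (plane_point (fst z) (snd z)) F = 0 \<longleftrightarrow> snd z = f (fst z)"
    using assms(1) by (simp add: local_graph_def case_prod_beta')
  show an: "f analytic_on {p 0}" using assms(1) by (simp add: local_graph_def)
  show f0: "f (p 0) = p 1"
    using eventually_nhds_x_imp_x[OF ev] assms(2) plane_point_eta[OF assms(3)] by simp
  have "isCont f (p 0)" using an analytic_at_imp_isCont by blast
  then have "(f \<longlongrightarrow> f (p 0)) (nhds (p 0))"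
    unfolding isCont_def by (rule tendsto_at_iff_tendsto_nhds[THEN iffD1])
  then have "((\<lambda>x. (x, f x)) \<longlongrightarrow> (p 0, p 1)) (nhds (p 0))"
    unfolding f0 by (intro tendsto_Pair filterlim_ident)
  then have "\<forall>\<^sub>F x in nhds (p 0). peval (plane_point (fst (x, f x)) (snd (x, f x))) F = 0 \<longleftrightarrow> snd (x, f x) = f (fst (x, f x))"
    by (rule eventually_compose_filterlim[OF ev])
  then show "\<forall>\<^sub>F x in nhds (p 0). peval (plane_point x (f x)) F = 0" by simp
qed

text \<open>Here \<open>F\<close> is \<open>U\<close> with its parameters set to \<open>c\<close>.
  The formal derivatives of \<open>U\<close> along the graph obey the recursion of the derivatives
  of \<open>f\<close>. Equality is claimed on a neighbourhood and not only at the point, so that it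
  can be differentiated again.\<close>

lemma deriv_local_graph:
  fixes U F :: "nat cpoly"
  assumes spec: "\<And>x y. peval (plane_point x y) F = peval (c(0 := x, Suc 0 := y)) U"
    and lg: "local_graph F p f" and p: "peval p F = 0" "p \<in> affine_space {0, 1}"
    and nz: "peval (c(0 := p 0, Suc 0 := p 1)) (pderivative (Suc 0) U) \<noteq> 0"
  shows "\<forall>\<^sub>F x in nhds (p 0). (deriv ^^ m) f x = rvalue (y_implicit U m) (c(0 := x, Suc 0 := f x))"
proof -
  let ?q = "\<lambda>x. c(0 := x, Suc 0 := f x)"
  have f0: "f (p 0) = p 1" and an: "f analytic_on {p 0}"
    and zero: "\<forall>\<^sub>F x in nhds (p 0). peval (?q x) U = 0"
    using local_graphD[OF lg p] by (simp_all add: spec)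
  have diff: "\<forall>\<^sub>F x in nhds (p 0). (f has_field_derivative deriv f x) (at x)"
  proof -
    obtain s where s: "open s" "p 0 \<in> s" "f holomorphic_on s" using an by (auto simp: analytic_at)
    have "\<forall>\<^sub>F x in nhds (p 0). x \<in> s" using s by (intro eventually_nhds_in_open)
    then show ?thesis by eventually_elim (use s holomorphic_derivI in blast)
  qed
  have U0: "pderivative (Suc 0) U \<noteq> 0" using nz by auto
  have nz': "\<forall>\<^sub>F x in nhds (p 0). peval (?q x) (pderivative (Suc 0) U) \<noteq> 0"
  proof -
    have "isCont (\<lambda>x. peval (?q x) (pderivative (Suc 0) U)) (p 0)"
      using DERIV_isCont[OF has_field_derivative_peval_graph[OF eventually_nhds_x_imp_x[OF diff]]] .
    then have "((\<lambda>x. peval (?q x) (pderivative (Suc 0) U)) \<longlongrightarrow> peval (?q (p 0)) (pderivative (Suc 0) U)) (nhds (p 0))"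
      unfolding isCont_def by (rule tendsto_at_iff_tendsto_nhds[THEN iffD1])
    then show ?thesis by (rule tendsto_imp_eventually_ne) (use nz f0 in simp)
  qed
  have def: "defined_at (y_implicit U m) (?q x)" if "peval (?q x) (pderivative (Suc 0) U) \<noteq> 0" for m x
  proof -
    obtain N e where N: "y_implicit U m = Fract N (pderivative (Suc 0) U ^ e)"
      using y_implicit_eq_Fract[OF U0] by blast
    show ?thesis unfolding N by (rule defined_at_Fract) (use that in \<open>simp add: peval_power\<close>)
  qed
  have y1: "\<forall>\<^sub>F x in nhds (p 0). deriv f x = rvalue (y_implicit U (Suc 0)) (?q x)"
    using zero[THEN eventually_eventually[THEN iffD2]] diff nz'
  proof eventually_elim
    case (elim x)
    let ?a = "peval (?q x) (pderivative 0 U)" and ?b = "peval (?q x) (pderivative (Suc 0) U)"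
    have "((\<lambda>x. peval (?q x) U) has_field_derivative ?a + deriv f x * ?b) (at x)"
      by (rule has_field_derivative_peval_graph[OF elim(2)])
    moreover have "((\<lambda>x. peval (?q x) U) has_field_derivative 0) (at x)"
      using DERIV_cong_ev[OF refl elim(1) refl] by simp
    ultimately have "?a + deriv f x * ?b = 0" by (rule DERIV_unique)
    then have "deriv f x = - ?a / ?b" using elim(3) by (simp add: field_simps add_eq_0_iff)
    moreover have "y_implicit U (Suc 0) = Fract (- pderivative 0 U) (pderivative (Suc 0) U)"
      by (simp add: minus_fract)
    ultimately show ?case using rvalue_Fract[OF elim(3)] by (simp only: peval_uminus)
  qed
  show ?thesis
  proof (induction m)
    case 0
    have "rvalue (rvar 1) q = q 1" for q
      unfolding rvar_def by (subst rvalue_Fract) simp_all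
    then show ?case by simp
  next
    case (Suc m)
    show ?case
    proof (cases m)
      case 0
      have "(deriv ^^ Suc 0) f = deriv f" by simp
      then show ?thesis using y1 by (simp only: 0)
    next
      case (Suc n)
      \<comment> \<open>The identity for \<open>m\<close> holds around every point near
        \<open>p 0\<close>, which permits differentiating both sides at all these points.\<close>
      show ?thesis
        using \<open>\<forall>\<^sub>F x in nhds (p 0). (deriv ^^ m) f x = rvalue (y_implicit U m) (?q x)\<close>[THEN eventually_eventually[THEN iffD2]]
          y1 diff nz'
      proof eventually_elim
        case (elim x)
        have d: "defined_at (y_implicit U k) (?q x)" for k by (rule def[OF elim(4)])
        have "(deriv ^^ Suc m) f x = deriv (\<lambda>x. rvalue (y_implicit U m) (?q x)) x"
          using deriv_cong_ev[OF elim(1) refl] by simp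
        also have "\<dots> = rvalue (rpartial 0 (y_implicit U m)) (?q x)
            + deriv f x * rvalue (rpartial (Suc 0) (y_implicit U m)) (?q x)"
          by (rule DERIV_imp_deriv[OF has_field_derivative_rvalue_graph[OF elim(3) d]])
        also have "\<dots> = rvalue (y_implicit U (Suc m)) (?q x)"
        proof -
          have dm: "defined_at (y_implicit U (Suc 0) * rpartial (Suc 0) (y_implicit U m)) (?q x)"
            by (rule defined_at_mult[OF d defined_at_rpartial[OF d]])
          have "y_implicit U (Suc m) = rpartial 0 (y_implicit U m)
              + y_implicit U (Suc 0) * rpartial (Suc 0) (y_implicit U m)"
            unfolding Suc by (simp only: y_implicit.simps(3) One_nat_def)
          then show ?thesis
            by (simp only: rvalue_arith(1)[OF defined_at_rpartial[OF d] dm]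
                rvalue_arith(2)[OF d defined_at_rpartial[OF d]] elim(2))
        qed
        finally show ?case .
      qed
    qed
  qed
qed

text \<open>The graph function in \<open>y_curve\<close> is picked by choice; the formula for the
  derivatives holds for every local graph, so the choice does not affect the value.\<close>

lemma y_curve_eq_y_implicit:
  fixes U F :: "nat cpoly"
  assumes spec: "\<And>x y. peval (plane_point x y) F = peval (c(0 := x, Suc 0 := y)) U"
    and p: "peval p F = 0" "p \<in> affine_space {0, 1}"
    and nz: "peval p (pderivative 1 F) \<noteq> 0"
      "peval (c(0 := p 0, Suc 0 := p 1)) (pderivative (Suc 0) U) \<noteq> 0"
  shows "y_curve F m p = rvalue (y_implicit U m) (c(0 := p 0, Suc 0 := p 1))"
proof -
  let ?f = "SOME f. local_graph F p f"
  have lg: "local_graph F p ?f"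
    using local_graph_exists[OF p nz(1)] by (rule someI_ex)
  show ?thesis
    unfolding y_curve_def
    using eventually_nhds_x_imp_x[OF deriv_local_graph[OF spec lg p nz(2), of m]] local_graphD(1)[OF lg p]
    by simp
qed

section \<open>The universal curve\<close>

abbreviation pt :: "(nat \<Rightarrow> complex) \<Rightarrow> complex \<Rightarrow> complex \<Rightarrow> nat \<Rightarrow> complex" where
  "pt c x y \<equiv> c(0 := x, Suc 0 := y)"

lemma finite_degree_pairs: "finite {(i, j). i + j \<le> (d::nat)}"
  by (rule finite_subset[of _ "{..d} \<times> {..d}"]) auto

lemma coeff_index_eq_iff [simp]: "coeff_index i j = coeff_index i' j' \<longleftrightarrow> i = i' \<and> j = j'"
  by (auto simp: coeff_index_def)

lemma coeff_index_neq [simp]: "coeff_index i j \<noteq> 0" "coeff_index i j \<noteq> Suc 0"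
  "0 \<noteq> coeff_index i j" "Suc 0 \<noteq> coeff_index i j"
  by (simp_all add: coeff_index_def)

lemma zero_one_notin_coeff_indices [simp]: "0 \<notin> coeff_indices d" "Suc 0 \<notin> coeff_indices d"
  by (auto simp: coeff_indices_def)

lemma coeff_index_in [simp]: "coeff_index i j \<in> coeff_indices d \<longleftrightarrow> i + j \<le> d"
  by (auto simp: coeff_indices_def)

lemma finite_coeff_indices: "finite (coeff_indices d)"
proof -
  have "coeff_indices d = (\<lambda>(i, j). coeff_index i j) ` {(i, j). i + j \<le> d}"
    by (auto simp: coeff_indices_def)
  then show ?thesis using finite_degree_pairs by simp
qed

lemma peval_specialization: "peval a (specialization d c)
    = (\<Sum>(i, j)\<in>{(i, j). i + j \<le> d}. c (coeff_index i j) * a 0 ^ i * a (Suc 0) ^ j)"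
  by (simp add: specialization_def peval_simps case_prod_beta')

lemma peval_universal_poly: "peval q (universal_poly d)
    = (\<Sum>(i, j)\<in>{(i, j). i + j \<le> d}. q (coeff_index i j) * q 0 ^ i * q (Suc 0) ^ j)"
  by (simp add: universal_poly_def peval_simps case_prod_beta')

lemma peval_specialization_eq:
  "peval (plane_point x y) (specialization d c) = peval (pt c x y) (universal_poly d)"
  unfolding peval_specialization peval_universal_poly by simp

lemma pvars_specialization: "pvars (specialization d c) \<subseteq> {0, 1}"
  unfolding specialization_def case_prod_beta' by (intro pvars_intros) auto

lemma specialization_surj:
  assumes w: "pvars w \<subseteq> {0, 1}" "total_degree w \<le> d"
  shows "\<exists>c\<in>affine_space (coeff_indices d). w = specialization d c"
proof -
  define \<mu> :: "nat \<times> nat \<Rightarrow> nat \<Rightarrow>\<^sub>0 nat"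
    where "\<mu> = (\<lambda>(i, j). single 0 i + single (Suc 0) j)"
  \<comment> \<open>\<open>n - 2\<close> undoes the offset in \<open>coeff_index\<close>, and
    \<open>\<mu>\<close> turns the decoded pair into an exponent vector.\<close>
  define c where "c = (\<lambda>n. if n \<in> coeff_indices d
    then lookup w (\<mu> (prod_decode (n - 2))) else 0)"
  let ?T = "{(i, j). i + j \<le> d}"
  have lk: "lookup (\<mu> (i, j)) 0 = i" "lookup (\<mu> (i, j)) (Suc 0) = j" for i j
    by (simp_all add: \<mu>_def lookup_add lookup_single)
  have inj: "inj_on \<mu> ?T"
    by (rule inj_onI) (metis lk surj_pair)
  have keys_mu: "keys (\<mu> ij) \<subseteq> {0, Suc 0}" for ij
    by (auto simp: \<mu>_def in_keys_iff lookup_add lookup_single when_def split: prod.splits if_splits)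
  have sub: "keys w \<subseteq> \<mu> ` ?T"
  proof
    fix m assume m: "m \<in> keys w"
    let ?i = "lookup m 0" and ?j = "lookup m (Suc 0)"
    have km: "keys m \<subseteq> {0, Suc 0}" using w(1) m by (auto simp: pvars_def)
    have "m = \<mu> (?i, ?j)"
    proof (rule poly_mapping_eqI)
      fix n show "lookup m n = lookup (\<mu> (?i, ?j)) n"
      proof (cases "n = 0 \<or> n = Suc 0")
        case True
        then show ?thesis by (auto simp: lk)
      next
        case False
        then have "n \<notin> keys m" "n \<notin> keys (\<mu> (?i, ?j))"
          using km keys_mu by blast+
        then show ?thesis by (simp add: in_keys_iff)
      qed
    qed
    moreover have "mdeg UNIV m = ?i + ?j"
      using mdeg_superset[of "{0, Suc 0}" m UNIV] km by simp
    then have "?i + ?j \<le> d" using mdeg_le_degree_in[OF m, of UNIV] w(2) by simp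
    ultimately show "m \<in> \<mu> ` ?T" by blast
  qed
  have "w = specialization d c"
  proof (rule cpoly_plane_eqI[OF w(1) pvars_specialization])
    fix x y
    let ?g = "\<lambda>m a. a * (\<Prod>i\<in>keys m. plane_point x y i ^ lookup m i)"
    have pr: "(\<Prod>n\<in>keys (\<mu> (i, j)). plane_point x y n ^ lookup (\<mu> (i, j)) n) = x ^ i * y ^ j" for i j
      by (subst prod_keys_superset[of "{0, Suc 0}"]) (use keys_mu in \<open>auto simp: lk\<close>)
    have "peval (plane_point x y) w = (\<Sum>m\<in>\<mu> ` ?T. ?g m (lookup w m))"
      unfolding peval_def using finite_degree_pairs sub by (intro poly_mapping_sum_superset) auto
    also have "\<dots> = (\<Sum>ij\<in>?T. ?g (\<mu> ij) (lookup w (\<mu> ij)))"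
      using inj by (subst sum.reindex) auto
    also have "\<dots> = peval (plane_point x y) (specialization d c)"
      unfolding peval_specialization
      by (rule sum.cong) (auto simp: pr c_def mult.assoc coeff_index_def[of _ _] prod_encode_inverse
          simp flip: coeff_index_in)
    finally show "peval (plane_point x y) w = peval (plane_point x y) (specialization d c)" .
  qed
  moreover have "c \<in> affine_space (coeff_indices d)" by (simp add: affine_space_def c_def)
  ultimately show ?thesis by blast
qed

text \<open>Along the line a monomial becomes a polynomial in \<open>t\<close>, from its coefficient
  variables, times its part in the variables 0 and 1. Collecting powers of \<open>t\<close> leaves
  the latter untouched, whence the degree bound.\<close>

lemma expand_along_line:
  fixes p :: "nat cpoly"
  shows "\<exists>S n. (\<forall>j. pvars (S j) \<subseteq> {0, 1} \<and> total_degree (S j) \<le> degree_in {0, 1} p) \<and>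
    (\<forall>t x y. peval (pt (\<lambda>i. c i + t * w i) x y) p = (\<Sum>j\<le>n. t ^ j * peval (plane_point x y) (S j)))"
proof -
  define \<pi> where "\<pi> = (\<lambda>m :: nat \<Rightarrow>\<^sub>0 nat. \<Prod>i\<in>keys m - {0, Suc 0}. [:c i, w i:] ^ lookup m i)"
  \<comment> \<open>A crude common bound: the sum of the degrees in \<open>t\<close> dominates each
    of them.\<close>
  define n where "n = (\<Sum>m\<in>keys p. degree (\<pi> m))"
  define S :: "nat \<Rightarrow> nat cpoly" where "S = (\<lambda>j. \<Sum>m\<in>keys p.
    cconst (lookup p m * coeff (\<pi> m) j) * (cvar 0 ^ lookup m 0 * cvar (Suc 0) ^ lookup m (Suc 0)))"
  have "pvars (S j) \<subseteq> {0, 1}" for j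
    unfolding S_def by (intro pvars_intros) auto
  moreover have "total_degree (S j) \<le> degree_in {0, 1} p" for j
    unfolding S_def
  proof (rule degree_in_sum_le)
    fix m assume m: "m \<in> keys p"
    let ?i = "lookup m 0" and ?j = "lookup m (Suc 0)"
    have "total_degree (cconst (lookup p m * coeff (\<pi> m) j) * (cvar 0 ^ ?i * cvar (Suc 0) ^ ?j))
        \<le> 0 + (?i * 1 + ?j * 1)"
      by (intro order.trans[OF degree_in_mult_le] add_mono order.trans[OF degree_in_power_le] mult_mono)
        (auto simp: degree_in_cvar)
    also have "\<dots> = mdeg {0, 1} m"
      by (subst mdeg_superset[of "insert 0 (insert (Suc 0) (keys m))"]) auto
    also have "\<dots> \<le> degree_in {0, 1} p" by (rule mdeg_le_degree_in[OF m])
    finally show "total_degree (cconst (lookup p m * coeff (\<pi> m) j) * (cvar 0 ^ ?i * cvar (Suc 0) ^ ?j))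
        \<le> degree_in {0, 1} p" .
  qed
  moreover have "peval (pt (\<lambda>i. c i + t * w i) x y) p = (\<Sum>j\<le>n. t ^ j * peval (plane_point x y) (S j))" for t x y
  proof -
    let ?c = "\<lambda>i. c i + t * w i"
    have *: "(\<Prod>i\<in>keys m. (pt ?c x y) i ^ lookup m i)
        = (\<Sum>j\<le>n. t ^ j * coeff (\<pi> m) j) * (x ^ lookup m 0 * y ^ lookup m (Suc 0))"
      if m: "m \<in> keys p" for m
    proof -
      let ?B = "keys m - {0, Suc 0}"
      have dn: "degree (\<pi> m) \<le> n" unfolding n_def using m by (intro member_le_sum) auto
      have "(\<Prod>i\<in>keys m. (pt ?c x y) i ^ lookup m i)
          = (\<Prod>i\<in>?B \<union> {0, Suc 0}. (pt ?c x y) i ^ lookup m i)"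
        by (rule prod_keys_superset) auto
      also have "\<dots> = (\<Prod>i\<in>?B. (pt ?c x y) i ^ lookup m i)
          * (x ^ lookup m 0 * y ^ lookup m (Suc 0))"
        by (subst prod.union_disjoint) auto
      also have "(\<Prod>i\<in>?B. (pt ?c x y) i ^ lookup m i) = poly (\<pi> m) t"
        unfolding \<pi>_def poly_prod by (rule prod.cong) (auto simp: poly_power)
      also have "poly (\<pi> m) t = (\<Sum>j\<le>n. t ^ j * coeff (\<pi> m) j)"
        unfolding poly_altdef using dn
        by (intro sum.mono_neutral_cong_left) (auto simp: coeff_eq_0 mult.commute)
      finally show ?thesis .
    qed
    have "peval (pt ?c x y) p = (\<Sum>m\<in>keys p. lookup p m *
        ((\<Sum>j\<le>n. t ^ j * coeff (\<pi> m) j) * (x ^ lookup m 0 * y ^ lookup m (Suc 0))))"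
      unfolding peval_def by (rule sum.cong[OF refl]) (simp only: *)
    also have "\<dots> = (\<Sum>m\<in>keys p. \<Sum>j\<le>n. t ^ j * (lookup p m * coeff (\<pi> m) j *
        (x ^ lookup m 0 * y ^ lookup m (Suc 0))))"
      by (simp add: sum_distrib_left sum_distrib_right mult_ac)
    also have "\<dots> = (\<Sum>j\<le>n. \<Sum>m\<in>keys p. t ^ j * (lookup p m * coeff (\<pi> m) j *
        (x ^ lookup m 0 * y ^ lookup m (Suc 0))))"
      by (rule sum.swap)
    also have "\<dots> = (\<Sum>j\<le>n. t ^ j * peval (plane_point x y) (S j))"
      unfolding S_def by (simp add: peval_simps sum_distrib_left)
    finally show ?thesis .
  qed
  ultimately show ?thesis by (intro exI[of _ S] exI[of _ n] conjI allI)
qed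

text \<open>The universal polynomial is affine in each coefficient variable. This makes it possible
  to place points on the curve and to perturb its derivatives through a single coefficient.\<close>

lemma universal_poly_update_coeff:
  assumes "i + j \<le> d"
  shows "peval (q(coeff_index i j := z)) (universal_poly d)
    = peval q (universal_poly d) + (z - q (coeff_index i j)) * (q 0 ^ i * q (Suc 0) ^ j)"
proof -
  let ?T = "{(i, j). i + j \<le> d}"
  let ?f = "\<lambda>q (i, j). q (coeff_index i j) * q 0 ^ i * q (Suc 0) ^ j"
  have T: "(i, j) \<in> ?T" using assms by simp
  have "sum (?f (q(coeff_index i j := z))) (?T - {(i, j)}) = sum (?f q) (?T - {(i, j)})"
    by (rule sum.cong[OF refl]) (clarsimp, metis)
  then show ?thesis
    unfolding peval_universal_poly sum.remove[OF finite_degree_pairs T]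
    by (simp add: algebra_simps)
qed

text \<open>The equation of the universal curve can be solved for \<open>c\<^sub>0\<^sub>0\<close>, so the curve is a polynomial retract of
  affine space.\<close>

lemma universal_curve_no_zero_divisors:
  assumes f: "polyfun (coeff_indices d \<union> {0, 1}) f" and g: "polyfun (coeff_indices d \<union> {0, 1}) g"
    and van: "\<And>q. q \<in> universal_curve d \<Longrightarrow> f q * g q = 0"
  shows "(\<forall>q\<in>universal_curve d. f q = 0) \<or> (\<forall>q\<in>universal_curve d. g q = 0)"
proof -
  let ?J = "coeff_indices d \<union> {0, 1}" and ?U = "universal_poly d"
  define \<rho> where "\<rho> = (\<lambda>q. q(coeff_index 0 0 := q (coeff_index 0 0) - peval q ?U))"
  have aff: "\<rho> q \<in> affine_space ?J" if "q \<in> affine_space ?J" for q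
    using that by (auto simp: affine_space_def \<rho>_def)
  have on: "\<rho> q \<in> universal_curve d" if "q \<in> affine_space ?J" for q
    using aff[OF that] by (simp add: universal_curve_def \<rho>_def universal_poly_update_coeff)
  have id: "\<rho> q = q" if "q \<in> universal_curve d" for q
    using that by (simp add: universal_curve_def \<rho>_def)
  have poly: "polyfun ?J (\<lambda>q. \<rho> q i)" for i
  proof (cases "i = coeff_index 0 0")
    case True
    have "polyfun ?J (\<lambda>q. q i - peval q ?U)"
      by (intro polyfun_diff polyfun_coord polyfun_comp_peval)
    then show ?thesis using True by (simp add: \<rho>_def)
  next
    case False
    then show ?thesis by (simp add: \<rho>_def polyfun_coord)
  qed
  have "(\<forall>q\<in>affine_space ?J. f (\<rho> q) = 0) \<or> (\<forall>q\<in>affine_space ?J. g (\<rho> q) = 0)"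
    by (rule polyfun_no_zero_divisors) (use polyfun_comp[OF f poly aff] polyfun_comp[OF g poly aff] van on in auto)
  moreover have "universal_curve d \<subseteq> affine_space ?J" by (auto simp: universal_curve_def)
  ultimately show ?thesis using id by (metis subsetD)
qed

text \<open>Both sides are the derivative of the same function of the second coordinate, so
  uniqueness of derivatives gives the equality.\<close>

lemma peval_pderivative_eq:
  assumes "\<And>x y. peval (plane_point x y) F = peval (pt c x y) U"
  shows "peval (plane_point x y) (pderivative 1 F) = peval (pt c x y) (pderivative (Suc 0) U)"
proof -
  have 1: "((\<lambda>t. peval (plane_point x t) F) has_derivative
      (\<lambda>h. \<Sum>i\<in>{Suc 0}. h * peval (plane_point x y) (pderivative i F))) (at y)"
  proof (rule has_derivative_peval)
    show "plane_point x z' i = plane_point x y i" if "i \<notin> {Suc 0}" for i z'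
      using that by (cases "i = 0") auto
  qed auto
  have 2: "((\<lambda>t. peval (pt c x t) U) has_derivative
      (\<lambda>h. \<Sum>i\<in>{Suc 0}. h * peval (pt c x y) (pderivative i U))) (at y)"
    by (rule has_derivative_peval) auto
  have "(\<lambda>h. h * peval (plane_point x y) (pderivative (Suc 0) F)) = (\<lambda>h. h * peval (pt c x y) (pderivative (Suc 0) U))"
    using has_derivative_unique[OF 1[unfolded assms] 2] by simp
  from fun_cong[OF this, of 1] show ?thesis by simp
qed

abbreviation coeff_plane :: "nat \<Rightarrow> nat set" where
  "coeff_plane d \<equiv> coeff_indices d \<union> {0, 1}"

abbreviation univ_y :: "nat \<Rightarrow> nat cpoly" where
  "univ_y d \<equiv> pderivative (Suc 0) (universal_poly d)"

lemma pt_in_affine_space: "c \<in> affine_space (coeff_indices d) \<Longrightarrow> pt c x y \<in> affine_space (coeff_plane d)"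
  by (auto simp: affine_space_def)

lemma defined_at_y_implicit:
  assumes "peval q (pderivative (Suc 0) U) \<noteq> 0"
  shows "defined_at (y_implicit U m) q"
proof -
  have "pderivative (Suc 0) U \<noteq> 0" using assms by auto
  then obtain N e where N: "y_implicit U m = Fract N (pderivative (Suc 0) U ^ e)"
    using y_implicit_eq_Fract by blast
  show ?thesis unfolding N by (rule defined_at_Fract) (use assms in \<open>simp add: peval_power\<close>)
qed

lemma super_jet_defined_if_nonvertical:
  "q \<in> universal_curve d \<Longrightarrow> peval q (univ_y d) \<noteq> 0 \<Longrightarrow> super_jet_defined d n q"
  by (simp add: super_jet_defined_def defined_at_y_implicit)

text \<open>The bridge between one curve and the universal curve: jets computed from the local graph
  agree with formal implicit differentiation in which the coefficients are parameters.\<close>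

lemma jet_defined_specialization:
  assumes c: "c \<in> affine_space (coeff_indices d)" and p: "jet_defined (specialization d c) p"
  shows "pt c (p 0) (p 1) \<in> universal_curve d" "peval (pt c (p 0) (p 1)) (univ_y d) \<noteq> 0"
    "jet (specialization d c) n p = super_jet d n (pt c (p 0) (p 1))"
proof -
  let ?q = "pt c (p 0) (p 1)" and ?F = "specialization d c"
  have pF: "peval p ?F = 0" "p \<in> affine_space {0, 1}" and nz: "peval p (pderivative 1 ?F) \<noteq> 0"
    using p by (auto simp: jet_defined_def curve_def)
  note eta = plane_point_eta[OF pF(2)]
  show "?q \<in> universal_curve d"
    using pF(1) peval_specialization_eq[of "p 0" "p 1" d c] pt_in_affine_space[OF c]
    unfolding eta by (simp add: universal_curve_def)
  show nz': "peval ?q (univ_y d) \<noteq> 0"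
    using nz peval_pderivative_eq[OF peval_specialization_eq, of "p 0" "p 1" d c] unfolding eta by simp
  have "y_curve ?F m p = rvalue (y_implicit (universal_poly d) m) ?q" for m
    by (rule y_curve_eq_y_implicit[OF peval_specialization_eq pF nz nz'])
  then show "jet ?F n p = super_jet d n ?q"
    by (simp add: jet_def super_jet_def jet_point_def fun_eq_iff)
qed

lemma jet_defined_specializationI:
  assumes "pt c (p 0) (p 1) \<in> universal_curve d" "peval (pt c (p 0) (p 1)) (univ_y d) \<noteq> 0"
    "p \<in> affine_space {0, 1}"
  shows "jet_defined (specialization d c) p"
  using assms peval_specialization_eq[of "p 0" "p 1" d c] plane_point_eta[OF assms(3)]
    peval_pderivative_eq[OF peval_specialization_eq, of "p 0" "p 1" d c]
  by (simp add: jet_defined_def curve_def universal_curve_def)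

text \<open>At the coefficient vector whose only nonzero entry is \<open>1\<close> at the monomial
  \<open>y\<close>, the universal polynomial is \<open>y\<close>, with derivative 1.\<close>

lemma univ_y_neq_0:
  assumes "d \<ge> 1"
  shows "univ_y d \<noteq> 0"
proof
  assume "univ_y d = 0"
  let ?q = "(\<lambda>_. 0)(coeff_index 0 1 := 1 :: complex)"
  have U: "peval (pt ?q 0 y) (universal_poly d) = y" for y
  proof -
    have "peval (pt (\<lambda>_. 0) 0 y) (universal_poly d) = 0" by (simp add: peval_universal_poly)
    then show ?thesis
      using universal_poly_update_coeff[of 0 1 d "pt (\<lambda>_. 0) 0 y" 1] assms by (simp add: fun_upd_twist)
  qed
  have "((\<lambda>y. peval (pt ?q 0 y) (universal_poly d)) has_derivative
      (\<lambda>h. \<Sum>i\<in>{Suc 0}. h * peval (pt ?q 0 0) (pderivative i (universal_poly d)))) (at 0)"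
    by (rule has_derivative_peval) auto
  then have "((\<lambda>y. y) has_derivative (\<lambda>h. 0 :: complex)) (at (0 :: complex))"
    unfolding U using \<open>univ_y d = 0\<close> by simp
  then have "(\<lambda>h::complex. 0 :: complex) = (\<lambda>h. h)" using has_derivative_ident has_derivative_unique by blast
  from fun_cong[OF this, of 1] show False by simp
qed

text \<open>A priori \<open>y\<^sup>(\<^sup>1\<^sup>) = - F\<^sub>x / F\<^sub>y\<close> could be defined at a zero of \<open>F\<^sub>y\<close> through another representation.
  Varying \<open>c\<^sub>1\<^sub>0\<close>, which changes \<open>F\<^sub>x\<close> but not \<open>F\<^sub>y\<close>, excludes this.\<close>

lemma nonvertical_if_super_jet_defined:
  assumes q: "super_jet_defined d n q" and "n \<ge> 1" "d \<ge> 1"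
  shows "peval q (univ_y d) \<noteq> 0"
proof
  assume hq: "peval q (univ_y d) = 0"
  let ?U = "universal_poly d"
  have "defined_at (y_implicit ?U (Suc 0)) q" using q \<open>n \<ge> 1\<close> by (auto simp: super_jet_defined_def)
  then obtain a b where ab: "y_implicit ?U (Suc 0) = Fract a b" "peval q b \<noteq> 0" "b \<noteq> 0"
    by (rule defined_atE) (rule that)
  define \<gamma> where "\<gamma> = (\<lambda>s. q(coeff_index 1 0 := q (coeff_index 1 0) + s))"
  have U\<gamma>: "peval (pt (\<gamma> s) x y) ?U = peval (pt q x y) ?U + s * x" for s x y
    using universal_poly_update_coeff[of 1 0 d "pt q x y" "q (coeff_index 1 0) + s"] \<open>d \<ge> 1\<close>
    by (simp add: \<gamma>_def fun_upd_twist)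
  have pt\<gamma>: "pt (\<gamma> s) (q 0) (q 1) = \<gamma> s" "pt q (q 0) (q 1) = q" for s
    by (auto simp: \<gamma>_def fun_eq_iff)
  have d0: "peval (\<gamma> s) (pderivative 0 ?U) = peval q (pderivative 0 ?U) + s" for s
  proof -
    have "((\<lambda>x. peval (pt (\<gamma> s) x (q 1)) ?U) has_field_derivative peval (\<gamma> s) (pderivative 0 ?U)) (at (q 0))"
      using has_field_derivative_peval_graph[OF DERIV_const[of "q 1"], where c = "\<gamma> s" and x = "q 0" and p = ?U] pt\<gamma>(1)[of s]
      by simp
    moreover have "((\<lambda>x. peval (pt q x (q 1)) ?U + s * x) has_field_derivative peval q (pderivative 0 ?U) + s) (at (q 0))"
      using DERIV_add[OF has_field_derivative_peval_graph[OF DERIV_const[of "q 1"], where c = q and x = "q 0" and p = ?U] DERIV_cmult_Id[of s]] pt\<gamma>(2)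
      by simp
    ultimately show ?thesis unfolding U\<gamma> by (rule DERIV_unique)
  qed
  have d1: "peval (\<gamma> s) (univ_y d) = 0" for s
  proof -
    have D: "((\<lambda>y. peval (pt c (q 0) y) ?U) has_field_derivative peval c (univ_y d)) (at (q 1))"
      if "pt c (q 0) (q 1) = c" for c
    proof -
      have "((\<lambda>y. peval (pt c (q 0) y) ?U) has_derivative
          (\<lambda>h. \<Sum>i\<in>{Suc 0}. h * peval (pt c (q 0) (q 1)) (pderivative i ?U))) (at (q 1))"
        by (rule has_derivative_peval) auto
      then show ?thesis unfolding has_field_derivative_def that
        by (rule has_derivative_eq_rhs) (auto simp: mult.commute)
    qed
    have "((\<lambda>y. peval (pt q (q 0) y) ?U + s * q 0) has_field_derivative peval q (univ_y d) + 0) (at (q 1))"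
      by (intro DERIV_add D pt\<gamma> DERIV_const)
    then show ?thesis
      using D[OF pt\<gamma>(1), of s] unfolding U\<gamma> hq by (auto dest: DERIV_unique)
  qed
  have "Fract a b = Fract (- pderivative 0 ?U) (univ_y d)"
    using ab(1) by (simp add: minus_fract)
  then have e: "a * univ_y d = - pderivative 0 ?U * b"
    using ab(3) univ_y_neq_0[OF \<open>d \<ge> 1\<close>] by (simp add: eq_fract)
  \<comment> \<open>Along \<open>\<gamma>\<close> the left side of \<open>e\<close> is 0, while the
    \<open>x\<close>-derivative is nonzero except for one \<open>s\<close>. So the denominator
    \<open>b\<close> vanishes there, and by continuity at \<open>q\<close>.\<close>
  have b0: "peval (\<gamma> s) b = 0" if "s \<noteq> - peval q (pderivative 0 ?U)" for s
    using arg_cong[OF e, of "peval (\<gamma> s)"] that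
    by (simp add: peval_mult peval_uminus d0 d1 add_eq_0_iff)
  have "((\<lambda>s. peval (\<gamma> s) b) \<longlongrightarrow> peval q b) (at 0)"
  proof (rule tendsto_peval)
    fix i show "((\<lambda>s. \<gamma> s i) \<longlongrightarrow> q i) (at 0)"
      by (cases "i = coeff_index 1 0") (auto simp: \<gamma>_def intro!: tendsto_eq_intros)
  qed
  moreover have "\<forall>\<^sub>F s in at 0. peval (\<gamma> s) b = 0"
    using eventually_neq_at_within[of "- peval q (pderivative 0 ?U)" 0 UNIV]
    by (rule eventually_mono) (rule b0)
  then have "((\<lambda>s. peval (\<gamma> s) b) \<longlongrightarrow> 0) (at 0)" by (rule tendsto_eventually)
  ultimately have "peval q b = 0" using tendsto_unique[OF at_neq_bot] by blast
  then show False using ab(2) by simp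
qed

section \<open>Signatures along the universal curve\<close>

text \<open>Elements of the localization at \<open>h\<close>: quotients \<open>A / h ^ e\<close> on
  the principal open set where \<open>h\<close> is nonzero, with no condition elsewhere. The
  exponent may depend on \<open>f\<close>.\<close>

definition regular_off :: "'v set \<Rightarrow> (('v \<Rightarrow> complex) \<Rightarrow> complex) \<Rightarrow> (('v \<Rightarrow> complex) \<Rightarrow> complex) \<Rightarrow> bool" where
  "regular_off I h f \<longleftrightarrow> (\<exists>A e. polyfun I A \<and> (\<forall>a\<in>affine_space I. h a \<noteq> 0 \<longrightarrow> f a * h a ^ e = A a))"

lemma regular_off_polyfun: "polyfun I f \<Longrightarrow> regular_off I h f"
  unfolding regular_off_def by (rule exI[of _ f], rule exI[of _ 0]) simp

lemma regular_off_add: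
  assumes "polyfun I h" "regular_off I h f" "regular_off I h g"
  shows "regular_off I h (\<lambda>a. f a + g a)"
proof -
  obtain A m B n where A: "polyfun I A" "\<And>a. a \<in> affine_space I \<Longrightarrow> h a \<noteq> 0 \<Longrightarrow> f a * h a ^ m = A a"
    and B: "polyfun I B" "\<And>a. a \<in> affine_space I \<Longrightarrow> h a \<noteq> 0 \<Longrightarrow> g a * h a ^ n = B a"
    using assms(2,3) unfolding regular_off_def by metis
  have "polyfun I (\<lambda>a. A a * h a ^ n + B a * h a ^ m)" by (intro polyfun_add polyfun_mult polyfun_power A(1) B(1) assms(1))
  moreover have "(f a + g a) * h a ^ (m + n) = A a * h a ^ n + B a * h a ^ m"
    if "a \<in> affine_space I" "h a \<noteq> 0" for a
    unfolding A(2)[OF that, symmetric] B(2)[OF that, symmetric] by (simp add: power_add algebra_simps)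
  ultimately show ?thesis unfolding regular_off_def by blast
qed

lemma regular_off_mult:
  assumes "regular_off I h f" "regular_off I h g"
  shows "regular_off I h (\<lambda>a. f a * g a)"
proof -
  obtain A m B n where A: "polyfun I A" "\<And>a. a \<in> affine_space I \<Longrightarrow> h a \<noteq> 0 \<Longrightarrow> f a * h a ^ m = A a"
    and B: "polyfun I B" "\<And>a. a \<in> affine_space I \<Longrightarrow> h a \<noteq> 0 \<Longrightarrow> g a * h a ^ n = B a"
    using assms unfolding regular_off_def by metis
  have "polyfun I (\<lambda>a. A a * B a)" by (intro polyfun_mult A(1) B(1))
  moreover have "(f a * g a) * h a ^ (m + n) = A a * B a"
    if "a \<in> affine_space I" "h a \<noteq> 0" for a
    unfolding A(2)[OF that, symmetric] B(2)[OF that, symmetric] by (simp add: power_add algebra_simps)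
  ultimately show ?thesis unfolding regular_off_def by blast
qed

lemma regular_off_peval:
  assumes "polyfun I h" "\<And>i. regular_off I h (\<lambda>a. \<phi> a i)"
  shows "regular_off I h (\<lambda>a. peval (\<phi> a) p)"
  by (induction p rule: cpoly_induct)
    (auto simp: peval_simps intro: regular_off_polyfun regular_off_add regular_off_mult assms)

lemma regular_off_super_jet:
  assumes "d \<ge> 1"
  shows "regular_off (coeff_plane d) (\<lambda>q. peval q (univ_y d)) (\<lambda>q. super_jet d n q i)"
proof -
  let ?h = "\<lambda>q. peval q (univ_y d)"
  have y: "regular_off (coeff_plane d) ?h (\<lambda>q. rvalue (y_implicit (universal_poly d) m) q)" for m
  proof -
    obtain N e where N: "y_implicit (universal_poly d) m = Fract N (univ_y d ^ e)"
      using y_implicit_eq_Fract[OF univ_y_neq_0[OF assms]] by blast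
    have "rvalue (Fract N (univ_y d ^ e)) a * ?h a ^ e = peval a N" if "?h a \<noteq> 0" for a
      using that by (subst rvalue_Fract) (auto simp: peval_power)
    then show ?thesis unfolding N regular_off_def
      by (intro exI[of _ "\<lambda>a. peval a N"] exI[of _ e]) (auto simp: polyfun_def)
  qed
  consider "i = 0" | "i \<noteq> 0" "i < n + 2" | "\<not> i < n + 2" by blast
  then show ?thesis
  proof cases
    case 1
    then show ?thesis by (auto simp: super_jet_def jet_point_def intro!: regular_off_polyfun)
  next
    case 2
    then have "(\<lambda>q. super_jet d n q i) = (\<lambda>q. rvalue (y_implicit (universal_poly d) (i - 1)) q)"
      by (simp add: super_jet_def jet_point_def)
    then show ?thesis using y by simp
  next
    case 3
    then have "(\<lambda>q. super_jet d n q i) = (\<lambda>q. 0)" by (auto simp: super_jet_def jet_point_def)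
    then show ?thesis using regular_off_polyfun[OF polyfun_const] by simp
  qed
qed

text \<open>A rational function need not have one representation that is valid on its whole domain, so the
  signature map is written as a quotient only off the zeros of a suitable \<open>H\<close>.\<close>

definition signature_chart :: "nat \<Rightarrow> nat \<Rightarrow> nat \<Rightarrow> ratfun \<Rightarrow> ratfun \<Rightarrow>
    ((nat \<Rightarrow> complex) \<Rightarrow> complex) \<Rightarrow> ((nat \<Rightarrow> complex) \<Rightarrow> complex) \<Rightarrow> ((nat \<Rightarrow> complex) \<Rightarrow> complex) \<Rightarrow> bool" where
  "signature_chart d k r K1 K2 N1 N2 H \<longleftrightarrow>
     polyfun (coeff_plane d) N1 \<and> polyfun (coeff_plane d) N2 \<and> polyfun (coeff_plane d) H \<and>
     (\<forall>q\<in>affine_space (coeff_plane d). H q \<noteq> 0 \<longrightarrow> peval q (univ_y d) \<noteq> 0 \<and>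
        defined_at K1 (super_jet d k q) \<and> defined_at K2 (super_jet d r q) \<and>
        rvalue K1 (super_jet d k q) = N1 q / H q \<and> rvalue K2 (super_jet d r q) = N2 q / H q)"

lemma signature_chartD:
  assumes "signature_chart d k r K1 K2 N1 N2 H"
  shows "polyfun (coeff_plane d) N1" "polyfun (coeff_plane d) N2" "polyfun (coeff_plane d) H"
    and "\<lbrakk>q \<in> affine_space (coeff_plane d); H q \<noteq> 0\<rbrakk> \<Longrightarrow> peval q (univ_y d) \<noteq> 0"
    and "\<lbrakk>q \<in> affine_space (coeff_plane d); H q \<noteq> 0\<rbrakk> \<Longrightarrow> defined_at K1 (super_jet d k q)"
    and "\<lbrakk>q \<in> affine_space (coeff_plane d); H q \<noteq> 0\<rbrakk> \<Longrightarrow> defined_at K2 (super_jet d r q)"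
    and "\<lbrakk>q \<in> affine_space (coeff_plane d); H q \<noteq> 0\<rbrakk> \<Longrightarrow> rvalue K1 (super_jet d k q) = N1 q / H q"
    and "\<lbrakk>q \<in> affine_space (coeff_plane d); H q \<noteq> 0\<rbrakk> \<Longrightarrow> rvalue K2 (super_jet d r q) = N2 q / H q"
  using assms unfolding signature_chart_def by simp_all

text \<open>A representation of \<open>K\<close> valid at the jet of \<open>q0\<close> is composed
  with the jet map; the jet coordinates contribute only powers of \<open>univ_y d\<close> as
  denominators.\<close>

lemma rational_chart_exists:
  assumes d: "d \<ge> 1" and q: "peval q0 (univ_y d) \<noteq> 0" "defined_at K (super_jet d n q0)"
    "q0 \<in> affine_space (coeff_plane d)"
  shows "\<exists>N M. polyfun (coeff_plane d) N \<and> polyfun (coeff_plane d) M \<and> M q0 \<noteq> 0 \<and>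
    (\<forall>q\<in>affine_space (coeff_plane d). peval q (univ_y d) \<noteq> 0 \<and> M q \<noteq> 0 \<longrightarrow>
       defined_at K (super_jet d n q) \<and> rvalue K (super_jet d n q) = N q / M q)"
proof -
  let ?h = "\<lambda>q. peval q (univ_y d)" and ?J = "coeff_plane d"
  obtain a b where ab: "K = Fract a b" "peval (super_jet d n q0) b \<noteq> 0"
    by (rule defined_atE[OF q(2)]) (rule that)
  have h: "polyfun ?J ?h" by (auto simp: polyfun_def)
  have "regular_off ?J ?h (\<lambda>q. peval (super_jet d n q) p)" for p
    by (intro regular_off_peval h regular_off_super_jet d)
  then obtain A m B l where A: "polyfun ?J A" "\<And>q. q \<in> affine_space ?J \<Longrightarrow> ?h q \<noteq> 0 \<Longrightarrow> peval (super_jet d n q) a * ?h q ^ m = A q"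
    and B: "polyfun ?J B" "\<And>q. q \<in> affine_space ?J \<Longrightarrow> ?h q \<noteq> 0 \<Longrightarrow> peval (super_jet d n q) b * ?h q ^ l = B q"
    unfolding regular_off_def by metis
  \<comment> \<open>With numerator \<open>A / h^m\<close> and denominator \<open>B / h^l\<close>,
    the quotient is \<open>(A * h^l) / (B * h^m)\<close>.\<close>
  show ?thesis
  proof (rule exI[of _ "\<lambda>q. A q * ?h q ^ l"], rule exI[of _ "\<lambda>q. B q * ?h q ^ m"], intro conjI ballI impI)
    show "polyfun ?J (\<lambda>q. A q * ?h q ^ l)" "polyfun ?J (\<lambda>q. B q * ?h q ^ m)"
      by (intro polyfun_mult polyfun_power A(1) B(1) h)+
    show "B q0 * ?h q0 ^ m \<noteq> 0" using B(2)[OF q(3,1)] ab(2) q(1) by auto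
    fix q assume qa: "q \<in> affine_space ?J" and n: "?h q \<noteq> 0 \<and> B q * ?h q ^ m \<noteq> 0"
    have hq: "?h q \<noteq> 0" using n by blast
    have bq: "peval (super_jet d n q) b \<noteq> 0" using n B(2)[OF qa hq] by auto
    show "defined_at K (super_jet d n q)" unfolding ab(1) using bq by (rule defined_at_Fract)
    show "rvalue K (super_jet d n q) = A q * ?h q ^ l / (B q * ?h q ^ m)"
      unfolding ab(1) rvalue_Fract[OF bq] A(2)[OF qa hq, symmetric] B(2)[OF qa hq, symmetric]
      using hq by (simp add: field_simps)
  qed
qed

lemma signature_chart_exists:
  assumes d: "d \<ge> 1" and q: "peval q0 (univ_y d) \<noteq> 0" "q0 \<in> affine_space (coeff_plane d)"
    and K: "defined_at K1 (super_jet d k q0)" "defined_at K2 (super_jet d r q0)"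
  obtains N1 N2 H where "signature_chart d k r K1 K2 N1 N2 H" "H q0 \<noteq> 0"
proof -
  let ?h = "\<lambda>q. peval q (univ_y d)" and ?J = "coeff_plane d"
  have h: "polyfun ?J ?h" by (auto simp: polyfun_def)
  obtain A M where A: "polyfun ?J A" "polyfun ?J M" "M q0 \<noteq> 0"
    "\<forall>q\<in>affine_space ?J. ?h q \<noteq> 0 \<and> M q \<noteq> 0 \<longrightarrow>
       defined_at K1 (super_jet d k q) \<and> rvalue K1 (super_jet d k q) = A q / M q"
    using rational_chart_exists[OF d q(1) K(1) q(2)] by blast
  obtain B L where B: "polyfun ?J B" "polyfun ?J L" "L q0 \<noteq> 0"
    "\<forall>q\<in>affine_space ?J. ?h q \<noteq> 0 \<and> L q \<noteq> 0 \<longrightarrow>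
       defined_at K2 (super_jet d r q) \<and> rvalue K2 (super_jet d r q) = B q / L q"
    using rational_chart_exists[OF d q(1) K(2) q(2)] by blast
  show ?thesis
  proof (rule that)
    \<comment> \<open>The factor \<open>?h\<close> makes a nonzero common denominator imply a
      nonvertical tangent as well.\<close>
    show "?h q0 * M q0 * L q0 \<noteq> 0" using q(1) A(3) B(3) by simp
    show "signature_chart d k r K1 K2 (\<lambda>q. A q * ?h q * L q) (\<lambda>q. B q * ?h q * M q) (\<lambda>q. ?h q * M q * L q)"
      unfolding signature_chart_def
    proof (intro conjI ballI impI)
      show "polyfun ?J (\<lambda>q. A q * ?h q * L q)" "polyfun ?J (\<lambda>q. B q * ?h q * M q)" "polyfun ?J (\<lambda>q. ?h q * M q * L q)"
        by (intro polyfun_mult A(1,2) B(1,2) h)+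
      fix q assume qa: "q \<in> affine_space ?J" and "?h q * M q * L q \<noteq> 0"
      then have n: "?h q \<noteq> 0" "M q \<noteq> 0" "L q \<noteq> 0" by auto
      show "?h q \<noteq> 0" by (rule n)
      show "defined_at K1 (super_jet d k q)" "defined_at K2 (super_jet d r q)"
        using A(4) B(4) qa n by blast+
      have e: "rvalue K1 (super_jet d k q) = A q / M q" "rvalue K2 (super_jet d r q) = B q / L q"
        using A(4) B(4) qa n by blast+
      show "rvalue K1 (super_jet d k q) = A q * ?h q * L q / (?h q * M q * L q)"
        "rvalue K2 (super_jet d r q) = B q * ?h q * M q / (?h q * M q * L q)"
        unfolding e using n by simp_all
    qed
  qed
qed

lemma signature_chart_super_image:
  assumes "signature_chart d k r K1 K2 N1 N2 H" "q \<in> universal_curve d" "H q \<noteq> 0"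
  shows "pt q (N1 q / H q) (N2 q / H q) \<in> super_signature_image d k r K1 K2"
proof -
  have qa: "q \<in> affine_space (coeff_plane d)" using assms(2) by (simp add: universal_curve_def)
  note c = signature_chartD(4-)[OF assms(1) qa assms(3)]
  show ?thesis unfolding super_signature_image_def c(4,5)[symmetric]
    using c super_jet_defined_if_nonvertical[OF assms(2) c(1)]
    by (intro CollectI exI[of _ q]) simp
qed

lemma tendsto_polyfun:
  assumes "polyfun I f" "\<And>i. ((\<lambda>t. \<gamma> t i) \<longlongrightarrow> a i) F" "\<And>t. \<gamma> t \<in> affine_space I" "a \<in> affine_space I"
  shows "((\<lambda>t. f (\<gamma> t)) \<longlongrightarrow> f a) F"
proof -
  obtain p where p: "\<And>a. a \<in> affine_space I \<Longrightarrow> f a = peval a p"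
    by (rule polyfunE[OF assms(1)]) (rule that)
  show ?thesis
    unfolding p[OF assms(3)] p[OF assms(4)] by (rule tendsto_peval[OF assms(2)])
qed

theorem specialized_vanishing_polynomial:
  assumes d: "d \<ge> 1" and c: "c \<in> affine_space (coeff_indices d)"
    and S: "S \<noteq> 0" "pvars S \<subseteq> coeff_plane d"
    and van: "\<forall>q\<in>super_signature_image d k r K1 K2. peval q S = 0"
  shows "\<exists>S'. S' \<noteq> 0 \<and> pvars S' \<subseteq> {0, 1} \<and> total_degree S' \<le> degree_in {0, 1} S \<and>
    (\<forall>z\<in>signature_image k r K1 K2 (specialization d c). peval z S' = 0)"
proof -
  obtain a where a: "a \<in> affine_space (coeff_plane d)" "peval a S \<noteq> 0"
    using eq_0_if_vanishes[OF S(2)] S(1) by blast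
  \<comment> \<open>The line passes through \<open>c\<close> at \<open>t = 0\<close> and through the
    coefficients of \<open>a\<close> at \<open>t = 1\<close>, so the nonzero value of
    \<open>S\<close> at \<open>a\<close> excludes that all \<open>T j\<close> vanish.\<close>
  define w where "w = (\<lambda>i. if i \<in> coeff_indices d then a i - c i else 0)"
  let ?c = "\<lambda>t i. c i + t * w i"
  have c1: "pt (?c 1) (a 0) (a 1) = a"
    using a(1) c by (auto simp: fun_eq_iff w_def affine_space_def)
  have caff: "?c t \<in> affine_space (coeff_indices d)" for t
    using c by (auto simp: affine_space_def w_def)
  obtain T n where T: "\<And>j. pvars (T j) \<subseteq> {0, 1}" "\<And>j. total_degree (T j) \<le> degree_in {0, 1} S"
    and exp: "\<And>t x y. peval (pt (?c t) x y) S = (\<Sum>j\<le>n. t ^ j * peval (plane_point x y) (T j))"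
    using expand_along_line[of S c w] by metis
  have "\<exists>j\<le>n. T j \<noteq> 0"
  proof (rule ccontr)
    assume "\<not> ?thesis"
    then have "peval (pt (?c 1) (a 0) (a 1)) S = 0" unfolding exp by simp
    then show False using a(2) unfolding c1 by simp
  qed
  \<comment> \<open>The order of vanishing of \<open>S\<close> in \<open>t\<close> at
    \<open>t = 0\<close>; it is positive exactly when \<open>S\<close> becomes zero at
    \<open>c\<close>.\<close>
  define m where "m = (LEAST j. T j \<noteq> 0)"
  obtain j0 where j0: "j0 \<le> n" "T j0 \<noteq> 0" using \<open>\<exists>j\<le>n. T j \<noteq> 0\<close> by blast
  have Tm: "T m \<noteq> 0" unfolding m_def by (rule LeastI[of "\<lambda>j. T j \<noteq> 0", OF j0(2)])
  have mn: "m \<le> n"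
    using Least_le[of "\<lambda>j. T j \<noteq> 0", OF j0(2)] j0(1) unfolding m_def by (rule order.trans)
  have low: "T j = 0" if "j < m" for j
    using not_less_Least[of j "\<lambda>j. T j \<noteq> 0"] that unfolding m_def by blast
  have exp': "peval (pt (?c t) x y) S = t ^ m * (\<Sum>j\<in>{m..n}. t ^ (j - m) * peval (plane_point x y) (T j))" for t x y
  proof -
    have "peval (pt (?c t) x y) S = (\<Sum>j\<in>{m..n}. t ^ j * peval (plane_point x y) (T j))"
      unfolding exp by (rule sum.mono_neutral_right) (auto simp: low not_le)
    also have "\<dots> = t ^ m * (\<Sum>j\<in>{m..n}. t ^ (j - m) * peval (plane_point x y) (T j))"
      unfolding sum_distrib_left by (rule sum.cong) (auto simp flip: power_add mult.assoc)
    finally show ?thesis .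
  qed
  have "peval z (T m) = 0" if z: "z \<in> signature_image k r K1 K2 (specialization d c)" for z
  proof -
    let ?F = "specialization d c" and ?U = "universal_poly d"
    obtain p where p: "jet_defined ?F p" "defined_at K1 (jet ?F k p)" "defined_at K2 (jet ?F r p)"
      and zp: "z = plane_point (rvalue K1 (jet ?F k p)) (rvalue K2 (jet ?F r p))"
      using z by (auto simp: signature_image_def restriction_defined_def restriction_def)
    let ?q = "pt c (p 0) (p 1)"
    note jd = jet_defined_specialization[OF c p(1)]
    have qa: "?q \<in> affine_space (coeff_plane d)" by (rule pt_in_affine_space[OF c])
    obtain N1 N2 H where ch: "signature_chart d k r K1 K2 N1 N2 H" and H0: "H ?q \<noteq> 0"
      by (rule signature_chart_exists[OF d jd(2) qa p(2,3)[unfolded jd(3)]]) (rule that)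
    have zq: "z = plane_point (N1 ?q / H ?q) (N2 ?q / H ?q)"
      unfolding zp jd(3) signature_chartD(7,8)[OF ch qa H0] ..
    \<comment> \<open>The first plane coordinate stays fixed at \<open>p 0\<close>. The unknowns are
      the line parameter \<open>fst z\<close> and the second plane coordinate \<open>snd z\<close>,
      and the nonvertical tangent allows solving for the latter.\<close>
    let ?\<gamma> = "\<lambda>z :: complex \<times> complex. pt (?c (fst z)) (p 0) (snd z)"
    define A where "A = (\<lambda>z. \<Sum>i\<in>coeff_indices d. w i * peval (?\<gamma> z) (pderivative i ?U))"
    define B where "B = (\<lambda>z. peval (?\<gamma> z) (univ_y d))"
    have \<gamma>cont: "continuous_on UNIV (\<lambda>z. ?\<gamma> z i)" for i
      by (cases "i = 0"; cases "i = Suc 0") (auto intro!: continuous_intros)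
    have "((\<lambda>z. peval (?\<gamma> z) ?U) has_derivative (\<lambda>h. A z * fst h + B z * snd h)) (at z)" for z
    proof -
      have "((\<lambda>z. peval (?\<gamma> z) ?U) has_derivative
          (\<lambda>h. \<Sum>i\<in>insert (Suc 0) (coeff_indices d). (if i = Suc 0 then snd h else w i * fst h) * peval (?\<gamma> z) (pderivative i ?U))) (at z)"
      proof (rule has_derivative_peval)
        show "finite (insert (Suc 0) (coeff_indices d))" using finite_coeff_indices by simp
        fix i assume "i \<in> insert (Suc 0) (coeff_indices d)"
        then show "((\<lambda>z. ?\<gamma> z i) has_derivative (\<lambda>h. if i = Suc 0 then snd h else w i * fst h)) (at z)"
          by (cases "i = Suc 0"; cases "i = 0") (auto intro!: derivative_eq_intros)
      next
        fix i z' assume "i \<notin> insert (Suc 0) (coeff_indices d)"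
        then show "?\<gamma> z' i = ?\<gamma> z i" by (auto simp: w_def)
      qed
      moreover have "(\<Sum>i\<in>insert (Suc 0) (coeff_indices d). (if i = Suc 0 then snd h else w i * fst h) * peval (?\<gamma> z) (pderivative i ?U))
          = A z * fst h + B z * snd h" for h
      proof -
        have "(\<Sum>i\<in>coeff_indices d. (if i = Suc 0 then snd h else w i * fst h) * peval (?\<gamma> z) (pderivative i ?U)) = A z * fst h"
          unfolding A_def sum_distrib_right by (rule sum.cong) auto
        then show ?thesis using finite_coeff_indices by (simp add: B_def)
      qed
      ultimately show ?thesis by simp
    qed
    moreover have "continuous_on UNIV A" "continuous_on UNIV B"
      unfolding A_def B_def by (intro continuous_intros continuous_on_peval \<gamma>cont)+
    moreover have "?\<gamma> (0, p 1) = ?q" by simp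
    then have "peval (?\<gamma> (0, p 1)) ?U = 0" "B (0, p 1) \<noteq> 0"
      using jd(1,2) by (simp_all add: universal_curve_def B_def)
    ultimately obtain f where f: "f analytic_on {0}" "f 0 = p 1"
      "\<forall>\<^sub>F (x, y) in nhds (0, p 1). peval (?\<gamma> (x, y)) ?U = 0 \<longleftrightarrow> y = f x"
      using implicit_function[of "\<lambda>z. peval (?\<gamma> z) ?U" A B 0 "p 1"] by blast
    let ?g = "\<lambda>t. ?\<gamma> (t, f t)"
    have "isCont f 0" using f(1) analytic_at_imp_isCont by blast
    then have f0: "(f \<longlongrightarrow> p 1) (at 0)" unfolding isCont_def f(2) .
    have "((\<lambda>t. (t, f t)) \<longlongrightarrow> (0, p 1)) (at 0)" by (intro tendsto_Pair tendsto_ident_at f0)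
    then have "\<forall>\<^sub>F t in at 0. case (t, f t) of (x, y) \<Rightarrow> peval (?\<gamma> (x, y)) ?U = 0 \<longleftrightarrow> y = f x"
      by (rule eventually_compose_filterlim[OF f(3)])
    then have ev0: "\<forall>\<^sub>F t in at 0. peval (?g t) ?U = 0" by simp
    have ga: "?g t \<in> affine_space (coeff_plane d)" for t
      using pt_in_affine_space[OF caff] by simp
    have glim: "((\<lambda>t. ?g t i) \<longlongrightarrow> ?q i) (at 0)" for i
      by (cases "i = 0"; cases "i = Suc 0") (auto intro!: tendsto_eq_intros f0[unfolded One_nat_def])
    have lim: "((\<lambda>t. G (?g t)) \<longlongrightarrow> G ?q) (at 0)" if "polyfun (coeff_plane d) G" for G
      by (rule tendsto_polyfun[OF that glim ga qa])
    note pol = signature_chartD(1-3)[OF ch]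
    have evH: "\<forall>\<^sub>F t in at 0. H (?g t) \<noteq> 0"
      using lim[OF pol(3)] H0 by (rule tendsto_imp_eventually_ne)
    let ?x = "\<lambda>t. N1 (?g t) / H (?g t)" and ?y = "\<lambda>t. N2 (?g t) / H (?g t)"
    \<comment> \<open>The expansion of \<open>S\<close> divided by \<open>t ^ m\<close>; the
      division is legitimate on the punctured neighbourhood of 0.\<close>
    let ?R = "\<lambda>t x y. \<Sum>j\<in>{m..n}. t ^ (j - m) * peval (plane_point x y) (T j)"
    have "\<forall>\<^sub>F t in at 0. ?R t (?x t) (?y t) = 0"
      using ev0 evH eventually_neq_at_within[of 0 0 UNIV]
    proof eventually_elim
      case (elim t)
      have "?g t \<in> universal_curve d" using elim(1) ga by (simp add: universal_curve_def)
      then have "peval (pt (?g t) (?x t) (?y t)) S = 0"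
        by (rule bspec[OF van signature_chart_super_image[OF ch _ elim(2)]])
      moreover have "pt (?g t) u v = pt (?c t) u v" for u v by (auto simp: fun_eq_iff)
      ultimately have "t ^ m * ?R t (?x t) (?y t) = 0" unfolding exp'[symmetric] by simp
      then show ?case using elim(3) by simp
    qed
    then have "((\<lambda>t. ?R t (?x t) (?y t)) \<longlongrightarrow> 0) (at 0)" by (rule tendsto_eventually)
    moreover have "((\<lambda>t. ?R t (?x t) (?y t)) \<longlongrightarrow> (\<Sum>j\<in>{m..n}. 0 ^ (j - m) * peval z (T j))) (at 0)"
    proof -
      have xl: "(?x \<longlongrightarrow> N1 ?q / H ?q) (at 0)" and yl: "(?y \<longlongrightarrow> N2 ?q / H ?q) (at 0)"
        using tendsto_divide[OF lim[OF pol(1)] lim[OF pol(3)] H0]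
          tendsto_divide[OF lim[OF pol(2)] lim[OF pol(3)] H0] .
      have "((\<lambda>t. plane_point (?x t) (?y t) i) \<longlongrightarrow> z i) (at 0)" for i
        unfolding zq by (cases "i = 0"; cases "i = 1") (use xl yl in simp_all)
      then show ?thesis
        by (intro tendsto_sum tendsto_mult tendsto_power tendsto_ident_at tendsto_peval)
    qed
    ultimately have "(\<Sum>j\<in>{m..n}. 0 ^ (j - m) * peval z (T j)) = 0"
      using tendsto_unique[OF at_neq_bot] by blast
    \<comment> \<open>In the limit only the term \<open>j = m\<close> survives, where
      \<open>0 ^ 0 = 1\<close>.\<close>
    moreover have "(\<Sum>j\<in>{m..n}. 0 ^ (j - m) * peval z (T j)) = (\<Sum>j\<in>{m..n}. if j = m then peval z (T m) else 0)"
      by (rule sum.cong) auto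
    ultimately show ?thesis using mn by simp
  qed
  then show ?thesis using Tm T(1)[of m] T(2)[of m] by blast
qed

section \<open>Generic linear independence\<close>

lemma zero_in_affine_space [simp]: "(\<lambda>_. 0) \<in> affine_space I"
  by (simp add: affine_space_def)

text \<open>The witness is a polynomial function and not an open set, so that the elimination can
  multiply it by the pivot.\<close>

definition holds_generically :: "'v set \<Rightarrow> (('v \<Rightarrow> complex) \<Rightarrow> bool) \<Rightarrow> bool" where
  "holds_generically I P \<longleftrightarrow> (\<exists>\<Delta>. polyfun I \<Delta> \<and> (\<exists>c\<in>affine_space I. \<Delta> c \<noteq> 0) \<and>
     (\<forall>c\<in>affine_space I. \<Delta> c \<noteq> 0 \<longrightarrow> P c))"

lemma holds_generically_mono:
  assumes "holds_generically I P" "\<And>c. c \<in> affine_space I \<Longrightarrow> P c \<Longrightarrow> Q c"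
  shows "holds_generically I Q"
  using assms unfolding holds_generically_def by meson

lemma holds_generically_open:
  assumes "holds_generically I P"
  obtains V where "openin (zariski I) V" "V \<noteq> {}" "\<And>c. c \<in> V \<Longrightarrow> P c"
proof -
  obtain \<Delta> where \<Delta>: "polyfun I \<Delta>" "\<exists>c\<in>affine_space I. \<Delta> c \<noteq> 0"
    "\<forall>c\<in>affine_space I. \<Delta> c \<noteq> 0 \<longrightarrow> P c"
    using assms unfolding holds_generically_def by (elim exE conjE)
  show ?thesis
    by (rule that[of "{c \<in> affine_space I. \<Delta> c \<noteq> 0}"]) (use \<Delta> openin_zariski_polyfun in auto)
qed

text \<open>Gaussian elimination, where the value at a point \<open>z\<^sub>0\<close> serves as the pivot.\<close>

lemma generic_linear_independence:
  fixes M :: "'t \<Rightarrow> ('v::linorder \<Rightarrow> complex) \<Rightarrow> 'z \<Rightarrow> complex"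
  assumes "finite T" and "\<And>t z. t \<in> T \<Longrightarrow> polyfun I (\<lambda>c. M t c z)"
    and "\<And>\<alpha>. \<lbrakk>\<And>t. t \<in> T \<Longrightarrow> polyfun I (\<alpha> t);
        \<And>c z. c \<in> affine_space I \<Longrightarrow> (\<Sum>t\<in>T. \<alpha> t c * M t c z) = 0\<rbrakk>
      \<Longrightarrow> \<forall>t\<in>T. \<forall>c\<in>affine_space I. \<alpha> t c = 0"
  shows "holds_generically I (\<lambda>c. \<forall>a. (\<forall>z. (\<Sum>t\<in>T. a t * M t c z) = 0) \<longrightarrow> (\<forall>t\<in>T. a t = 0))"
  using assms
proof (induction T arbitrary: M rule: finite_induct)
  case empty
  have "\<exists>c. c \<in> affine_space I" by (rule exI, rule zero_in_affine_space)
  then show ?case unfolding holds_generically_def by (intro exI[of _ "\<lambda>_. 1"]) auto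
next
  case (insert s T)
  have "\<exists>z. \<exists>c\<in>affine_space I. M s c z \<noteq> 0"
  proof (rule ccontr)
    assume none: "\<not> ?thesis"
    \<comment> \<open>If \<open>M s\<close> were identically 0, the coefficient 1 at
      \<open>s\<close> alone would be a nontrivial relation.\<close>
    have "\<forall>t\<in>insert s T. \<forall>c\<in>affine_space I. (if t = s then 1 else 0 :: complex) = 0"
    proof (rule insert.prems(2)[of "\<lambda>t _. if t = s then 1 else 0"])
      fix c z assume c: "c \<in> affine_space I"
      show "(\<Sum>t\<in>insert s T. (if t = s then 1 else 0) * M t c z) = 0"
        by (rule sum.neutral) (use none c in auto)
    qed (rule polyfun_const)
    from bspec[OF bspec[OF this insertI1] zero_in_affine_space] show False by simp
  qed
  then obtain z0 c0 where c0: "c0 \<in> affine_space I" "M s c0 z0 \<noteq> 0" by blast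
  define e where "e = (\<lambda>t c. M t c z0)"
  have e: "polyfun I (e t)" if "t \<in> insert s T" for t
    unfolding e_def using insert.prems(1)[OF that] .
  \<comment> \<open>One elimination step without division: a multiple of \<open>M s\<close> is
    subtracted such that the new functions vanish at \<open>z0\<close>.\<close>
  define M' where "M' = (\<lambda>t c z. e s c * M t c z - e t c * M s c z)"
  have "holds_generically I (\<lambda>c. \<forall>a. (\<forall>z. (\<Sum>t\<in>T. a t * M' t c z) = 0) \<longrightarrow> (\<forall>t\<in>T. a t = 0))"
  proof (rule insert.IH)
    show "polyfun I (\<lambda>c. M' t c z)" if "t \<in> T" for t z
      unfolding M'_def using that by (intro polyfun_diff polyfun_mult e insert.prems(1)) auto
    fix \<alpha>
    assume \<alpha>: "\<And>t. t \<in> T \<Longrightarrow> polyfun I (\<alpha> t)"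
      and z: "\<And>c z. c \<in> affine_space I \<Longrightarrow> (\<Sum>t\<in>T. \<alpha> t c * M' t c z) = 0"
    \<comment> \<open>A relation among the functions \<open>M'\<close>, rewritten as a relation
      among the original functions; the coefficient of \<open>s\<close> collects what the
      elimination subtracted.\<close>
    define \<beta> where "\<beta> = (\<lambda>t. if t = s then (\<lambda>c. - (\<Sum>t\<in>T. \<alpha> t c * e t c)) else (\<lambda>c. \<alpha> t c * e s c))"
    have "\<forall>t\<in>insert s T. \<forall>c\<in>affine_space I. \<beta> t c = 0"
    proof (rule insert.prems(2))
      show "polyfun I (\<beta> t)" if "t \<in> insert s T" for t
        using that unfolding \<beta>_def
        by (cases "t = s") (simp_all add: polyfun_minus polyfun_sum polyfun_mult \<alpha> e)
      fix c z assume c: "c \<in> affine_space I"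
      have "(\<Sum>t\<in>T. \<beta> t c * M t c z) = (\<Sum>t\<in>T. \<alpha> t c * e s c * M t c z)"
        by (rule sum.cong) (use insert.hyps(2) in \<open>auto simp: \<beta>_def\<close>)
      then have "(\<Sum>t\<in>insert s T. \<beta> t c * M t c z) = (\<Sum>t\<in>T. \<alpha> t c * M' t c z)"
        using insert.hyps by (simp add: \<beta>_def M'_def sum_subtractf algebra_simps sum_distrib_left)
      then show "(\<Sum>t\<in>insert s T. \<beta> t c * M t c z) = 0" using z[OF c] by simp
    qed
    then have ae: "\<alpha> t c * e s c = 0" if "t \<in> T" "c \<in> affine_space I" for t c
      using that insert.hyps(2) by (auto simp: \<beta>_def dest!: bspec[of _ _ t] split: if_splits)
    have "\<forall>c\<in>affine_space I. \<alpha> t c = 0" if "t \<in> T" for t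
      using polyfun_no_zero_divisors[OF \<alpha>[OF that] e[of s] ae[OF that]] c0 by (auto simp: e_def)
    then show "\<forall>t\<in>T. \<forall>c\<in>affine_space I. \<alpha> t c = 0" by blast
  qed
  then obtain \<Delta> where \<Delta>: "polyfun I \<Delta>" "\<exists>c\<in>affine_space I. \<Delta> c \<noteq> 0"
    and ind: "\<forall>c\<in>affine_space I. \<Delta> c \<noteq> 0 \<longrightarrow>
      (\<forall>a. (\<forall>z. (\<Sum>t\<in>T. a t * M' t c z) = 0) \<longrightarrow> (\<forall>t\<in>T. a t = 0))"
    unfolding holds_generically_def by (elim exE conjE)
  \<comment> \<open>The pivot \<open>e s c\<close> must stay nonzero as well: the elimination gives
    \<open>a t = 0\<close> for \<open>t\<close> in \<open>T\<close>, and then the value at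
    \<open>z0\<close> gives \<open>a s = 0\<close>.\<close>
  show ?case
    unfolding holds_generically_def
  proof (intro exI[of _ "\<lambda>c. e s c * \<Delta> c"] conjI ballI impI allI)
    show "polyfun I (\<lambda>c. e s c * \<Delta> c)" by (intro polyfun_mult e \<Delta>(1)) simp
    show "\<exists>c\<in>affine_space I. e s c * \<Delta> c \<noteq> 0"
      using polyfun_no_zero_divisors[of I "e s" \<Delta>] e[of s] \<Delta> c0 by (auto simp: e_def)
    fix c a t
    assume c: "c \<in> affine_space I" and n: "e s c * \<Delta> c \<noteq> 0"
      and z: "\<forall>z. (\<Sum>t\<in>insert s T. a t * M t c z) = 0" and t: "t \<in> insert s T"
    have z': "(\<Sum>t\<in>T. a t * M t c z) = - a s * M s c z" for z
      using z[rule_format, of z] insert.hyps by (simp add: add_eq_0_iff)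
    have "(\<Sum>t\<in>T. a t * M' t c z) = 0" for z
    proof -
      have "(\<Sum>t\<in>T. a t * M' t c z) = e s c * (\<Sum>t\<in>T. a t * M t c z) - (\<Sum>t\<in>T. a t * e t c) * M s c z"
        by (simp add: M'_def sum_subtractf algebra_simps sum_distrib_left)
      then show ?thesis unfolding z' e_def by simp
    qed
    then have aT: "\<forall>t\<in>T. a t = 0" using bspec[OF ind c] n by simp
    then have "a s * e s c = 0" using z'[of z0] by (simp add: e_def)
    then show "a t = 0" using aT t n by auto
  qed
qed

lemma monomials_independent:
  fixes \<alpha> :: "nat \<times> nat \<Rightarrow> complex"
  assumes "finite E" "\<And>x y. (\<Sum>(i, j)\<in>E. \<alpha> (i, j) * x ^ i * y ^ j) = 0" "(i, j) \<in> E"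
  shows "\<alpha> (i, j) = 0"
proof -
  let ?P = "\<Sum>(i, j)\<in>E. monom (monom (\<alpha> (i, j)) i) j"
  have "?P = 0"
    by (rule poly2_eq_0_imp_eq_0) (use assms(2) in \<open>simp add: poly2_sum poly2_monom case_prod_beta'\<close>)
  then have "0 = coeff (coeff ?P j) i" by simp
  also have "\<dots> = (\<Sum>ab\<in>E. if ab = (i, j) then \<alpha> (i, j) else 0)"
    unfolding coeff_sum by (rule sum.cong) (auto simp: coeff_sum split: prod.splits)
  also have "\<dots> = \<alpha> (i, j)" using assms(1,3) by simp
  finally show ?thesis by simp
qed

text \<open>The degenerate line of direction 0, evaluated at \<open>t = 1\<close>.\<close>

lemma specialize_polynomial:
  fixes p :: "nat cpoly"
  shows "\<exists>w. pvars w \<subseteq> {0, 1} \<and> total_degree w \<le> degree_in {0, 1} p \<and>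
    (\<forall>x y. peval (plane_point x y) w = peval (pt c x y) p)"
proof -
  obtain T n where T: "\<And>j. pvars (T j) \<subseteq> {0, 1}" "\<And>j. total_degree (T j) \<le> degree_in {0, 1} p"
    and e: "\<And>t x y. peval (pt (\<lambda>i. c i + t * 0) x y) p = (\<Sum>j\<le>n. t ^ j * peval (plane_point x y) (T j))"
    using expand_along_line[of p c "\<lambda>_. 0"] by metis
  show ?thesis
  proof (intro exI[of _ "\<Sum>j\<le>n. T j"] conjI allI)
    show "peval (plane_point x y) (\<Sum>j\<le>n. T j) = peval (pt c x y) p" for x y
      using e[where t = 1] by (simp add: peval_sum)
  qed (intro pvars_sum degree_in_sum_le T)+
qed

lemma polyfun_pt:
  assumes "polyfun (coeff_plane d) f"
  shows "polyfun (coeff_indices d) (\<lambda>c. f (pt c x y))"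
proof (rule polyfun_comp[OF assms])
  show "polyfun (coeff_indices d) (\<lambda>c. (pt c x y) i)" for i
    by (cases "i = 0"; cases "i = Suc 0") auto
qed (rule pt_in_affine_space)

lemma polyfun_pt_plane:
  assumes "polyfun (coeff_plane d) f" "c \<in> affine_space (coeff_indices d)"
  shows "polyfun {0, 1} (\<lambda>p. f (pt c (p 0) (p 1)))"
proof (rule polyfun_comp[OF assms(1)])
  show "polyfun {0, 1} (\<lambda>p. (pt c (p 0) (p 1)) i)" for i
    by (cases "i = 0"; cases "i = Suc 0") auto
qed (rule pt_in_affine_space[OF assms(2)])

lemma curve_specialization_iff:
  assumes "c \<in> affine_space (coeff_indices d)" "p \<in> affine_space {0, 1}"
  shows "p \<in> curve (specialization d c) \<longleftrightarrow> pt c (p 0) (p 1) \<in> universal_curve d"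
  using peval_specialization_eq[of "p 0" "p 1" d c] pt_in_affine_space[OF assms(1)] assms(2)
  unfolding plane_point_eta[OF assms(2)] by (simp add: curve_def universal_curve_def)

lemma curve_subset: "curve F \<subseteq> affine_space {0, 1}"
  by (auto simp: curve_def)

lemma signature_chart_image:
  assumes ch: "signature_chart d k r K1 K2 N1 N2 H" and c: "c \<in> affine_space (coeff_indices d)"
    and p: "p \<in> curve (specialization d c)" and H: "H (pt c (p 0) (p 1)) \<noteq> 0"
  shows "plane_point (N1 (pt c (p 0) (p 1)) / H (pt c (p 0) (p 1))) (N2 (pt c (p 0) (p 1)) / H (pt c (p 0) (p 1)))
    \<in> signature_image k r K1 K2 (specialization d c)"
proof -
  let ?q = "pt c (p 0) (p 1)" and ?F = "specialization d c"
  have pa: "p \<in> affine_space {0, 1}" using p curve_subset by blast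
  have q: "?q \<in> universal_curve d" using p curve_specialization_iff[OF c pa] by simp
  have h: "peval ?q (univ_y d) \<noteq> 0" "defined_at K1 (super_jet d k ?q)" "defined_at K2 (super_jet d r ?q)"
    "rvalue K1 (super_jet d k ?q) = N1 ?q / H ?q" "rvalue K2 (super_jet d r ?q) = N2 ?q / H ?q"
    by (rule signature_chartD(4-)[OF ch pt_in_affine_space[OF c] H])+
  have jd: "jet_defined ?F p" by (rule jet_defined_specializationI[OF q h(1) pa])
  show ?thesis
    unfolding signature_image_def
    by (intro CollectI exI[of _ p])
      (simp add: restriction_defined_def restriction_def jd jet_defined_specialization(3)[OF c jd] h[unfolded One_nat_def])
qed

lemma signature_image_chart:
  assumes d: "d \<ge> 1" and c: "c \<in> affine_space (coeff_indices d)"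
    and z: "z \<in> signature_image k r K1 K2 (specialization d c)"
  obtains p N1 N2 H where "p \<in> curve (specialization d c)" "signature_chart d k r K1 K2 N1 N2 H"
    "H (pt c (p 0) (p 1)) \<noteq> 0"
    "z = plane_point (N1 (pt c (p 0) (p 1)) / H (pt c (p 0) (p 1))) (N2 (pt c (p 0) (p 1)) / H (pt c (p 0) (p 1)))"
proof -
  let ?F = "specialization d c"
  obtain p where p: "jet_defined ?F p" "defined_at K1 (jet ?F k p)" "defined_at K2 (jet ?F r p)"
    and zp: "z = plane_point (rvalue K1 (jet ?F k p)) (rvalue K2 (jet ?F r p))"
    using z by (auto simp: signature_image_def restriction_defined_def restriction_def)
  let ?q = "pt c (p 0) (p 1)"
  note jd = jet_defined_specialization[OF c p(1)]
  have qa: "?q \<in> affine_space (coeff_plane d)" by (rule pt_in_affine_space[OF c])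
  obtain N1 N2 H where ch: "signature_chart d k r K1 K2 N1 N2 H" and H0: "H ?q \<noteq> 0"
    by (rule signature_chart_exists[OF d jd(2) qa p(2,3)[unfolded jd(3)]]) (rule that)
  have "z = plane_point (N1 ?q / H ?q) (N2 ?q / H ?q)"
    unfolding zp jd(3) signature_chartD(7,8)[OF ch qa H0] ..
  moreover have "p \<in> curve ?F" using p(1) by (simp add: jet_defined_def)
  ultimately show ?thesis using that ch H0 by blast
qed

lemma signature_image_subset: "signature_image k r K1 K2 F \<subseteq> affine_space {0, 1}"
  unfolding signature_image_def using plane_point_in_affine_space by blast

text \<open>Primality is pulled back to the irreducible curve. If \<open>R\<close> is nonzero at
  some point of the image, clearing denominators gives a polynomial function on the curve whose
  nonzeros have a signature where \<open>R\<close> is nonzero. Two such functions have a nonzero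
  product somewhere on the curve.\<close>

lemma signature_image_prime:
  assumes d: "d \<ge> 1" and c: "c \<in> affine_space (coeff_indices d)"
    and irr: "irreducible_curve (specialization d c)"
  shows "vanishing_prime (signature_image k r K1 K2 (specialization d c))"
  unfolding vanishing_prime_def
proof (intro allI impI, rule ccontr)
  fix P Q
  let ?F = "specialization d c" and ?Z = "signature_image k r K1 K2 (specialization d c)"
  let ?J = "coeff_plane d"
  have lift: "\<exists>f. polyfun {0, 1} f \<and> (\<exists>p\<in>curve ?F. f p \<noteq> 0) \<and>
     (\<forall>p\<in>curve ?F. f p \<noteq> 0 \<longrightarrow> jet_defined ?F p \<and> defined_at K1 (jet ?F k p) \<and> defined_at K2 (jet ?F r p) \<and>
        peval (plane_point (rvalue K1 (jet ?F k p)) (rvalue K2 (jet ?F r p))) R \<noteq> 0)"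
    if z: "z \<in> ?Z" "peval z R \<noteq> 0" for z R
  proof -
    obtain p0 N1 N2 H where p0: "p0 \<in> curve ?F" and ch: "signature_chart d k r K1 K2 N1 N2 H"
      and H0: "H (pt c (p0 0) (p0 1)) \<noteq> 0"
      and z0: "z = plane_point (N1 (pt c (p0 0) (p0 1)) / H (pt c (p0 0) (p0 1)))
        (N2 (pt c (p0 0) (p0 1)) / H (pt c (p0 0) (p0 1)))"
      by (rule signature_image_chart[OF d c z(1)]) (rule that)
    note pol = signature_chartD(1-3)[OF ch]
    have div: "regular_off ?J H (\<lambda>q. N q / H q)" if "polyfun ?J N" for N
      unfolding regular_off_def using that by (intro exI[of _ N] exI[of _ 1]) auto
    have "regular_off ?J H (\<lambda>q. peval (plane_point (N1 q / H q) (N2 q / H q)) R)"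
    proof (rule regular_off_peval[OF pol(3)])
      fix i show "regular_off ?J H (\<lambda>q. plane_point (N1 q / H q) (N2 q / H q) i)"
        by (cases "i = 0"; cases "i = 1")
          (use div[OF pol(1)] div[OF pol(2)] regular_off_polyfun[OF polyfun_const] in simp_all)
    qed
    then obtain A e where A: "polyfun ?J A" "\<And>q. q \<in> affine_space ?J \<Longrightarrow> H q \<noteq> 0 \<Longrightarrow>
        peval (plane_point (N1 q / H q) (N2 q / H q)) R * H q ^ e = A q"
      unfolding regular_off_def by blast
    \<comment> \<open>The extra factor \<open>H\<close> confines the nonzeros of the function to
      points where the chart is valid.\<close>
    let ?f = "\<lambda>q. A q * H q"
    show ?thesis
    proof (intro exI[of _ "\<lambda>p. ?f (pt c (p 0) (p 1))"] conjI ballI impI bexI[of _ p0])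
      show "polyfun {0, 1} (\<lambda>p. ?f (pt c (p 0) (p 1)))"
        using polyfun_pt_plane[OF polyfun_mult[OF A(1) pol(3)] c] .
      show "?f (pt c (p0 0) (p0 1)) \<noteq> 0"
        using A(2)[OF pt_in_affine_space[OF c] H0] H0 z(2) unfolding z0 by auto
      fix p assume p: "p \<in> curve ?F" and n: "?f (pt c (p 0) (p 1)) \<noteq> 0"
      let ?q = "pt c (p 0) (p 1)"
      have Hq: "H ?q \<noteq> 0" "A ?q \<noteq> 0" using n by auto
      have pa: "p \<in> affine_space {0, 1}" using p curve_subset by blast
      have q: "?q \<in> universal_curve d" using p curve_specialization_iff[OF c pa] by simp
      note h = signature_chartD(4-)[OF ch pt_in_affine_space[OF c] Hq(1)]
      show jd: "jet_defined ?F p" by (rule jet_defined_specializationI[OF q h(1) pa])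
      note j = jet_defined_specialization(3)[OF c jd]
      show "defined_at K1 (jet ?F k p)" "defined_at K2 (jet ?F r p)" unfolding j by (rule h)+
      show "peval (plane_point (rvalue K1 (jet ?F k p)) (rvalue K2 (jet ?F r p))) R \<noteq> 0"
        unfolding j h(4,5) using A(2)[OF pt_in_affine_space[OF c] Hq(1)] Hq(2) by auto
    qed (rule p0)
  qed
  assume van: "\<forall>z\<in>?Z. peval z P * peval z Q = 0"
    and "\<not> ((\<forall>z\<in>?Z. peval z P = 0) \<or> (\<forall>z\<in>?Z. peval z Q = 0))"
  then obtain z z' where z: "z \<in> ?Z" "peval z P \<noteq> 0" "z' \<in> ?Z" "peval z' Q \<noteq> 0" by blast
  obtain f where f: "polyfun {0, 1} f" "\<exists>p\<in>curve ?F. f p \<noteq> 0"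
     "\<forall>p\<in>curve ?F. f p \<noteq> 0 \<longrightarrow> jet_defined ?F p \<and> defined_at K1 (jet ?F k p) \<and> defined_at K2 (jet ?F r p) \<and>
        peval (plane_point (rvalue K1 (jet ?F k p)) (rvalue K2 (jet ?F r p))) P \<noteq> 0"
    using lift[OF z(1,2)] by blast
  obtain g where g: "polyfun {0, 1} g" "\<exists>p\<in>curve ?F. g p \<noteq> 0"
     "\<forall>p\<in>curve ?F. g p \<noteq> 0 \<longrightarrow> jet_defined ?F p \<and> defined_at K1 (jet ?F k p) \<and> defined_at K2 (jet ?F r p) \<and>
        peval (plane_point (rvalue K1 (jet ?F k p)) (rvalue K2 (jet ?F r p))) Q \<noteq> 0"
    using lift[OF z(3,4)] by blast
  have "f p * g p = 0" if p: "p \<in> curve ?F" for p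
  proof (rule ccontr)
    assume "f p * g p \<noteq> 0"
    then have n: "f p \<noteq> 0" "g p \<noteq> 0" by auto
    let ?z = "plane_point (rvalue K1 (jet ?F k p)) (rvalue K2 (jet ?F r p))"
    have "?z \<in> ?Z"
      unfolding signature_image_def restriction_defined_def restriction_def using f(3) p n(1) by blast
    then have "peval ?z P * peval ?z Q = 0" by (rule bspec[OF van])
    then show False using f(3) g(3) p n by auto
  qed
  then have "(\<forall>p\<in>curve ?F. f p = 0) \<or> (\<forall>p\<in>curve ?F. g p = 0)"
    by (rule curve_vanish_mult[OF irr f(1) g(1)])
  then show False using f(2) g(2) by blast
qed

text \<open>Take a nonzero vanishing polynomial of least total degree. In a factorization one factor
  vanishes on \<open>Z\<close> by primality, and minimality leaves degree 0 for the other;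
  \<open>Z\<close> being nonempty excludes a unit.\<close>

lemma irreducible_vanishing_polynomial:
  assumes Z: "Z \<noteq> {}"
    and prime: "vanishing_prime Z"
    and S: "S \<noteq> 0" "pvars S \<subseteq> V" "\<forall>z\<in>Z. peval z S = 0"
  shows "\<exists>P :: nat cpoly. irreducible P \<and> pvars P \<subseteq> V \<and> (\<forall>z\<in>Z. peval z P = 0)"
proof -
  define X where "X = (\<lambda>P :: nat cpoly. P \<noteq> 0 \<and> pvars P \<subseteq> V \<and> (\<forall>z\<in>Z. peval z P = 0))"
  have "X S" using S by (simp add: X_def)
  then obtain P where P: "X P" "\<And>Q. X Q \<Longrightarrow> total_degree P \<le> total_degree Q"
    using arg_min_natI[of X S total_degree] arg_min_nat_le[of X _ total_degree] by blast
  have P0: "P \<noteq> 0" and PV: "pvars P \<subseteq> V" and PZ: "\<And>z. z \<in> Z \<Longrightarrow> peval z P = 0"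
    using P(1) by (auto simp: X_def)
  have unit: "B dvd 1" if e: "P = A * B" and A: "\<forall>z\<in>Z. peval z A = 0" for A B
  proof -
    have n: "A \<noteq> 0" "B \<noteq> 0" using e P0 by auto
    have "pvars A \<subseteq> V" using pvars_factor(1)[of A B V] e PV P0 by simp
    then have "X A" using n A by (simp add: X_def)
    then have "total_degree B = 0"
      using P(2)[of A] degree_in_mult[OF n, of UNIV] e by simp
    then obtain b where b: "B = cconst b" using total_degree_eq_0_imp by blast
    then show ?thesis using n(2) cconst_is_unit_iff by auto
  qed
  have "irreducible P"
  proof (rule irreducibleI[OF P0])
    show "\<not> P dvd 1"
    proof
      assume "P dvd 1"
      then have "total_degree P = 0" using degree_in_dvd_le[of P 1 UNIV] by simp
      then obtain b where "P = cconst b" using total_degree_eq_0_imp by blast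
      then show False using Z PZ P0 by auto
    qed
    fix A B assume e: "P = A * B"
    then have "(\<forall>z\<in>Z. peval z A = 0) \<or> (\<forall>z\<in>Z. peval z B = 0)"
      using vanishing_primeD[OF prime, of A B] PZ by (simp add: peval_mult)
    then show "A dvd 1 \<or> B dvd 1" using unit[of A B] unit[of B A] e by (auto simp: mult.commute)
  qed
  then show ?thesis using PV PZ by blast
qed

section \<open>The degree of the signature polynomial\<close>

text \<open>The relation is known with the fractions of one chart only. Around any other point a
  second chart is taken; both give the same signature where both are valid, and irreducibility of
  the universal curve carries the cleared relation over to the second chart.\<close>

lemma vanishes_on_super_signature_image:
  assumes d: "d \<ge> 1" "r \<ge> 1" and ch: "signature_chart d k r K1 K2 N1 N2 H"
    and q0: "q0 \<in> universal_curve d" "H q0 \<noteq> 0"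
    and E: "finite E" "\<And>a b. (a, b) \<in> E \<Longrightarrow> a + b < l"
    and A: "\<And>t. pvars (A t) \<subseteq> coeff_indices d"
    and van: "\<And>q. q \<in> universal_curve d \<Longrightarrow>
      (\<Sum>(a, b)\<in>E. peval q (A (a, b)) * (N1 q ^ a * N2 q ^ b * H q ^ (l - a - b))) = 0"
    and s: "s \<in> super_signature_image d k r K1 K2"
  shows "peval s (\<Sum>(a, b)\<in>E. A (a, b) * (cvar 0 ^ a * cvar (Suc 0) ^ b)) = 0"
proof -
  let ?J = "coeff_plane d"
  obtain q where q: "super_jet_defined d r q" "defined_at K1 (super_jet d k q)" "defined_at K2 (super_jet d r q)"
    and sq: "s = pt q (rvalue K1 (super_jet d k q)) (rvalue K2 (super_jet d r q))"
    using s unfolding super_signature_image_def by auto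
  have qU: "q \<in> universal_curve d" using q(1) by (simp add: super_jet_defined_def)
  have aff: "q \<in> affine_space ?J" if "q \<in> universal_curve d" for q
    using that by (simp add: universal_curve_def)
  have hq: "peval q (univ_y d) \<noteq> 0" by (rule nonvertical_if_super_jet_defined[OF q(1) d(2,1)])
  obtain N1' N2' H' where ch': "signature_chart d k r K1 K2 N1' N2' H'" and H': "H' q \<noteq> 0"
    by (rule signature_chart_exists[OF d(1) hq aff[OF qU] q(2,3)]) (rule that)
  note pol = signature_chartD(1-3)[OF ch] signature_chartD(1-3)[OF ch']
  have hom: "(\<Sum>(a, b)\<in>E. c (a, b) * (n1 ^ a * n2 ^ b * h ^ (l - a - b)))
      = h ^ l * (\<Sum>(a, b)\<in>E. c (a, b) * ((n1 / h) ^ a * (n2 / h) ^ b))"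
    if "h \<noteq> 0" for c and n1 n2 h :: complex
    unfolding sum_distrib_left
  proof (rule sum.cong[OF refl], clarify)
    fix a b assume "(a, b) \<in> E"
    then have "l = a + b + (l - a - b)" using E(2)[of a b] by simp
    then have "h ^ l = h ^ a * h ^ b * h ^ (l - a - b)" by (metis power_add)
    then show "c (a, b) * (n1 ^ a * n2 ^ b * h ^ (l - a - b)) = h ^ l * (c (a, b) * ((n1 / h) ^ a * (n2 / h) ^ b))"
      using that by (simp add: power_divide)
  qed
  define G where "G = (\<lambda>q. \<Sum>(a, b)\<in>E. peval q (A (a, b)) * (N1' q ^ a * N2' q ^ b * H' q ^ (l - a - b)))"
  have Gpol: "polyfun ?J G"
    unfolding G_def case_prod_beta'
    by (intro polyfun_sum polyfun_mult polyfun_power pol polyfun_comp_peval polyfun_coord)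
  \<comment> \<open>The comparison of the charts says nothing about \<open>G\<close> at zeros of
    \<open>H'\<close>, so the product \<open>H' * G\<close> is shown to vanish; at the point in
    question \<open>H'\<close> is nonzero.\<close>
  have "(\<forall>q\<in>universal_curve d. H q = 0) \<or> (\<forall>q\<in>universal_curve d. H' q * G q = 0)"
  proof (rule universal_curve_no_zero_divisors[OF pol(3) polyfun_mult[OF pol(6) Gpol]])
    fix q assume qU: "q \<in> universal_curve d"
    show "H q * (H' q * G q) = 0"
    proof (rule ccontr)
      assume "H q * (H' q * G q) \<noteq> 0"
      then have n: "H q \<noteq> 0" "H' q \<noteq> 0" "G q \<noteq> 0" by auto
      have e: "N1' q / H' q = N1 q / H q" "N2' q / H' q = N2 q / H q"
        using signature_chartD(7,8)[OF ch aff[OF qU] n(1)] signature_chartD(7,8)[OF ch' aff[OF qU] n(2)]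
        by simp_all
      have "H q ^ l * (\<Sum>(a, b)\<in>E. peval q (A (a, b)) * ((N1 q / H q) ^ a * (N2 q / H q) ^ b)) = 0"
        using van[OF qU] hom[OF n(1), of "\<lambda>t. peval q (A t)"] by simp
      then have "G q = 0" unfolding G_def hom[OF n(2), of "\<lambda>t. peval q (A t)"] e using n(1) by simp
      then show False using n(3) by simp
    qed
  qed
  then have "G q = 0" using q0 qU H' by auto
  then have G0: "(\<Sum>(a, b)\<in>E. peval q (A (a, b)) * ((N1' q / H' q) ^ a * (N2' q / H' q) ^ b)) = 0"
    unfolding G_def hom[OF H', of "\<lambda>t. peval q (A t)"] using H' by simp
  note k = signature_chartD(7,8)[OF ch' aff[OF qU] H']
  have As: "peval s (A t) = peval q (A t)" for t
    by (rule peval_cong) (use A[of t] in \<open>auto simp: sq\<close>)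
  show ?thesis
    using G0 unfolding peval_sum case_prod_beta' peval_simps As by (simp add: sq k case_prod_beta')
qed

definition monomials_independent_on :: "(nat \<times> nat) set \<Rightarrow> (nat \<Rightarrow> complex) set \<Rightarrow> bool" where
  "monomials_independent_on E Z \<longleftrightarrow> (\<forall>\<alpha>. (\<forall>z\<in>Z. (\<Sum>(a, b)\<in>E. \<alpha> (a, b) * (z 0 ^ a * z 1 ^ b)) = 0)
     \<longrightarrow> (\<forall>t\<in>E. \<alpha> t = 0))"

lemma monomials_independent_onD:
  assumes "monomials_independent_on E Z"
    "\<And>z. z \<in> Z \<Longrightarrow> (\<Sum>(a, b)\<in>E. \<alpha> (a, b) * (z 0 ^ a * z 1 ^ b)) = 0" "t \<in> E"
  shows "\<alpha> t = 0"
  using assms unfolding monomials_independent_on_def by blast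

text \<open>The hypothesis \<open>adm\<close> says that a combination of the monomials in
  \<open>E\<close> over \<open>\<complex>[c]\<close> can be a multiple of \<open>S\<close> only if
  it is 0. Keeping \<open>E\<close> general covers both uses: the monomials of degree below that of
  \<open>S\<close>, and a pair consisting of 1 and one coordinate.\<close>

theorem signature_monomials_independent:
  assumes d: "d \<ge> 1" "r \<ge> 1" and ch: "signature_chart d k r K1 K2 N1 N2 H"
    and q0: "q0 \<in> universal_curve d" "H q0 \<noteq> 0"
    and S: "super_signature_polynomial d k r K1 K2 S"
    and E: "finite E"
    and adm: "\<And>A. \<lbrakk>\<And>t. pvars (A t) \<subseteq> coeff_indices d;
        S dvd (\<Sum>(a, b)\<in>E. A (a, b) * (cvar 0 ^ a * cvar (Suc 0) ^ b))\<rbrakk>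
      \<Longrightarrow> (\<Sum>(a, b)\<in>E. A (a, b) * (cvar 0 ^ a * cvar (Suc 0) ^ b)) = 0"
  shows "holds_generically (coeff_indices d) (\<lambda>c. irreducible_curve (specialization d c) \<longrightarrow>
    monomials_independent_on E (signature_image k r K1 K2 (specialization d c)))"
proof -
  let ?I = "coeff_indices d" and ?J = "coeff_plane d" and ?U = "universal_poly d"
  note pol = signature_chartD(1-3)[OF ch]
  \<comment> \<open>The exponent exceeds every \<open>a + b\<close>, so that the cleared monomials vanish at the zeros of \<open>H\<close>.\<close>
  define l where "l = Suc (\<Sum>(a, b)\<in>E. a + b)"
  have El: "a + b < l" if "(a, b) \<in> E" for a b
    using member_le_sum[of "(a, b)" E "\<lambda>(a, b). a + b"] E that by (simp add: l_def)
  define M where "M = (\<lambda>(a, b) q. N1 q ^ a * N2 q ^ b * H q ^ (l - a - b))"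
  have Mpol: "polyfun ?J (M t)" for t
    unfolding M_def case_prod_beta' by (intro polyfun_mult polyfun_power pol)
  have "\<forall>t. \<exists>p. \<forall>q\<in>affine_space ?J. M t q = peval q p"
    using Mpol unfolding polyfun_def by blast
  then obtain P where P: "\<And>t q. q \<in> affine_space ?J \<Longrightarrow> M t q = peval q (P t)" by metis
  \<comment> \<open>A bound for the degree in \<open>x, y\<close> of all cleared monomials. It also
    bounds the cofactor when a combination of them is a multiple of the curve equation, and so fixes
    the exponents in \<open>B\<close>.\<close>
  define D where "D = (\<Sum>t\<in>E. degree_in {0, 1} (P t))"
  have PD: "degree_in {0, 1} (P t) \<le> D" if "t \<in> E" for t
    unfolding D_def using E that by (intro member_le_sum) auto
  define B where "B = {(i, j). i + j \<le> D}"
  have Bfin: "finite B" unfolding B_def by (rule finite_degree_pairs)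
  \<comment> \<open>\<open>Inl\<close> stands for a cleared signature monomial and
    \<open>Inr (i, j)\<close> for the multiple \<open>x^i y^j F\<close>.\<close>
  define T where "T = E <+> B"
  define V where "V = (\<lambda>t c z :: complex \<times> complex. case t of Inl ab \<Rightarrow> M ab (pt c (fst z) (snd z))
    | Inr (i, j) \<Rightarrow> fst z ^ i * snd z ^ j * peval (pt c (fst z) (snd z)) ?U)"
  have Tfin: "finite T" unfolding T_def using E Bfin by simp
  have split: "(\<Sum>t\<in>T. \<beta> t * V t c z) = (\<Sum>ab\<in>E. \<beta> (Inl ab) * M ab (pt c (fst z) (snd z)))
      + (\<Sum>(i, j)\<in>B. \<beta> (Inr (i, j)) * fst z ^ i * snd z ^ j) * peval (pt c (fst z) (snd z)) ?U" for \<beta> c z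
    unfolding T_def using E Bfin
    by (simp add: sum.Plus V_def sum_distrib_right case_prod_beta' mult.assoc)
  have ind: "holds_generically ?I (\<lambda>c. \<forall>a. (\<forall>z. (\<Sum>t\<in>T. a t * V t c z) = 0) \<longrightarrow> (\<forall>t\<in>T. a t = 0))"
  proof (rule generic_linear_independence[OF Tfin])
    fix t and z :: "complex \<times> complex"
    have "polyfun ?J (\<lambda>q. peval q ?U)" by (auto simp: polyfun_def)
    then show "polyfun ?I (\<lambda>c. V t c z)"
      unfolding V_def
      by (cases t) (auto intro!: polyfun_pt[OF Mpol] polyfun_mult polyfun_const polyfun_pt[of d "\<lambda>q. peval q ?U"])
  next
    fix \<alpha>
    assume \<alpha>: "\<And>t. t \<in> T \<Longrightarrow> polyfun ?I (\<alpha> t)"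
      and z: "\<And>c z. c \<in> affine_space ?I \<Longrightarrow> (\<Sum>t\<in>T. \<alpha> t c * V t c z) = 0"
    have "\<forall>t. \<exists>p. pvars p \<subseteq> ?I \<and> (t \<in> T \<longrightarrow> (\<forall>c\<in>affine_space ?I. \<alpha> t c = peval c p))"
    proof
      fix t
      show "\<exists>p. pvars p \<subseteq> ?I \<and> (t \<in> T \<longrightarrow> (\<forall>c\<in>affine_space ?I. \<alpha> t c = peval c p))"
      proof (cases "t \<in> T")
        case True
        show ?thesis by (rule polyfunE[OF \<alpha>[OF True]]) auto
      next
        case False
        then show ?thesis using pvars_cconst[of 0 ?I] by blast
      qed
    qed
    then obtain A where A: "\<And>t. pvars (A t) \<subseteq> ?I"
      "\<And>t c. t \<in> T \<Longrightarrow> c \<in> affine_space ?I \<Longrightarrow> \<alpha> t c = peval c (A t)" by metis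
    have InT: "Inl ab \<in> T" if "ab \<in> E" for ab using that by (auto simp: T_def)
    have InT': "Inr ij \<in> T" if "ij \<in> B" for ij using that by (auto simp: T_def)
    \<comment> \<open>Setting the plane coordinates to 0 extracts the coefficient vector from a
      point of the total space.\<close>
    have restr: "q(0 := 0, Suc 0 := 0) \<in> affine_space ?I" if "q \<in> affine_space ?J" for q
      using that by (auto simp: affine_space_def)
    have Aq: "\<alpha> t (q(0 := 0, Suc 0 := 0)) = peval q (A t)" if "t \<in> T" "q \<in> affine_space ?J" for t q
    proof -
      have "peval (q(0 := 0, Suc 0 := 0)) (A t) = peval q (A t)"
        by (rule peval_cong) (use A(1)[of t] in auto)
      then show ?thesis using A(2)[OF that(1) restr[OF that(2)]] by simp
    qed
    have ptq: "pt (q(0 := 0, Suc 0 := 0)) (q 0) (q (Suc 0)) = q" for q :: "nat \<Rightarrow> complex"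
      by (auto simp: fun_eq_iff)
    let ?Q = "\<Sum>(a, b)\<in>E. A (Inl (a, b)) * (cvar 0 ^ a * cvar (Suc 0) ^ b)"
    have Qvan: "\<forall>s\<in>super_signature_image d k r K1 K2. peval s ?Q = 0"
    proof
      fix s assume s: "s \<in> super_signature_image d k r K1 K2"
      show "peval s ?Q = 0"
      proof (rule vanishes_on_super_signature_image[where A = "\<lambda>t. A (Inl t)", OF d ch q0 E El A(1) _ s])
        fix q assume q: "q \<in> universal_curve d"
        then have qa: "q \<in> affine_space ?J" and U0: "peval q ?U = 0" by (auto simp: universal_curve_def)
        have "(\<Sum>ab\<in>E. \<alpha> (Inl ab) (q(0 := 0, Suc 0 := 0)) * M ab q) = 0"
          using z[OF restr[OF qa], of "(q 0, q (Suc 0))"] unfolding split by (simp only: fst_conv snd_conv ptq U0) simp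
        moreover have "(\<Sum>ab\<in>E. \<alpha> (Inl ab) (q(0 := 0, Suc 0 := 0)) * M ab q) = (\<Sum>ab\<in>E. peval q (A (Inl ab)) * M ab q)"
          by (rule sum.cong) (use Aq[OF InT qa] in simp_all)
        ultimately show "(\<Sum>(a, b)\<in>E. peval q (A (Inl (a, b))) * (N1 q ^ a * N2 q ^ b * H q ^ (l - a - b))) = 0"
          by (simp add: M_def case_prod_beta')
      qed
    qed
    have "pvars ?Q \<subseteq> ?J"
      unfolding case_prod_beta' by (intro pvars_intros order.trans[OF A(1)]) auto
    then have "S dvd ?Q" using S Qvan unfolding super_signature_polynomial_def by blast
    then have Q0: "?Q = 0" using adm[of "\<lambda>t. A (Inl t)"] A(1) by simp
    have \<alpha>E: "\<alpha> (Inl ab) c = 0" if ab: "ab \<in> E" and c: "c \<in> affine_space ?I" for ab c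
    proof -
      have "(\<Sum>(i, j)\<in>E. peval c (A (Inl (i, j))) * x ^ i * y ^ j) = 0" for x y
      proof -
        have "peval (pt c x y) (A t) = peval c (A t)" for t
          by (rule peval_cong) (use A(1)[of t] in auto)
        then show ?thesis
          using arg_cong[OF Q0, of "peval (pt c x y)"] by (simp add: peval_simps case_prod_beta' mult.assoc)
      qed
      then have "peval c (A (Inl (fst ab, snd ab))) = 0"
        using monomials_independent[OF E, of "\<lambda>t. peval c (A (Inl t))" "fst ab" "snd ab"] ab by simp
      then show ?thesis using A(2)[OF InT[OF ab] c] by simp
    qed
    let ?W = "\<lambda>q. \<Sum>(i, j)\<in>B. peval q (A (Inr (i, j))) * q 0 ^ i * q (Suc 0) ^ j"
    \<comment> \<open>With the signature coefficients gone, the relation reads \<open>?W\<close>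
      times the universal polynomial equals 0 on all of affine space, and the second factor is not
      identically 0.\<close>
    have "(\<forall>q\<in>affine_space ?J. ?W q = 0) \<or> (\<forall>q\<in>affine_space ?J. peval q ?U = 0)"
    proof (rule polyfun_no_zero_divisors)
      show "polyfun ?J ?W" unfolding case_prod_beta'
        by (intro polyfun_sum polyfun_mult polyfun_power polyfun_coord polyfun_comp_peval)
      show "polyfun ?J (\<lambda>q. peval q ?U)" by (auto simp: polyfun_def)
      fix q assume qa: "q \<in> affine_space ?J"
      have 1: "(\<Sum>ab\<in>E. \<alpha> (Inl ab) (q(0 := 0, Suc 0 := 0)) * M ab q) = 0"
        by (rule sum.neutral) (use \<alpha>E[OF _ restr[OF qa]] in simp)
      have 2: "?W q = (\<Sum>(i, j)\<in>B. \<alpha> (Inr (i, j)) (q(0 := 0, Suc 0 := 0)) * q 0 ^ i * q (Suc 0) ^ j)"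
        by (rule sum.cong) (use Aq[OF InT' qa] in auto)
      show "?W q * peval q ?U = 0"
        using z[OF restr[OF qa], of "(q 0, q (Suc 0))"] unfolding split
        by (simp only: fst_conv snd_conv ptq 1 2) simp
    qed
    moreover have "\<not> (\<forall>q\<in>affine_space ?J. peval q ?U = 0)"
    proof
      assume all: "\<forall>q\<in>affine_space ?J. peval q ?U = 0"
      have "(\<lambda>_. 0)(coeff_index 0 0 := 1 :: complex) \<in> affine_space ?J"
        by (auto simp: affine_space_def)
      then have "peval ((\<lambda>_. 0)(coeff_index 0 0 := 1)) ?U = 0" using all by blast
      moreover have "peval (\<lambda>_. 0) ?U = 0" using all by simp
      ultimately show False
        using universal_poly_update_coeff[of 0 0 d "\<lambda>_. 0" 1] by simp
    qed
    ultimately have W0: "?W q = 0" if "q \<in> affine_space ?J" for q using that by blast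
    have \<alpha>B: "\<alpha> (Inr ij) c = 0" if ij: "ij \<in> B" and c: "c \<in> affine_space ?I" for ij c
    proof -
      have "(\<Sum>(i, j)\<in>B. peval c (A (Inr (i, j))) * x ^ i * y ^ j) = 0" for x y
      proof -
        have "peval (pt c x y) (A t) = peval c (A t)" for t
          by (rule peval_cong) (use A(1)[of t] in auto)
        then show ?thesis using W0[OF pt_in_affine_space[OF c], of x y] by simp
      qed
      then have "peval c (A (Inr (fst ij, snd ij))) = 0"
        using monomials_independent[OF Bfin, of "\<lambda>t. peval c (A (Inr t))" "fst ij" "snd ij"] ij by simp
      then show ?thesis using A(2)[OF InT'[OF ij] c] by simp
    qed
    show "\<forall>t\<in>T. \<forall>c\<in>affine_space ?I. \<alpha> t c = 0"
      unfolding T_def using \<alpha>E \<alpha>B by auto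
  qed
  show ?thesis
    using ind unfolding monomials_independent_on_def
  proof (rule holds_generically_mono, intro impI allI ballI)
    fix c \<alpha> t
    assume c: "c \<in> affine_space ?I" and irr: "irreducible_curve (specialization d c)"
      and ind: "\<forall>a. (\<forall>z. (\<Sum>t\<in>T. a t * V t c z) = 0) \<longrightarrow> (\<forall>t\<in>T. a t = 0)"
      and z: "\<forall>z\<in>signature_image k r K1 K2 (specialization d c). (\<Sum>(a, b)\<in>E. \<alpha> (a, b) * (z 0 ^ a * z 1 ^ b)) = 0"
      and t: "t \<in> E"
    let ?F = "specialization d c"
    have "\<forall>t. \<exists>w. pvars w \<subseteq> {0, 1} \<and> total_degree w \<le> degree_in {0, 1} (P t) \<and>
        (\<forall>x y. peval (plane_point x y) w = peval (pt c x y) (P t))"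
      using specialize_polynomial by blast
    then obtain w where w: "\<And>t. pvars (w t) \<subseteq> {0, 1}" "\<And>t. total_degree (w t) \<le> degree_in {0, 1} (P t)"
      "\<And>t x y. peval (plane_point x y) (w t) = peval (pt c x y) (P t)" by metis
    define W where "W = (\<Sum>t\<in>E. cconst (\<alpha> t) * w t)"
    have Wv: "pvars W \<subseteq> {0, 1}" unfolding W_def by (intro pvars_intros w(1))
    have Wd: "total_degree W \<le> D"
      unfolding W_def
    proof (rule degree_in_sum_le)
      fix t assume t: "t \<in> E"
      have "total_degree (cconst (\<alpha> t) * w t) \<le> total_degree (w t)"
        using degree_in_mult_le[of UNIV "cconst (\<alpha> t)" "w t"] by simp
      then show "total_degree (cconst (\<alpha> t) * w t) \<le> D" using w(2)[of t] PD[OF t] by linarith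
    qed
    have Wp: "peval (plane_point x y) W = (\<Sum>t\<in>E. \<alpha> t * M t (pt c x y))" for x y
      unfolding W_def by (simp add: peval_simps w(3) P[OF pt_in_affine_space[OF c]])
    have "peval p W = 0" if p: "p \<in> curve ?F" for p
    proof -
      let ?q = "pt c (p 0) (p 1)"
      have pa: "p \<in> affine_space {0, 1}" using p curve_subset by blast
      have e: "peval p W = (\<Sum>t\<in>E. \<alpha> t * M t ?q)" using Wp[of "p 0" "p 1"] unfolding plane_point_eta[OF pa] .
      show ?thesis
      proof (cases "H ?q = 0")
        case True
        have "M t ?q = 0" if "t \<in> E" for t
          using El[of "fst t" "snd t"] that True by (simp add: M_def case_prod_beta')
        then show ?thesis unfolding e by simp
      next
        case False
        have "(\<Sum>(a, b)\<in>E. \<alpha> (a, b) * ((N1 ?q / H ?q) ^ a * (N2 ?q / H ?q) ^ b)) = 0"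
          using bspec[OF z signature_chart_image[OF ch c p False]] by (simp only: plane_point_simps(1,3))
        moreover have "\<alpha> t * M t ?q = H ?q ^ l * (\<alpha> t * ((N1 ?q / H ?q) ^ fst t * (N2 ?q / H ?q) ^ snd t))"
          if "t \<in> E" for t
        proof -
          have "l = fst t + snd t + (l - fst t - snd t)" using El[of "fst t" "snd t"] that by simp
          then have "H ?q ^ l = H ?q ^ fst t * H ?q ^ snd t * H ?q ^ (l - fst t - snd t)" by (metis power_add)
          then show ?thesis using False by (simp add: power_divide M_def case_prod_beta')
        qed
        then have "(\<Sum>t\<in>E. \<alpha> t * M t ?q) = H ?q ^ l * (\<Sum>t\<in>E. \<alpha> t * ((N1 ?q / H ?q) ^ fst t * (N2 ?q / H ?q) ^ snd t))"
          unfolding sum_distrib_left by (rule sum.cong[OF refl])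
        ultimately show ?thesis unfolding e by (simp add: case_prod_beta')
      qed
    qed
    then have "?F dvd W" by (rule curve_vanish_imp_dvd[OF irr Wv])
    then obtain R where R: "W = ?F * R" by (elim dvdE)
    have F0: "?F \<noteq> 0" using irr by (auto simp: irreducible_curve_def)
    \<comment> \<open>If \<open>W\<close> is nonzero, its factors have no larger degree; this is why
      the exponents in \<open>B\<close> suffice for every \<open>c\<close>.\<close>
    have Rd: "pvars R \<subseteq> {0, 1} \<and> total_degree R \<le> D"
    proof (cases "W = 0")
      case True
      then have "R = 0" using R F0 by simp
      then show ?thesis by (simp add: pvars_def)
    next
      case False
      then show ?thesis
        using pvars_factor(2)[of ?F R "{0, 1}"] degree_in_dvd_le[of R W UNIV] Wv Wd R by auto
    qed
    obtain \<beta> where \<beta>: "R = specialization D \<beta>"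
      using specialization_surj[OF conjunct1[OF Rd] conjunct2[OF Rd]] by (elim bexE)
    \<comment> \<open>The equation \<open>W - F * R = 0\<close>, written as a relation in the family
      \<open>V\<close> at the parameter \<open>c\<close>; the coefficients of \<open>R\<close> enter
      with a minus sign.\<close>
    define g where "g = (\<lambda>t. case t of Inl ab \<Rightarrow> \<alpha> ab | Inr (i, j) \<Rightarrow> - \<beta> (coeff_index i j))"
    have "(\<Sum>t\<in>T. g t * V t c z) = 0" for z
    proof -
      have "(\<Sum>(i, j)\<in>B. g (Inr (i, j)) * fst z ^ i * snd z ^ j) = - peval (plane_point (fst z) (snd z)) R"
        unfolding \<beta> peval_specialization B_def
        by (simp add: g_def case_prod_beta' sum_negf)
      moreover have "(\<Sum>ab\<in>E. g (Inl ab) * M ab (pt c (fst z) (snd z))) = peval (plane_point (fst z) (snd z)) W"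
        unfolding Wp by (simp add: g_def)
      moreover have "peval (plane_point (fst z) (snd z)) W
          = peval (pt c (fst z) (snd z)) ?U * peval (plane_point (fst z) (snd z)) R"
        unfolding R peval_mult peval_specialization_eq ..
      ultimately show ?thesis unfolding split by simp
    qed
    then have "\<forall>t\<in>T. g t = 0" using ind by blast
    then have "g (Inl t) = 0" using t by (auto simp: T_def)
    then show "\<alpha> t = 0" by (simp add: g_def)
  qed
qed

text \<open>A nonzero multiple of \<open>S\<close> has at least the degree of \<open>S\<close> in
  the variables of \<open>V\<close>. Taking both variables bounds the total degree of relations;
  taking one variable excludes relations that involve only the other.\<close>

lemma signature_admissible:
  assumes S: "S \<noteq> 0" and E: "finite E" and V: "V \<subseteq> {0, Suc 0}" and n: "n < degree_in V S"
    and dE: "\<And>a b. (a, b) \<in> E \<Longrightarrow> (if 0 \<in> V then a else 0) + (if Suc 0 \<in> V then b else 0) \<le> n"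
    and A: "\<And>t. pvars (A t) \<subseteq> coeff_indices d"
    and dvd: "S dvd (\<Sum>(a, b)\<in>E. A (a, b) * (cvar 0 ^ a * cvar (Suc 0) ^ b))"
  shows "(\<Sum>(a, b)\<in>E. A (a, b) * (cvar 0 ^ a * cvar (Suc 0) ^ b)) = 0"
proof (rule ccontr)
  let ?Q = "\<Sum>(a, b)\<in>E. A (a, b) * (cvar 0 ^ a * cvar (Suc 0) ^ b)"
  assume "?Q \<noteq> 0"
  then have "degree_in V S \<le> degree_in V ?Q" by (rule degree_in_dvd_le[OF dvd])
  moreover have "degree_in V ?Q \<le> n"
  proof (rule degree_in_sum_le, clarify)
    fix a b assume ab: "(a, b) \<in> E"
    have "coeff_indices d \<subseteq> - V" using V by auto
    then have "degree_in V (A (a, b)) = 0" using A[of "(a, b)"] pvars_subset_iff[of "A (a, b)" "- V"] by auto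
    moreover have "degree_in V (cvar i ^ m) \<le> (if i \<in> V then m else 0)" for i :: nat and m
      using degree_in_power_le[of V "cvar i" m] by (cases "i \<in> V") (simp_all add: degree_in_cvar)
    then have "degree_in V (cvar 0 ^ a * cvar (Suc 0) ^ b)
        \<le> (if 0 \<in> V then a else 0) + (if Suc 0 \<in> V then b else 0)"
      by (intro order.trans[OF degree_in_mult_le] add_mono)
    ultimately show "degree_in V (A (a, b) * (cvar 0 ^ a * cvar (Suc 0) ^ b)) \<le> n"
      using degree_in_mult_le[of V "A (a, b)" "cvar 0 ^ a * cvar (Suc 0) ^ b"] dE[OF ab] by linarith
  qed
  ultimately show False using n by simp
qed

text \<open>If the coordinate took a value other than \<open>x i\<close>, then \<open>?P\<close>
  would not vanish on \<open>Z\<close>, and the product \<open>?Q\<close> over the other values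
  would not vanish at \<open>x\<close>, although \<open>?P * ?Q\<close> vanishes on
  \<open>Z\<close>.\<close>

lemma prime_finite_imp_constant:
  assumes fin: "finite Z"
    and prime: "vanishing_prime Z"
  shows "\<exists>v. \<forall>z\<in>Z. z i = v"
proof (rule ccontr)
  assume n: "\<not> ?thesis"
  then obtain x where x: "x \<in> Z" by blast
  obtain y where y: "y \<in> Z" "y i \<noteq> x i" using n by blast
  let ?P = "cvar i - cconst (x i)"
  let ?Q = "\<Prod>w\<in>{w \<in> Z. w i \<noteq> x i}. cvar i - cconst (w i)"
  have "peval z ?P * peval z ?Q = 0" if z: "z \<in> Z" for z
  proof (cases "z i = x i")
    case False
    then have "peval z ?Q = 0" using z fin by (auto simp: peval_simps intro!: bexI[of _ z])
    then show ?thesis by simp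
  qed (simp add: peval_simps)
  from vanishing_primeD[OF prime this] show False
  proof
    assume "\<forall>z\<in>Z. peval z ?P = 0"
    then show False using y by (auto simp: peval_simps)
  next
    assume "\<forall>z\<in>Z. peval z ?Q = 0"
    then have "peval x ?Q = 0" using x by blast
    then show False using fin by (auto simp: peval_simps)
  qed
qed

lemma super_signature_polynomialD:
  assumes "super_signature_polynomial d k r K1 K2 S"
  shows "S \<noteq> 0" "pvars S \<subseteq> coeff_plane d" "\<forall>q\<in>super_signature_image d k r K1 K2. peval q S = 0"
  using assms unfolding super_signature_polynomial_def by simp_all

text \<open>Dimension 1 makes the signature infinite, and infinitely many common zeros force the
  irreducible \<open>P\<close> to divide the nonzero polynomial obtained along the line.\<close>

lemma signature_polynomial_degree_le:
  assumes d: "d \<ge> 1" and c: "c \<in> affine_space (coeff_indices d)"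
    and S: "super_signature_polynomial d k r K1 K2 S"
    and P: "signature_polynomial k r K1 K2 (specialization d c) P"
  shows "total_degree P \<le> degree_in {0, 1} S"
proof -
  let ?F = "specialization d c"
  let ?Z = "signature_image k r K1 K2 ?F"
  note Sv = super_signature_polynomialD[OF S]
  obtain S' where S': "S' \<noteq> 0" "pvars S' \<subseteq> {0, 1}" "total_degree S' \<le> degree_in {0, 1} S"
    "\<forall>z\<in>?Z. peval z S' = 0"
    using specialized_vanishing_polynomial[OF d c Sv] by (elim exE conjE)
  have Pp: "pvars P \<subseteq> {0, 1}" "irreducible P" "\<forall>\<kappa>\<in>zariski {0, 1} closure_of ?Z. peval \<kappa> P = 0"
    and dim: "krull_dim (subtopology (zariski {0, 1}) (zariski {0, 1} closure_of ?Z)) = 1"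
    using P unfolding signature_polynomial_def by blast+
  have inf: "infinite ?Z" by (rule infinite_of_krull_dim_closure_eq_1[OF signature_image_subset dim])
  have "?Z \<subseteq> zariski {0, 1} closure_of ?Z"
    using signature_image_subset by (intro closure_of_subset) simp
  then have PZ: "peval z P = 0" if "z \<in> ?Z" for z using Pp(3) that by blast
  have "P dvd S'"
  proof (rule irreducible_plane_dvd[OF Pp(1,2) S'(2)])
    have "?Z \<subseteq> {p \<in> affine_space {0, 1}. peval p P = 0 \<and> peval p S' = 0}"
      using signature_image_subset PZ S'(4) by blast
    then show "infinite {p \<in> affine_space {0, 1}. peval p P = 0 \<and> peval p S' = 0}"
      using inf finite_subset by blast
  qed
  then show ?thesis using degree_in_dvd_le[OF _ S'(1), of P UNIV] S'(3) by simp
qed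

theorem theorem3p13:
  fixes G :: "(complex^3^3) set set"
    and K1 K2 :: ratfun
    and k r d :: nat
    and W1 W2 :: "(nat \<Rightarrow> complex) set"
    and S :: "nat cpoly"
  assumes "subgroup G PGL3"
    and "closedin zariski_PGL3 G"
    and "krull_dim (subtopology zariski_PGL3 G) = enat r"
    and "r > 0"
    and "classifying G k r K1 K2"
    and "maximal_domain G k {K1} W1"
    and "maximal_domain G r {K1, K2} W2"
    and "generic_curve d (non_exceptional k r K1 K2 W1 W2)"
    and "super_signature_polynomial d k r K1 K2 S"
  shows "generic_curve d (\<lambda>F.
           (\<exists>P. signature_polynomial k r K1 K2 F P) \<and>
           (\<forall>P. signature_polynomial k r K1 K2 F P \<longrightarrow> total_degree P = degree_in {0, 1} S))
         \<and> (\<forall>F P. non_exceptional k r K1 K2 W1 W2 F \<and>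
                1 < total_degree F \<and> total_degree F \<le> d \<and>
                signature_polynomial k r K1 K2 F P \<longrightarrow>
              total_degree P \<le> degree_in {0, 1} S)"
proof
  show "\<forall>F P. non_exceptional k r K1 K2 W1 W2 F \<and> 1 < total_degree F \<and> total_degree F \<le> d \<and>
      signature_polynomial k r K1 K2 F P \<longrightarrow> total_degree P \<le> degree_in {0, 1} S"
  proof (intro allI impI, elim conjE)
    fix F P
    assume F: "non_exceptional k r K1 K2 W1 W2 F" "1 < total_degree F" "total_degree F \<le> d"
      and P: "signature_polynomial k r K1 K2 F P"
    have "pvars F \<subseteq> {0, 1}" using F(1) by (auto simp: non_exceptional_def irreducible_curve_def)
    from specialization_surj[OF this F(3)]
    obtain c where c: "c \<in> affine_space (coeff_indices d)" "F = specialization d c" by (elim bexE)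
    show "total_degree P \<le> degree_in {0, 1} S"
      using signature_polynomial_degree_le[OF _ c(1) assms(9)] P F(2,3) unfolding c(2) by simp
  qed
next
  let ?I = "coeff_indices d" and ?J = "coeff_plane d"
  let ?Z = "\<lambda>c. signature_image k r K1 K2 (specialization d c)"
  obtain U where U: "openin (zariski ?I) U" "U \<noteq> {}"
    and ne: "\<forall>c\<in>U. non_exceptional k r K1 K2 W1 W2 (specialization d c)"
    using assms(8) unfolding generic_curve_def by (elim exE conjE)
  have UI: "U \<subseteq> affine_space ?I" using openin_subset[OF U(1)] by simp
  have irr: "irreducible_curve (specialization d c)" if "c \<in> U" for c
    using bspec[OF ne that] by (simp add: non_exceptional_def)
  obtain c1 where c1: "c1 \<in> U" using U(2) by blast
  \<comment> \<open>For \<open>d = 0\<close> every specialization is a constant, which is 0 or a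
    unit and never irreducible.\<close>
  have d: "d \<ge> 1"
  proof (rule ccontr)
    assume "\<not> d \<ge> 1"
    then have "{(i, j). i + j \<le> d} = {(0, 0)}" by auto
    then have "specialization d c1 = cconst (c1 (coeff_index 0 0))" by (simp add: specialization_def)
    then have "irreducible (cconst (c1 (coeff_index 0 0)) :: nat cpoly)"
      using irr[OF c1] by (simp add: irreducible_curve_def)
    then show False
      using cconst_is_unit_iff[of "c1 (coeff_index 0 0)"] by (cases "c1 (coeff_index 0 0) = 0") (auto simp: irreducible_def)
  qed
  have r: "r \<ge> 1" using assms(4) by simp
  have c1I: "c1 \<in> affine_space ?I" using UI c1 by blast
  \<comment> \<open>The curve is infinite and all but finitely many of its points are regular. One
    regular point provides a chart whose denominator is not identically 0 on the universal
    curve.\<close>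
  obtain p where p: "p \<in> curve (specialization d c1)" "regular_point k r K1 K2 W1 W2 (specialization d c1) p"
  proof -
    have "finite {p \<in> curve (specialization d c1). \<not> regular_point k r K1 K2 W1 W2 (specialization d c1) p}"
      using bspec[OF ne c1] by (simp add: non_exceptional_def)
    then have "\<not> curve (specialization d c1) \<subseteq> {p \<in> curve (specialization d c1). \<not> regular_point k r K1 K2 W1 W2 (specialization d c1) p}"
      using infinite_curve[OF irr[OF c1]] finite_subset by blast
    then show ?thesis using that by blast
  qed
  have "jet_defined (specialization d c1) p" "jet (specialization d c1) k p \<in> W1" "jet (specialization d c1) r p \<in> W2"
    using p(2) by (auto simp: regular_point_def)
  moreover have "\<forall>p\<in>W1. defined_at K1 p" "\<forall>p\<in>W2. defined_at K2 p"
    using assms(6,7) by (auto simp: maximal_domain_def separates_orbits_def)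
  ultimately have jd: "jet_defined (specialization d c1) p" "defined_at K1 (jet (specialization d c1) k p)"
    "defined_at K2 (jet (specialization d c1) r p)" by blast+
  have "plane_point (rvalue K1 (jet (specialization d c1) k p)) (rvalue K2 (jet (specialization d c1) r p)) \<in> ?Z c1"
    unfolding signature_image_def restriction_defined_def restriction_def using jd by blast
  then obtain p0 N1 N2 H where p0: "p0 \<in> curve (specialization d c1)" and ch: "signature_chart d k r K1 K2 N1 N2 H"
    and H0: "H (pt c1 (p0 0) (p0 1)) \<noteq> 0"
    by (rule signature_image_chart[OF d c1I]) (rule that)
  define q0 where "q0 = pt c1 (p0 0) (p0 1)"
  have q0: "q0 \<in> universal_curve d" "H q0 \<noteq> 0"
    using curve_specialization_iff[OF c1I subsetD[OF curve_subset p0]] p0 H0 by (auto simp: q0_def)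
  note Sv = super_signature_polynomialD[OF assms(9)]

  \<comment> \<open>Otherwise \<open>S\<close> would be a condition on the coefficients alone that
    holds on the whole universal curve, hence at every coefficient vector whose curve has a point. A
    vector in \<open>U\<close> with \<open>S\<close> nonzero contradicts this.\<close>
  have S01: "0 \<in> pvars S \<or> Suc 0 \<in> pvars S"
  proof (rule ccontr)
    assume "\<not> ?thesis"
    then have SI: "pvars S \<subseteq> ?I" using Sv(2) by auto
    have "(\<forall>q\<in>universal_curve d. H q = 0) \<or> (\<forall>q\<in>universal_curve d. peval q S = 0)"
    proof (rule universal_curve_no_zero_divisors)
      show "polyfun ?J H" using ch unfolding signature_chart_def by blast
      show "polyfun ?J (\<lambda>q. peval q S)" by (auto simp: polyfun_def)
      fix q assume q: "q \<in> universal_curve d"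
      show "H q * peval q S = 0"
      proof (cases "H q = 0")
        case False
        have "peval (pt q (N1 q / H q) (N2 q / H q)) S = 0"
          by (rule bspec[OF Sv(3) signature_chart_super_image[OF ch q False]])
        moreover have "peval (pt q (N1 q / H q) (N2 q / H q)) S = peval q S"
          by (rule peval_cong) (use SI in auto)
        ultimately show ?thesis by simp
      qed simp
    qed
    then have S0: "\<forall>q\<in>universal_curve d. peval q S = 0" using q0 by blast
    have "\<exists>c\<in>affine_space ?I. peval c S \<noteq> 0" using eq_0_if_vanishes[OF SI] Sv(1) by blast
    then have "{c \<in> affine_space ?I. peval c S \<noteq> 0} \<noteq> {}" by blast
    then obtain c where c: "c \<in> U" "peval c S \<noteq> 0" "c \<in> affine_space ?I"
      using zariski_open_inter_nonempty[OF U openin_zariski_principal[OF SI]] by blast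
    have "curve (specialization d c) \<noteq> {}" using infinite_curve[OF irr[OF c(1)]] by auto
    then obtain p where p: "p \<in> curve (specialization d c)" by blast
    have "peval (pt c (p 0) (p 1)) S = 0"
      using S0 curve_specialization_iff[OF c(3) subsetD[OF curve_subset p]] p by blast
    moreover have "peval (pt c (p 0) (p 1)) S = peval c S"
      by (rule peval_cong) (use SI in auto)
    ultimately show False using c(2) by simp
  qed
  have degS: "degree_in V S > 0" if "i \<in> V" "i \<in> pvars S" for i V
    using that pvars_subset_iff[of S "- V"] by (cases "degree_in V S = 0") auto
  let ?D = "degree_in {0, 1} S"
  have D: "?D > 0" using S01 degS[of 0 "{0, 1}"] degS[of "Suc 0" "{0, 1}"] by auto

  \<comment> \<open>Positivity of \<open>?D\<close> makes \<open>?D - 1\<close> strictly smaller, so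
    these are exactly the monomials of degree less than \<open>?D\<close>.\<close>
  let ?E1 = "{(i, j). i + j \<le> ?D - 1}"
  have "holds_generically ?I (\<lambda>c. irreducible_curve (specialization d c) \<longrightarrow> monomials_independent_on ?E1 (?Z c))"
  proof (rule signature_monomials_independent[OF d r ch q0 assms(9) finite_degree_pairs])
    fix A :: "nat \<times> nat \<Rightarrow> nat cpoly"
    assume "\<And>t. pvars (A t) \<subseteq> ?I" "S dvd (\<Sum>(a, b)\<in>?E1. A (a, b) * (cvar 0 ^ a * cvar (Suc 0) ^ b))"
    then show "(\<Sum>(a, b)\<in>?E1. A (a, b) * (cvar 0 ^ a * cvar (Suc 0) ^ b)) = 0"
      by (rule signature_admissible[OF Sv(1) finite_degree_pairs, where V = "{0, 1}" and n = "?D - 1", rotated 3])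
        (use D in auto)
  qed
  then obtain V1 where V1: "openin (zariski ?I) V1" "V1 \<noteq> {}"
    and ind1: "\<And>c. c \<in> V1 \<Longrightarrow> irreducible_curve (specialization d c) \<longrightarrow> monomials_independent_on ?E1 (?Z c)"
    by (rule holds_generically_open) (rule that)

  \<comment> \<open>The coordinate \<open>i\<close> is chosen so that the other one,
    \<open>Suc 0 - i\<close>, occurs in \<open>S\<close>. Then no nonzero combination of 1 and
    coordinate \<open>i\<close> over the coefficient ring is a multiple of \<open>S\<close>.\<close>
  obtain i :: nat and e :: "nat \<times> nat" where ie: "(i = 0 \<and> e = (1, 0) \<and> Suc 0 \<in> pvars S) \<or> (i = Suc 0 \<and> e = (0, 1) \<and> 0 \<in> pvars S)"
    using S01 by blast
  let ?E2 = "{(0, 0), e}"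
  have "holds_generically ?I (\<lambda>c. irreducible_curve (specialization d c) \<longrightarrow> monomials_independent_on ?E2 (?Z c))"
  proof (rule signature_monomials_independent[OF d r ch q0 assms(9)])
    fix A :: "nat \<times> nat \<Rightarrow> nat cpoly"
    assume A: "\<And>t. pvars (A t) \<subseteq> ?I" "S dvd (\<Sum>(a, b)\<in>?E2. A (a, b) * (cvar 0 ^ a * cvar (Suc 0) ^ b))"
    have "0 < degree_in {Suc 0 - i} S" using ie degS[of "Suc 0 - i" "{Suc 0 - i}"] by auto
    then show "(\<Sum>(a, b)\<in>?E2. A (a, b) * (cvar 0 ^ a * cvar (Suc 0) ^ b)) = 0"
      by (intro signature_admissible[OF Sv(1) _ _ _ _ A, where V = "{Suc 0 - i}" and n = 0]) (use ie in auto)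
  qed simp
  then obtain V2 where V2: "openin (zariski ?I) V2" "V2 \<noteq> {}"
    and ind2: "\<And>c. c \<in> V2 \<Longrightarrow> irreducible_curve (specialization d c) \<longrightarrow> monomials_independent_on ?E2 (?Z c)"
    by (rule holds_generically_open) (rule that)

  have "U \<inter> V1 \<inter> V2 \<noteq> {}"
    by (rule zariski_open_inter_nonempty[OF openin_Int[OF U(1) V1(1)] zariski_open_inter_nonempty[OF U V1] V2])
  moreover have "openin (zariski ?I) (U \<inter> V1 \<inter> V2)" by (intro openin_Int U(1) V1(1) V2(1))
  moreover have "(\<exists>P. signature_polynomial k r K1 K2 (specialization d c) P) \<and>
      (\<forall>P. signature_polynomial k r K1 K2 (specialization d c) P \<longrightarrow> total_degree P = ?D)" if cV: "c \<in> U \<inter> V1 \<inter> V2" for c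
  proof -
    have c: "c \<in> affine_space ?I" and ic: "irreducible_curve (specialization d c)"
      and ind1': "monomials_independent_on ?E1 (?Z c)" and ind2': "monomials_independent_on ?E2 (?Z c)"
      using cV irr ind1 ind2 UI by blast+
    note prime = signature_image_prime[OF d c ic, of k r K1 K2]
    have inf: "infinite (?Z c)"
    proof
      assume "finite (?Z c)"
      from prime_finite_imp_constant[OF this prime, of i]
      obtain v where v: "\<forall>z\<in>?Z c. z i = v" by (elim exE)
      \<comment> \<open>A constant coordinate with value \<open>v\<close> satisfies the forbidden
        relation with coefficient \<open>- v\<close> at 1 and coefficient 1 at the
        coordinate.\<close>
      have "(if e = (0, 0) then - v else 1) = (0 :: complex)"
      proof (rule monomials_independent_onD[OF ind2', of "\<lambda>t. if t = (0, 0) then - v else 1"])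
        fix z assume "z \<in> ?Z c"
        then have "z i = v" using v by blast
        then show "(\<Sum>(a, b)\<in>?E2. (if (a, b) = (0, 0) then - v else 1) * (z 0 ^ a * z 1 ^ b)) = 0"
          using ie by auto
      qed simp
      then show False using ie by auto
    qed
    obtain S' where S': "S' \<noteq> 0" "pvars S' \<subseteq> {0, 1}" "\<forall>z\<in>?Z c. peval z S' = 0"
      using specialized_vanishing_polynomial[OF d c Sv] by (elim exE conjE)
    have "?Z c \<noteq> {}" using inf by auto
    from irreducible_vanishing_polynomial[OF this prime S']
    obtain P where P: "irreducible P" "pvars P \<subseteq> {0, 1}" "\<forall>z\<in>?Z c. peval z P = 0"
      by (elim exE conjE)
    have "krull_dim (subtopology (zariski {0, 1}) (zariski {0, 1} closure_of ?Z c)) = 1"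
      by (rule krull_dim_closure_eq_1[OF signature_image_subset inf prime P(2,1)])
        (use P(3) in simp_all)
    moreover have "peval \<kappa> P = 0" if "\<kappa> \<in> (zariski {0, 1} closure_of ?Z c)" for \<kappa>
      by (rule zariski_closure_vanish[OF P(2) _ that]) (use P(3) in simp)
    ultimately have "signature_polynomial k r K1 K2 (specialization d c) P"
      using ic P(1,2) unfolding signature_polynomial_def by blast
    moreover have "total_degree P = ?D" if P: "signature_polynomial k r K1 K2 (specialization d c) P" for P
    proof (rule antisym[OF signature_polynomial_degree_le[OF d c assms(9) P]], rule ccontr)
      assume "\<not> ?D \<le> total_degree P"
      then have Pd: "total_degree P \<le> ?D - 1" by simp
      have Pp: "pvars P \<subseteq> {0, 1}" "irreducible P"
        "\<forall>\<kappa>\<in>zariski {0, 1} closure_of ?Z c. peval \<kappa> P = 0"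
        using P unfolding signature_polynomial_def by blast+
      \<comment> \<open>Signature polynomials live in the same variables 0 and 1, so
        \<open>specialization\<close> also serves to list the coefficients of \<open>P\<close>
        against the monomials in \<open>?E1\<close>.\<close>
      obtain b where b: "P = specialization (?D - 1) b"
        using specialization_surj[OF Pp(1) Pd] by (elim bexE)
      have sub: "?Z c \<subseteq> zariski {0, 1} closure_of ?Z c"
        using signature_image_subset by (intro closure_of_subset) simp
      have b0: "b (coeff_index i j) = 0" if "i + j \<le> ?D - 1" for i j
      proof -
        have "(\<lambda>(i, j). b (coeff_index i j)) (i, j) = 0"
        proof (rule monomials_independent_onD[OF ind1'])
          fix z assume "z \<in> ?Z c"
          then have "peval z P = 0" using sub Pp(3) by blast
          then show "(\<Sum>(i, j)\<in>?E1. (\<lambda>(i, j). b (coeff_index i j)) (i, j) * (z 0 ^ i * z 1 ^ j)) = 0"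
            unfolding b peval_specialization by (simp add: case_prod_beta' mult.assoc)
        qed (use that in simp)
        then show ?thesis by simp
      qed
      have "P = 0" unfolding b specialization_def by (rule sum.neutral) (auto simp: b0)
      then show False using Pp(2) by (simp add: irreducible_def)
    qed
    ultimately show ?thesis by blast
  qed
  ultimately show "generic_curve d (\<lambda>F. (\<exists>P. signature_polynomial k r K1 K2 F P) \<and>
      (\<forall>P. signature_polynomial k r K1 K2 F P \<longrightarrow> total_degree P = ?D))"
    unfolding generic_curve_def by blast
qed

end
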